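(* Let $A\in\mathbb{C}^{n\times n}$ be Hermitian with eigenvalues $\lambda_1\ge\cdots\ge\lambda_n$ and associated orthonormal eigenvectors $x_1,\dots,x_n$. Let $1\le p$ with $2p\le n$, assume $\lambda_p>\lambda_{p+1}$, and put $\mathcal{X}=\mathrm{span}\{x_1,\dots,x_p\}$. Let $\mathcal{Y}\subset\mathbb{C}^n$ be a $p$-dimensional subspace with $\angle(\mathcal{X},\mathcal{Y})<\pi/2$, let $f$ be a function with $$\max_{j\in\{p+1,\dots,n\}}|f(\lambda_j)|<\min_{j\in\{1,\dots,p\}}|f(\lambda_j)|,$$ let $\mathcal{Y}'=f(A)\mathcal{Y}$, and let $\eta'_1\ge\cdots\ge\eta'_p$ be the Ritz values of $A$ in $\mathcal{Y}'$. Let $y_1,\dots,y_p$ be the basis of $\mathcal{Y}$ biorthogonal to $x_1,\dots,x_p$ (defined in the context), and for $i\in\{1,\dots,p\}$ let $\mathcal{X}_i=\mathrm{span}\{x_1,\dots,x_i\}$ and $\mathcal{Y}_i=\mathrm{span}\{y_1,\dots,y_i\}$. Then for each $i\in\{1,\dots,p\}$ $$\left[\frac{\lambda_1-\eta'_1}{\eta'_1-\lambda_n},\,\dots,\,\frac{\lambda_i-\eta'_i}{\eta'_i-\lambda_n}\right]\prec_w\Phi_i^2\,\widehat{\Phi}_i^2\,\tan^2\Theta(\mathcal{X}_i,\mathcal{Y}_i)\le\Phi_i^2\,\widehat{\Phi}_i^2\,\tan^2\Theta_i(\mathcal{X},\mathcal{Y}),$$ where $\Phi_i=\big[|f(\lambda_1)|^{-1},\dots,|f(\lambda_i)|^{-1}\big]^{\downarrow}$,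 $\widehat{\Phi}=\big[|f(\lambda_{p+1})|,\dots,|f(\lambda_n)|\big]^{\downarrow}$, $\widehat{\Phi}_i$ is the tuple of the first $i$ components of $\widehat{\Phi}$, and $\Theta_i(\mathcal{X},\mathcal{Y})$ is the tuple of the first $i$ components of $\Theta(\mathcal{X},\mathcal{Y})$. Products, squares and the inequality $\le$ between tuples are componentwise.
   Context: Superscript $H$ denotes the conjugate transpose. For $A=\sum_j\lambda_jx_jx_j^H$, $f(A)=\sum_j f(\lambda_j)x_jx_j^H$. The Ritz values of $A$ in a subspace $\mathcal{W}$ with orthonormal basis matrix $W$ are the eigenvalues of $W^HAW$. Under the stated assumptions $\dim\mathcal{Y}'=p$. Principal angles: for subspaces $\mathcal{U},\mathcal{V}\subset\mathbb{C}^n$ with $\dim\mathcal{U}=s\le\dim\mathcal{V}$ and orthonormal basis matrices $U,V$, the cosines of the principal angles from $\mathcal{U}$ to $\mathcal{V}$ are the $s$ singular values of $V^HU$. Arranged as $\theta_1\ge\cdots\ge\theta_s$ in $[0,\pi/2]$, they form $\Theta(\mathcal{U},\mathcal{V})=[\theta_1,\dots,\theta_s]$, and $\tan\Theta(\mathcal{U},\mathcal{V})=[\tan\theta_1,\dots,\tan\theta_s]$. The largest one, $\theta_1$, is denoted $\angle(\mathcal{U},\mathcal{V})$. Biorthogonal basis: with $X=[x_1,\dots,x_p]$ and any orthonormal basis matrix $\widetilde{Y}\in\mathbb{C}^{n\times p}$ of $\mathcal{Y}$, the matrix $X^H\widetilde{Y}$ is invertible (because $\angle(\mathcal{X},\mathcal{Y})<\pi/2$),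 and $y_i=\widetilde{Y}c_i$ where $c_1,\dots,c_p$ are the columns of $(X^H\widetilde{Y})^{-1}$; thus $x_i^Hy_j=\delta_{ij}$ for $i,j\in\{1,\dots,p\}$. Majorization: for a real tuple $a=[a_1,\dots,a_d]$, $a^{\downarrow}$ is its rearrangement in decreasing (not strictly) order. For real tuples $a,b$ of length $d$, $a\prec_w b$ means $\sum_{i=1}^k a_i^{\downarrow}\le\sum_{i=1}^k b_i^{\downarrow}$ for all $k\in\{1,\dots,d\}$. *)

theory Defs
  imports
    "Jordan_Normal_Form.Schur_Decomposition"
    "Jordan_Normal_Form.Gauss_Jordan_Elimination"
    Complex_Main
begin

abbreviation cspace :: "nat \<Rightarrow> (complex, complex vec) module" where
  "cspace n \<equiv> module_vec TYPE(complex) n"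

abbreviation cspan :: "nat \<Rightarrow> complex vec set \<Rightarrow> complex vec set" where
  "cspan n S \<equiv> LinearCombinations.module.span class_ring (cspace n) S"

abbreviation csubspace_of :: "nat \<Rightarrow> complex vec set \<Rightarrow> bool" where
  "csubspace_of n U \<equiv> VectorSpace.subspace class_ring U (cspace n)"

abbreviation csubspace_dim :: "nat \<Rightarrow> complex vec set \<Rightarrow> nat" where
  "csubspace_dim n U \<equiv> vectorspace.dim class_ring ((cspace n)\<lparr>carrier := U\<rparr>)"

definition orthonormal_basis_mat :: "nat \<Rightarrow> complex vec set \<Rightarrow> complex mat \<Rightarrow> bool" where
  "orthonormal_basis_mat n U W \<longleftrightarrow>
     dim_row W = n \<and> mat_adjoint W * W = 1\<^sub>m (dim_col W) \<and> vec_space.col_space n W = U"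

text \<open>The notions below are attached to a subspace through an arbitrarily chosen orthonormal
  basis matrix. That the choice is immaterial is shown in \<open>ritz_values_eq\<close>,
  \<open>principal_angles_eq\<close> and \<open>biorthogonal_basis_eq\<close>.\<close>

definition onb :: "nat \<Rightarrow> complex vec set \<Rightarrow> complex mat" where
  "onb n U = (SOME W. orthonormal_basis_mat n U W)"

text \<open>Tuples are lists: the \<open>j\<close>-th component of \<open>a\<close> is \<open>a ! (j - 1)\<close>.\<close>

definition decreasing :: "real list \<Rightarrow> real list" where
  "decreasing a = rev (sort a)"

definition weakly_majorized :: "real list \<Rightarrow> real list \<Rightarrow> bool" (infix "\<prec>\<^sub>w" 50) where
  "a \<prec>\<^sub>w b \<longleftrightarrow> length a = length b \<and>
     (\<forall>k\<in>{1..length a}. sum_list (take k (decreasing a)) \<le> sum_list (take k (decreasing b)))"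

abbreviation tuple_mult :: "real list \<Rightarrow> real list \<Rightarrow> real list" (infixl "\<circledast>" 70) where
  "a \<circledast> b \<equiv> map2 (*) a b"

abbreviation tuple_square :: "real list \<Rightarrow> real list" where
  "tuple_square a \<equiv> map (\<lambda>t. t\<^sup>2) a"

text \<open>Only used for Hermitian matrices, whose eigenvalues are real; they are listed with
  multiplicity, in decreasing order.\<close>

definition hermitian_eigenvalues :: "complex mat \<Rightarrow> real list" where
  "hermitian_eigenvalues M =
     rev (sorted_list_of_multiset (image_mset Re (proots (char_poly M))))"

text \<open>One singular value per column. This is the usual notion for matrices with at least as
  many rows as columns, which is the only case needed.\<close>

definition singular_values :: "complex mat \<Rightarrow> real list" where
  "singular_values M = map sqrt (hermitian_eigenvalues (mat_adjoint M * M))"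

definition ritz_values :: "nat \<Rightarrow> complex mat \<Rightarrow> complex vec set \<Rightarrow> real list" where
  "ritz_values n A U = hermitian_eigenvalues (mat_adjoint (onb n U) * A * onb n U)"

definition principal_angles :: "nat \<Rightarrow> complex vec set \<Rightarrow> complex vec set \<Rightarrow> real list" where
  "principal_angles n U V =
     decreasing (map arccos (singular_values (mat_adjoint (onb n V) * onb n U)))"

definition largest_angle :: "nat \<Rightarrow> complex vec set \<Rightarrow> complex vec set \<Rightarrow> real" where
  "largest_angle n U V = hd (principal_angles n U V)"

text \<open>The vectors \<open>x i\<close> and \<open>biorthogonal_basis n p x Y i\<close> are indexed by \<open>i \<in> {1..p}\<close>,
  whereas \<open>col\<close> counts from \<open>0\<close>.\<close>

definition biorthogonal_basis ::
  "nat \<Rightarrow> nat \<Rightarrow> (nat \<Rightarrow> complex vec) \<Rightarrow> complex vec set \<Rightarrow> nat \<Rightarrow> complex vec" where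
  "biorthogonal_basis n p x Y i =
     (let X = mat_of_cols n (map x [1..<Suc p]);
          C = the (mat_inverse (mat_adjoint X * onb n Y))
      in onb n Y *\<^sub>v col C (i - 1))"

text \<open>Entrywise form of \<open>f(A) = (\<Sum>j=1..n. f (\<lambda> j) x j (x j)\<^sup>H)\<close>, given the spectral
  decomposition \<open>(\<lambda>, x)\<close> of \<open>A\<close>.\<close>

definition matrix_function ::
  "nat \<Rightarrow> (nat \<Rightarrow> real) \<Rightarrow> (nat \<Rightarrow> complex vec) \<Rightarrow> (real \<Rightarrow> complex) \<Rightarrow> complex mat" where
  "matrix_function n lam x f =
     mat n n (\<lambda>(r, c). \<Sum>j=1..n. f (lam j) * (x j $ r) * cnj (x j $ c))"

lemma mat_adjoint_dim [simp]:
  "dim_row (mat_adjoint A) = dim_col A" "dim_col (mat_adjoint A) = dim_row A"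
  by (auto simp: mat_adjoint_def)

lemma mat_adjoint_index:
  "i < dim_col A \<Longrightarrow> j < dim_row A \<Longrightarrow> mat_adjoint A $$ (i, j) = conjugate (A $$ (j, i))"
  by (auto simp: mat_adjoint_def mat_of_rows_def)

lemma mat_adjoint_carrier: "A \<in> carrier_mat r c \<Longrightarrow> mat_adjoint A \<in> carrier_mat c r"
  by auto

lemma mat_adjoint_mult:
  fixes A B :: "complex mat"
  assumes "dim_col A = dim_row B"
  shows "mat_adjoint (A * B) = mat_adjoint B * mat_adjoint A"
  by (rule eq_matI) (use assms in \<open>auto simp: mat_adjoint_index scalar_prod_def mult.commute\<close>)

lemma mat_adjoint_adjoint: "mat_adjoint (mat_adjoint (A :: complex mat)) = A"
  by (rule eq_matI) (auto simp: mat_adjoint_index)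

lemma orthonormal_basis_mat_proj:
  assumes U: "orthonormal_basis_mat n U W" and U': "orthonormal_basis_mat n U W'"
  shows "W * (mat_adjoint W * W') = W'"
proof -
  define s where "s = dim_col W"
  have W: "W \<in> carrier_mat n s" and W': "W' \<in> carrier_mat n (dim_col W')"
    using U U' by (auto simp: orthonormal_basis_mat_def s_def)
  have cs: "vec_space.col_space n W = vec_space.col_space n W'"
    using U U' by (auto simp: orthonormal_basis_mat_def)
  have aux: "\<exists>v\<in>carrier_vec s. W *\<^sub>v v = col W' j" if j: "j < dim_col W'" for j
  proof -
    interpret vec_space "TYPE(complex)" n .
    have "W' *\<^sub>v unit_vec (dim_col W') j = col W' j"
      using j by (intro eq_vecI) auto
    moreover have "unit_vec (dim_col W') j \<in> carrier_vec (dim_col W')"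
      "col W' j \<in> carrier_vec (dim_row W')" by simp_all
    ultimately have "col W' j \<in> vec_space.col_space n W'"
      unfolding col_space_eq[OF W'] by blast
    thus ?thesis
      unfolding cs[symmetric] col_space_eq[OF W] s_def by blast
  qed
  have W1: "mat_adjoint W * W = 1\<^sub>m s"
    using U by (auto simp: orthonormal_basis_mat_def s_def)
  have WH: "mat_adjoint W \<in> carrier_mat s n" by (rule mat_adjoint_carrier[OF W])
  show ?thesis
  proof (rule mat_col_eqI)
    fix j assume j: "j < dim_col W'"
    then obtain v where v: "v \<in> carrier_vec s" and Wv: "W *\<^sub>v v = col W' j" using aux by blast
    have "col (W * (mat_adjoint W * W')) j = W *\<^sub>v (mat_adjoint W *\<^sub>v col W' j)"
      by (simp only: col_mult2[OF W mult_carrier_mat[OF WH W'] j] col_mult2[OF WH W' j])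
    also have "mat_adjoint W *\<^sub>v col W' j = (mat_adjoint W * W) *\<^sub>v v"
      unfolding Wv[symmetric] by (rule assoc_mult_mat_vec[symmetric, OF WH W v])
    also have "\<dots> = v" using v by (simp add: W1)
    finally show "col (W * (mat_adjoint W * W')) j = col W' j" by (simp add: Wv)
  qed (use carrier_matD(1)[OF W] carrier_matD(1)[OF W'] in simp_all)
qed

lemma orthonormal_basis_mat_change:
  assumes U: "orthonormal_basis_mat n U W" and U': "orthonormal_basis_mat n U W'"
  obtains Q where "dim_col W' = dim_col W" "Q \<in> carrier_mat (dim_col W) (dim_col W)"
    "W' = W * Q" "mat_adjoint Q * Q = 1\<^sub>m (dim_col W)" "Q * mat_adjoint Q = 1\<^sub>m (dim_col W)"
proof -
  define s t where "s = dim_col W" and "t = dim_col W'"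
  define Q where "Q = mat_adjoint W * W'"
  have W: "W \<in> carrier_mat n s" and W': "W' \<in> carrier_mat n t"
    and o: "mat_adjoint W * W = 1\<^sub>m s" "mat_adjoint W' * W' = 1\<^sub>m t"
    using U U' by (auto simp: orthonormal_basis_mat_def s_def t_def)
  have WH: "mat_adjoint W \<in> carrier_mat s n" and WH': "mat_adjoint W' \<in> carrier_mat t n"
    using mat_adjoint_carrier[OF W] mat_adjoint_carrier[OF W'] by auto
  have Q: "Q \<in> carrier_mat s t" using W W' by (auto simp: Q_def)
  have QH: "mat_adjoint Q = mat_adjoint W' * W"
    unfolding Q_def using W W' by (subst mat_adjoint_mult) (auto simp: mat_adjoint_adjoint)
  have WQ: "W * Q = W'" unfolding Q_def by (rule orthonormal_basis_mat_proj[OF U U'])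
  have W'Q: "W' * mat_adjoint Q = W"
    unfolding QH by (rule orthonormal_basis_mat_proj[OF U' U])
  have 1: "mat_adjoint Q * Q = 1\<^sub>m t"
    unfolding QH assoc_mult_mat[OF WH' W Q] WQ by (rule o)
  have 2: "Q * mat_adjoint Q = 1\<^sub>m s"
    unfolding assoc_mult_mat[OF WH W' mat_adjoint_carrier[OF Q], folded Q_def] W'Q by (rule o)
  have "of_nat t = (\<Sum>i<t. (mat_adjoint Q * Q) $$ (i, i))" by (simp add: 1)
  also have "\<dots> = (\<Sum>i<t. \<Sum>k<s. cnj (Q $$ (k, i)) * Q $$ (k, i))"
    using Q by (auto simp: scalar_prod_def mat_adjoint_index lessThan_atLeast0 intro!: sum.cong)
  also have "\<dots> = (\<Sum>k<s. \<Sum>i<t. Q $$ (k, i) * cnj (Q $$ (k, i)))"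
    by (subst sum.swap) (simp add: mult.commute)
  also have "\<dots> = (\<Sum>k<s. (Q * mat_adjoint Q) $$ (k, k))"
    using Q by (auto simp: scalar_prod_def mat_adjoint_index lessThan_atLeast0 intro!: sum.cong)
  also have "\<dots> = of_nat s" by (simp add: 2)
  finally have "(of_nat t :: complex) = of_nat s" .
  hence "t = s" by simp
  hence Q': "Q \<in> carrier_mat s s" and 1: "mat_adjoint Q * Q = 1\<^sub>m s" using Q 1 by simp_all
  show ?thesis
    by (rule that[OF \<open>t = s\<close>[unfolded s_def t_def] Q'[unfolded s_def] WQ[symmetric]
          1[unfolded s_def] 2[unfolded s_def]])
qed

lemma onb:
  assumes "orthonormal_basis_mat n U W"
  shows "orthonormal_basis_mat n U (onb n U)"
  unfolding onb_def by (rule someI[of _ W]) (rule assms)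

lemma hermitian_eigenvalues_conj:
  assumes "M \<in> carrier_mat s s" "Q \<in> carrier_mat s s"
    and "mat_adjoint Q * Q = 1\<^sub>m s" "Q * mat_adjoint Q = 1\<^sub>m s"
  shows "hermitian_eigenvalues (mat_adjoint Q * M * Q) = hermitian_eigenvalues M"
proof -
  have "similar_mat (mat_adjoint Q * M * Q) M"
    by (rule similar_matI[of _ _ "mat_adjoint Q" Q s]) (use assms in auto)
  thus ?thesis by (simp add: hermitian_eigenvalues_def char_poly_similar)
qed

lemma ritz_values_eq:
  assumes A: "A \<in> carrier_mat n n" and W: "orthonormal_basis_mat n U W"
  shows "ritz_values n A U = hermitian_eigenvalues (mat_adjoint W * A * W)"
proof -
  define s where "s = dim_col W"
  obtain Q where Q: "Q \<in> carrier_mat s s" "onb n U = W * Q"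
    "mat_adjoint Q * Q = 1\<^sub>m s" "Q * mat_adjoint Q = 1\<^sub>m s"
    using orthonormal_basis_mat_change[OF W onb[OF W]] unfolding s_def by metis
  have Wc: "W \<in> carrier_mat n s" using W by (auto simp: orthonormal_basis_mat_def s_def)
  have WH: "mat_adjoint W \<in> carrier_mat s n" and QH: "mat_adjoint Q \<in> carrier_mat s s"
    using Wc Q by auto
  have WHA: "mat_adjoint W * A \<in> carrier_mat s n" using WH A by (rule mult_carrier_mat)
  have "mat_adjoint (W * Q) = mat_adjoint Q * mat_adjoint W"
    by (rule mat_adjoint_mult) (use Q(1) Wc in simp)
  hence "mat_adjoint (W * Q) * A * (W * Q) = mat_adjoint Q * (mat_adjoint W * A) * (W * Q)"
    by (simp only: assoc_mult_mat[OF QH WH A])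
  also have "\<dots> = mat_adjoint Q * (mat_adjoint W * A * (W * Q))"
    by (rule assoc_mult_mat[OF QH WHA mult_carrier_mat[OF Wc Q(1)]])
  also have "\<dots> = mat_adjoint Q * (mat_adjoint W * A * W * Q)"
    by (simp only: assoc_mult_mat[OF WHA Wc Q(1)])
  also have "\<dots> = mat_adjoint Q * (mat_adjoint W * A * W) * Q"
    by (rule assoc_mult_mat[OF QH mult_carrier_mat[OF WHA Wc] Q(1), symmetric])
  finally have "mat_adjoint (W * Q) * A * (W * Q) = mat_adjoint Q * (mat_adjoint W * A * W) * Q" .
  moreover have "mat_adjoint W * A * W \<in> carrier_mat s s" by (rule mult_carrier_mat[OF WHA Wc])
  ultimately show ?thesis
    using hermitian_eigenvalues_conj Q by (simp add: ritz_values_def)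
qed

lemma principal_angles_eq:
  assumes W: "orthonormal_basis_mat n U W" and Z: "orthonormal_basis_mat n V Z"
  shows "principal_angles n U V = decreasing (map arccos (singular_values (mat_adjoint Z * W)))"
proof -
  define s t where "s = dim_col W" and "t = dim_col Z"
  obtain Q where Q: "Q \<in> carrier_mat s s" "onb n U = W * Q"
    "mat_adjoint Q * Q = 1\<^sub>m s" "Q * mat_adjoint Q = 1\<^sub>m s"
    using orthonormal_basis_mat_change[OF W onb[OF W]] unfolding s_def by metis
  obtain R where R: "R \<in> carrier_mat t t" "onb n V = Z * R"
    "mat_adjoint R * R = 1\<^sub>m t" "R * mat_adjoint R = 1\<^sub>m t"
    using orthonormal_basis_mat_change[OF Z onb[OF Z]] unfolding t_def by metis
  have Wc: "W \<in> carrier_mat n s" and Zc: "Z \<in> carrier_mat n t"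
    using W Z by (auto simp: orthonormal_basis_mat_def s_def t_def)
  define N where "N = mat_adjoint Z * W"
  have N: "N \<in> carrier_mat t s" using Wc Zc by (auto simp: N_def)
  note H = mat_adjoint_carrier
  have "mat_adjoint (Z * R) = mat_adjoint R * mat_adjoint Z"
    by (rule mat_adjoint_mult) (use R(1) Zc in simp)
  hence "mat_adjoint (Z * R) * (W * Q) = mat_adjoint R * (mat_adjoint Z * (W * Q))"
    by (simp only: assoc_mult_mat[OF H[OF R(1)] H[OF Zc] mult_carrier_mat[OF Wc Q(1)]])
  hence eq: "mat_adjoint (Z * R) * (W * Q) = mat_adjoint R * (N * Q)"
    by (simp only: N_def assoc_mult_mat[OF H[OF Zc] Wc Q(1)])
  have NQ: "N * Q \<in> carrier_mat t s" using N Q by auto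
  have "mat_adjoint (mat_adjoint R * (N * Q)) * (mat_adjoint R * (N * Q))
      = (mat_adjoint (N * Q) * R) * (mat_adjoint R * (N * Q))"
    using NQ R by (subst mat_adjoint_mult) (auto simp: mat_adjoint_adjoint)
  also have "\<dots> = mat_adjoint (N * Q) * (R * (mat_adjoint R * (N * Q)))"
    by (rule assoc_mult_mat[OF H[OF NQ] R(1) mult_carrier_mat[OF H[OF R(1)] NQ]])
  also have "R * (mat_adjoint R * (N * Q)) = N * Q"
    unfolding assoc_mult_mat[OF R(1) H[OF R(1)] NQ, symmetric] R(4) by (rule left_mult_one_mat[OF NQ])
  also have "mat_adjoint (N * Q) = mat_adjoint Q * mat_adjoint N"
    by (rule mat_adjoint_mult) (use N Q(1) in simp)
  also have "mat_adjoint Q * mat_adjoint N * (N * Q) = mat_adjoint Q * (mat_adjoint N * N) * Q"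
    by (simp only: assoc_mult_mat[OF H[OF Q(1)] H[OF N] NQ] assoc_mult_mat[OF H[OF N] N Q(1)]
        assoc_mult_mat[OF H[OF Q(1)] mult_carrier_mat[OF H[OF N] N] Q(1)])
  finally have "singular_values (mat_adjoint (Z * R) * (W * Q)) = singular_values N"
    unfolding singular_values_def eq
    by (simp only: hermitian_eigenvalues_conj[OF mult_carrier_mat[OF H[OF N] N] Q(1,3,4)])
  thus ?thesis by (simp add: principal_angles_def Q R N_def)
qed

lemma biorthogonal_basis_eq:
  assumes W: "orthonormal_basis_mat n Y W" and p: "dim_col W = p"
    and i: "i \<in> {1..p}"
    and C: "C \<in> carrier_mat p p" "mat_adjoint (mat_of_cols n (map x [1..<Suc p])) * W * C = 1\<^sub>m p"
  shows "biorthogonal_basis n p x Y i = W *\<^sub>v col C (i - 1)"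
proof -
  define X where "X = mat_of_cols n (map x [1..<Suc p])"
  have X: "X \<in> carrier_mat n p" unfolding X_def by (rule carrier_matI) (simp_all del: upt_Suc)
  obtain Q where Q: "Q \<in> carrier_mat p p" "onb n Y = W * Q"
    "mat_adjoint Q * Q = 1\<^sub>m p" "Q * mat_adjoint Q = 1\<^sub>m p"
    using orthonormal_basis_mat_change[OF W onb[OF W]] unfolding p by metis
  have Wc: "W \<in> carrier_mat n p" using W p by (auto simp: orthonormal_basis_mat_def)
  have XH: "mat_adjoint X \<in> carrier_mat p n" and QH: "mat_adjoint Q \<in> carrier_mat p p"
    using X Q by auto
  define M where "M = mat_adjoint X * (W * Q)"
  have M: "M \<in> carrier_mat p p" using XH Wc Q by (auto simp: M_def)
  define B where "B = mat_adjoint Q * C"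
  have B: "B \<in> carrier_mat p p" using QH C by (auto simp: B_def)
  have WQB: "W * Q * B = W * C"
  proof -
    have "W * Q * B = W * (Q * B)" using Wc Q B by (intro assoc_mult_mat) auto
    also have "Q * B = Q * mat_adjoint Q * C"
      unfolding B_def using Q QH C by (intro assoc_mult_mat[symmetric]) auto
    finally show ?thesis using Q C by simp
  qed
  have "M * B = mat_adjoint X * (W * Q * B)"
    unfolding M_def using XH Wc Q B by (intro assoc_mult_mat) auto
  also have "\<dots> = mat_adjoint X * W * C"
    unfolding WQB using XH Wc C by (intro assoc_mult_mat[symmetric]) auto
  also have "\<dots> = 1\<^sub>m p" using C by (simp add: X_def)
  finally have MB: "M * B = 1\<^sub>m p" .
  have BM: "B * M = 1\<^sub>m p" by (rule mat_mult_left_right_inverse[OF M B MB])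
  have "mat_inverse M \<noteq> None"
    using mat_inverse(1)[OF M] MB BM M B
    by (force simp: Units_def ring_mat_def)
  then obtain B' where B': "mat_inverse M = Some B'" by auto
  have B'2: "M * B' = 1\<^sub>m p" "B' * M = 1\<^sub>m p" "B' \<in> carrier_mat p p"
    using mat_inverse(2)[OF M B'] by auto
  have "B' = B' * (M * B)" using MB B'2 by simp
  also have "\<dots> = B' * M * B" using B'2(3) M B by (intro assoc_mult_mat[symmetric]) auto
  finally have "B' = B" using B'2 B by simp
  hence "biorthogonal_basis n p x Y i = W * Q *\<^sub>v col B (i - 1)"
    unfolding biorthogonal_basis_def Let_def X_def[symmetric] Q(2) M_def[symmetric] B' by simp
  also have "\<dots> = col (W * Q * B) (i - 1)"
    using Wc Q B i by (intro col_mult2[symmetric]) auto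
  also have "\<dots> = W *\<^sub>v col C (i - 1)"
    unfolding WQB using Wc C i by (intro col_mult2) auto
  finally show ?thesis .
qed

end

theory Submission
  imports Defs "Jordan_Normal_Form.DL_Rank"
begin

text \<open>In coordinates with respect to the eigenvectors, biorthogonality means
  \<open>y\<^sub>j = x\<^sub>j + \<Sum>\<^sub>a B\<^sub>a\<^sub>j x\<^sub>p\<^sub>+\<^sub>a\<close>. So \<open>\<Y>\<^sub>i\<close> is the graph over \<open>\<X>\<^sub>i\<close> of the matrix \<open>B\<^sub>i\<close> formed by the
  first \<open>i\<close> columns of \<open>B\<close>, and \<open>\<Y>'\<close> is the graph over \<open>\<X>\<close> of \<open>C = F\<^sub>2 B F\<^sub>1\<^sup>-\<^sup>1\<close>, where the diagonal matrices
  \<open>F\<^sub>1\<close> and \<open>F\<^sub>2\<close> contain \<open>f(\<lambda>\<^sub>1), \<dots>, f(\<lambda>\<^sub>p)\<close> and \<open>f(\<lambda>\<^sub>p\<^sub>+\<^sub>1), \<dots>, f(\<lambda>\<^sub>n)\<close>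
  (\<open>biorthogonal_basis_graph\<close>, \<open>matrix_function_cscalar\<close>). The tangents of the principal angles from
  \<open>\<X>\<^sub>i\<close> to \<open>\<Y>\<^sub>i\<close> are the singular values of \<open>B\<^sub>i\<close> (\<open>graph_angles\<close>). With \<open>\<sigma>\<close> denoting decreasing singular
  values, the theorem becomes a chain of three facts about matrices.

  First, for every set \<open>J\<close> of \<open>k\<close> indices up to \<open>i\<close>, the sum of \<open>(\<lambda>\<^sub>j - \<eta>\<^sub>j) / (\<eta>\<^sub>j - \<lambda>\<^sub>n)\<close> over \<open>J\<close> is at
  most \<open>\<sigma>\<^sub>1(C\<^sub>i)\<^sup>2 + \<dots> + \<sigma>\<^sub>k(C\<^sub>i)\<^sup>2\<close> (\<open>graph_ritz\<close>). This rests on \<open>sum_ratio_le_top_eigenvalues\<close>, an additive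
  version of Lidskii's inequality for products: the ratios \<open>(\<lambda>\<^sub>j - \<lambda>\<^sub>n) / (\<eta>\<^sub>j - \<lambda>\<^sub>n)\<close> are controlled by the
  eigenvalues of \<open>1 + C\<^sub>i\<^sup>H C\<^sub>i\<close>, the Gram matrix of the natural basis of the graph.

  Secondly, \<open>\<sigma>\<^sub>1(C\<^sub>i)\<^sup>2 + \<dots> + \<sigma>\<^sub>k(C\<^sub>i)\<^sup>2\<close> is at most the sum of the first \<open>k\<close> products of \<open>\<Phi>\<^sub>i\<^sup>2\<close>, the squares of the
  largest entries of \<open>|F\<^sub>2|\<close> and \<open>\<sigma>(B\<^sub>i)\<^sup>2\<close>, because \<open>C\<^sub>i\<close> is a product of \<open>B\<^sub>i\<close> with two diagonal
  matrices (\<open>gram_eigs_scaled\<close>, by two uses of \<open>ky_fan_product\<close>). Since the bounding tuple is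
  already decreasing, this is the majorization.

  Thirdly, \<open>\<sigma>\<^sub>l(B\<^sub>i) \<le> \<sigma>\<^sub>l(B)\<close> because \<open>B\<^sub>i\<close> consists of columns of \<open>B\<close> (\<open>gram_eigs_tail_mono\<close>), which is the
  componentwise inequality.

  All comparisons of single eigenvalues reduce to \<open>diag_form_compare\<close>, a dimension count, and all
  estimates of sums of eigenvalues to Ky Fan's principle \<open>ky_fan\<close> and summation by parts.\<close>

section \<open>Orthonormal families\<close>

definition norm_sq :: "complex vec \<Rightarrow> real" where
  "norm_sq v = (\<Sum>i<dim_vec v. (cmod (v $ i))\<^sup>2)"

lemma cscalar_self: "v \<bullet>c v = of_real (norm_sq v)"
  by (simp add: norm_sq_def scalar_prod_def complex_norm_square lessThan_atLeast0 del: of_real_power)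

lemma norm_sq_nonneg [simp]: "0 \<le> norm_sq v"
  by (simp add: norm_sq_def sum_nonneg)

lemma norm_sq_eq_0_iff: "norm_sq v = 0 \<longleftrightarrow> v = 0\<^sub>v (dim_vec v)"
  by (auto simp: norm_sq_def sum_nonneg_eq_0_iff vec_eq_iff)

lemma norm_sq_pos: "v \<in> carrier_vec s \<Longrightarrow> v \<noteq> 0\<^sub>v s \<Longrightarrow> 0 < norm_sq v"
  using norm_sq_eq_0_iff[of v] norm_sq_nonneg[of v] by (auto simp: less_le simp del: norm_sq_nonneg)

lemma cscalar_commute:
  fixes v w :: "complex vec"
  assumes "v \<in> carrier_vec s" "w \<in> carrier_vec s"
  shows "cnj (v \<bullet>c w) = w \<bullet>c v"
  using assms by (auto simp: scalar_prod_def mult.commute)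

lemma cscalar_smult_right:
  fixes v w :: "complex vec"
  assumes "v \<in> carrier_vec s" "w \<in> carrier_vec s"
  shows "v \<bullet>c (c \<cdot>\<^sub>v w) = cnj c * (v \<bullet>c w)"
  using assms by (simp add: scalar_prod_def sum_distrib_left mult_ac)

lemma adjoint_mult_vec_index:
  "a < dim_col A \<Longrightarrow> w \<in> carrier_vec (dim_row A) \<Longrightarrow>
    (mat_adjoint A *\<^sub>v w) $ a = w \<bullet>c col (A :: complex mat) a"
  by (auto simp: scalar_prod_def mat_adjoint_index mult.commute)

lemma cscalar_adjoint:
  fixes A :: "complex mat"
  assumes A: "A \<in> carrier_mat r s" and v: "v \<in> carrier_vec s" and w: "w \<in> carrier_vec r"
  shows "(A *\<^sub>v v) \<bullet>c w = v \<bullet>c (mat_adjoint A *\<^sub>v w)"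
proof -
  have "(A *\<^sub>v v) \<bullet>c w = (\<Sum>i<r. \<Sum>j<s. A $$ (i, j) * v $ j * cnj (w $ i))"
    using A v w by (simp add: scalar_prod_def lessThan_atLeast0 sum_distrib_right)
  also have "\<dots> = (\<Sum>j<s. \<Sum>i<r. A $$ (i, j) * v $ j * cnj (w $ i))"
    by (rule sum.swap)
  also have "\<dots> = v \<bullet>c (mat_adjoint A *\<^sub>v w)"
    using A v w by (auto simp: scalar_prod_def lessThan_atLeast0 sum_distrib_left mat_adjoint_index
        intro!: sum.cong)
  finally show ?thesis .
qed

lemma norm_sq_smult: "norm_sq (c \<cdot>\<^sub>v v) = (cmod c)\<^sup>2 * norm_sq v"
  by (simp add: norm_sq_def norm_mult power_mult_distrib sum_distrib_left)

lemma norm_sq_add: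
  assumes "v \<in> carrier_vec s" "w \<in> carrier_vec s" 
  shows "norm_sq (v + w) = norm_sq v + norm_sq w + 2 * Re (v \<bullet>c w)"
proof -
  have "(cmod (a + b))\<^sup>2 = (cmod a)\<^sup>2 + (cmod b)\<^sup>2 + 2 * Re (a * cnj b)" for a b
    by (simp only: cmod_power2) (simp add: power2_eq_square algebra_simps)
  thus ?thesis
    using assms by (simp add: norm_sq_def scalar_prod_def sum.distrib sum_distrib_left lessThan_atLeast0)
qed

definition family_mat :: "nat \<Rightarrow> nat \<Rightarrow> (nat \<Rightarrow> complex vec) \<Rightarrow> complex mat" where
  "family_mat s k q = mat s k (\<lambda>(a, b). q b $ a)"

lemma family_mat_carrier [simp]: "family_mat s k q \<in> carrier_mat s k"
  "dim_row (family_mat s k q) = s" "dim_col (family_mat s k q) = k"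
  by (simp_all add: family_mat_def)

lemma col_family_mat: "b < k \<Longrightarrow> q b \<in> carrier_vec s \<Longrightarrow> col (family_mat s k q) b = q b"
  by (auto simp: family_mat_def)

definition orthonormal :: "nat \<Rightarrow> nat \<Rightarrow> (nat \<Rightarrow> complex vec) \<Rightarrow> bool" where
  "orthonormal s k q \<longleftrightarrow> (\<forall>j<k. q j \<in> carrier_vec s) \<and>
     (\<forall>i<k. \<forall>j<k. q i \<bullet>c q j = (if i = j then 1 else 0))"

lemma orthonormal_carrier: "orthonormal s k q \<Longrightarrow> j < k \<Longrightarrow> q j \<in> carrier_vec s"
  by (simp add: orthonormal_def)

lemma orthonormal_norm_sq: "orthonormal s k q \<Longrightarrow> j < k \<Longrightarrow> norm_sq (q j) = 1"
  using cscalar_self[of "q j"] by (simp add: orthonormal_def)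

lemma adjoint_family_mat_index:
  "a < k \<Longrightarrow> q a \<in> carrier_vec s \<Longrightarrow> w \<in> carrier_vec s \<Longrightarrow>
    (mat_adjoint (family_mat s k q) *\<^sub>v w) $ a = w \<bullet>c q a"
  by (subst adjoint_mult_vec_index) (auto simp: col_family_mat)

lemma orthonormal_gram:
  assumes "orthonormal s k q"
  shows "mat_adjoint (family_mat s k q) * family_mat s k q = 1\<^sub>m k"
proof (rule eq_matI)
  fix i j assume "i < dim_row (1\<^sub>m k)" "j < dim_col (1\<^sub>m k)"
  hence ij: "i < k" "j < k" by auto
  have "(mat_adjoint (family_mat s k q) * family_mat s k q) $$ (i, j)
      = (mat_adjoint (family_mat s k q) *\<^sub>v q j) $ i"
    using ij assms by (simp add: col_family_mat orthonormal_carrier)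
  also have "\<dots> = q j \<bullet>c q i"
    using ij assms by (intro adjoint_family_mat_index) (auto simp: orthonormal_carrier)
  finally show "(mat_adjoint (family_mat s k q) * family_mat s k q) $$ (i, j) = 1\<^sub>m k $$ (i, j)"
    using ij assms by (auto simp: orthonormal_def)
qed auto

text \<open>For a square matrix, \<open>U\<^sup>H U = 1\<close> implies \<open>U U\<^sup>H = 1\<close>, so \<open>s\<close> orthonormal vectors of
  \<open>\<complex>\<^sup>s\<close> reproduce every inner product.\<close>

lemma parseval:
  assumes q: "orthonormal s s q" and v: "v \<in> carrier_vec s" and w: "w \<in> carrier_vec s"
  shows "v \<bullet>c w = (\<Sum>j<s. (v \<bullet>c q j) * cnj (w \<bullet>c q j))"
proof -
  define U where "U = family_mat s s q"
  have U: "U \<in> carrier_mat s s" "mat_adjoint U \<in> carrier_mat s s"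
    by (auto simp: U_def)
  have "mat_adjoint U * U = 1\<^sub>m s" unfolding U_def by (rule orthonormal_gram[OF q])
  hence UU: "U * mat_adjoint U = 1\<^sub>m s" by (rule mat_mult_left_right_inverse[OF U(2,1)])
  have "v \<bullet>c w = (U *\<^sub>v (mat_adjoint U *\<^sub>v v)) \<bullet>c w"
    using U v UU by (simp add: assoc_mult_mat_vec[symmetric])
  also have "\<dots> = (mat_adjoint U *\<^sub>v v) \<bullet>c (mat_adjoint U *\<^sub>v w)"
    using U v w by (intro cscalar_adjoint) auto
  also have "\<dots> = (\<Sum>j<s. (mat_adjoint U *\<^sub>v v) $ j * cnj ((mat_adjoint U *\<^sub>v w) $ j))"
    unfolding scalar_prod_def using U
    by (auto simp: lessThan_atLeast0 simp del: index_mult_mat_vec intro!: sum.cong)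
  also have "\<dots> = (\<Sum>j<s. (v \<bullet>c q j) * cnj (w \<bullet>c q j))"
    using v w orthonormal_carrier[OF q]
    by (intro sum.cong refl) (auto simp: U_def adjoint_family_mat_index simp del: index_mult_mat_vec)
  finally show ?thesis .
qed

lemma norm_sq_coords:
  assumes "orthonormal s s q" "v \<in> carrier_vec s"
  shows "norm_sq v = (\<Sum>j<s. (cmod (v \<bullet>c q j))\<^sup>2)"
proof -
  have "complex_of_real (norm_sq v) = of_real (\<Sum>j<s. (cmod (v \<bullet>c q j))\<^sup>2)"
    unfolding cscalar_self[symmetric] parseval[OF assms assms(2)] 
    by (simp add: complex_norm_square del: of_real_power)
  thus ?thesis by (simp only: of_real_eq_iff)
qed

lemma orthonormal_basis_eqI:
  assumes q: "orthonormal s s q" and v: "v \<in> carrier_vec s" and w: "w \<in> carrier_vec s"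
    and eq: "\<And>j. j < s \<Longrightarrow> v \<bullet>c q j = w \<bullet>c q j"
  shows "v = w"
proof -
  have "(v - w) \<bullet>c q j = 0" if "j < s" for j
    using eq[OF that] v w orthonormal_carrier[OF q that]
    by (simp add: minus_scalar_prod_distrib[of _ s])
  hence "norm_sq (v - w) = 0" using norm_sq_coords[OF q, of "v - w"] v w by simp
  hence "v - w = 0\<^sub>v s" using v w by (simp add: norm_sq_eq_0_iff)
  thus ?thesis
    using v w by (intro eq_vecI) (auto dest!: arg_cong[of _ _ "\<lambda>u. u $ _"] simp: vec_eq_iff)
qed

text \<open>Fewer than \<open>s\<close> homogeneous conditions on \<open>s\<close> unknowns: a square system with a zero row
  appended is singular. Every dimension count below goes through this lemma.\<close>

lemma exists_orthogonal:
  fixes w :: "nat \<Rightarrow> complex vec"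
  assumes "k < s" and w: "\<And>j. j < k \<Longrightarrow> w j \<in> carrier_vec s"
  obtains z where "z \<in> carrier_vec s" "z \<noteq> 0\<^sub>v s" "\<And>j. j < k \<Longrightarrow> z \<bullet>c w j = 0"
proof -
  define c where "c i = (if i < k then conjugate (w i) else 0\<^sub>v s)" for i
  define M where "M = mat\<^sub>r s s (\<lambda>i. if i = k then 0\<^sub>v s else c i)"
  have "det M = 0" unfolding M_def
    by (rule det_row_0) (use assms in \<open>auto simp: c_def\<close>)
  moreover have M: "M \<in> carrier_mat s s" by (simp add: M_def)
  ultimately obtain z where z: "z \<in> carrier_vec s" "z \<noteq> 0\<^sub>v s" "M *\<^sub>v z = 0\<^sub>v s"
    using det_0_iff_vec_prod_zero_field[OF M] by auto
  have "z \<bullet>c w j = 0" if "j < k" for j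
  proof -
    have "z \<bullet>c w j = (M *\<^sub>v z) $ j"
      using that assms z(1) by (auto simp: M_def c_def intro!: comm_scalar_prod[of _ s])
    thus ?thesis using z that assms by simp
  qed
  with z show ?thesis using that by blast
qed

lemma orthonormal_extend:
  assumes q: "orthonormal s k q" and z: "z \<in> carrier_vec s" "z \<noteq> 0\<^sub>v s" "\<And>j. j < k \<Longrightarrow> z \<bullet>c q j = 0"
  defines "v \<equiv> complex_of_real (1 / sqrt (norm_sq z)) \<cdot>\<^sub>v z"
  shows "orthonormal s (Suc k) (q(k := v))"
proof -
  have pos: "norm_sq z > 0" using z norm_sq_pos by blast
  have v: "v \<in> carrier_vec s" using z by (simp add: v_def)
  have vq: "v \<bullet>c q j = 0" "q j \<bullet>c v = 0" if "j < k" for j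
  proof -
    have c: "q j \<in> carrier_vec s" using q that by (rule orthonormal_carrier)
    show "v \<bullet>c q j = 0" unfolding v_def using c z that by simp
    thus "q j \<bullet>c v = 0" using cscalar_commute[OF v c] by simp
  qed
  have "norm_sq v = 1" using pos by (simp add: v_def norm_sq_smult norm_divide power_divide)
  hence "v \<bullet>c v = 1" by (simp add: cscalar_self)
  thus ?thesis using q v vq by (auto simp: orthonormal_def less_Suc_eq)
qed

lemma orthonormal_completion:
  assumes "orthonormal s k q" "k \<le> s"
  obtains r where "orthonormal s s r" "\<And>j. j < k \<Longrightarrow> r j = q j"
proof -
  have "\<exists>r. orthonormal s (k + d) r \<and> (\<forall>j<k. r j = q j)" if "k + d \<le> s" for d
    using that
  proof (induction d)
    case (Suc d)
    then obtain r where r: "orthonormal s (k + d) r" "\<forall>j<k. r j = q j" by auto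
    obtain z where "z \<in> carrier_vec s" "z \<noteq> 0\<^sub>v s" "\<And>j. j < k + d \<Longrightarrow> z \<bullet>c r j = 0"
      by (rule exists_orthogonal[of "k + d" s r]) (use r Suc.prems in \<open>auto simp: orthonormal_carrier\<close>)
    from orthonormal_extend[OF r(1) this] show ?case using r(2)
      by (metis add_Suc_right fun_upd_other not_add_less1)
  qed (use assms in auto)
  from this[of "s - k"] assms that show ?thesis by auto
qed

section \<open>Diagonalised quadratic forms\<close>

lemma decreasing_length [simp]: "length (decreasing a) = length a"
  by (simp add: decreasing_def)

lemma decreasing_antimono: "i \<le> j \<Longrightarrow> j < length a \<Longrightarrow> decreasing a ! j \<le> decreasing a ! i"
  by (auto simp: decreasing_def rev_nth intro!: sorted_nth_mono)

text \<open>Realises sorting by a permutation of the indices, so that eigenvectors can be carried along.\<close>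

lemma decreasing_permutes:
  obtains \<pi> where "\<pi> permutes {..<length a}" "\<And>j. j < length a \<Longrightarrow> decreasing a ! j = a ! \<pi> j"
proof -
  have "mset (decreasing a) = mset a" by (simp add: decreasing_def)
  then obtain \<pi> where "\<pi> permutes {..<length a}" "permute_list \<pi> a = decreasing a"
    by (rule mset_eq_permutation)
  thus ?thesis using that by (metis permute_list_nth)
qed

lemma decreasing_eqI:
  assumes "mset a = mset b" "\<And>i j. i \<le> j \<Longrightarrow> j < length b \<Longrightarrow> b ! j \<le> b ! i"
  shows "decreasing a = b"
proof -
  have "sorted (rev b)"
    by (rule sorted_iff_nth_mono[THEN iffD2]) (auto simp: rev_nth intro!: assms(2))
  hence "sort a = rev b" by (intro properties_for_sort) (simp_all add: assms(1))
  thus ?thesis by (simp add: decreasing_def)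
qed

text \<open>The common shape of all spectral statements below. It speaks about the form \<open>\<Phi>\<close> and not
  about a matrix, so that forms such as \<open>\<lambda>z. norm_sq (S *\<^sub>v z)\<close> or \<open>\<lambda>z. - \<Phi> z\<close> need no matrix
  of their own.\<close>

definition diag_form ::
  "nat \<Rightarrow> (complex vec \<Rightarrow> real) \<Rightarrow> (nat \<Rightarrow> real) \<Rightarrow> (nat \<Rightarrow> complex vec) \<Rightarrow> bool" where
  "diag_form s \<Phi> m q \<longleftrightarrow> orthonormal s s q \<and> (\<forall>i j. i \<le> j \<longrightarrow> j < s \<longrightarrow> m j \<le> m i) \<and>
     (\<forall>z\<in>carrier_vec s. \<Phi> z = (\<Sum>j<s. m j * (cmod (z \<bullet>c q j))\<^sup>2))"

lemma diag_formD:
  assumes "diag_form s \<Phi> m q"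
  shows "orthonormal s s q" "\<And>i j. i \<le> j \<Longrightarrow> j < s \<Longrightarrow> m j \<le> m i"
    "\<And>z. z \<in> carrier_vec s \<Longrightarrow> \<Phi> z = (\<Sum>j<s. m j * (cmod (z \<bullet>c q j))\<^sup>2)"
  using assms by (auto simp: diag_form_def)

lemma diag_form_basis:
  assumes "diag_form s \<Phi> m q" "j < s"
  shows "\<Phi> (q j) = m j"
proof -
  note D = diag_formD[OF assms(1)]
  have "\<Phi> (q j) = (\<Sum>i<s. m i * (cmod (q j \<bullet>c q i))\<^sup>2)"
    using D(1) assms(2) by (intro D(3)) (auto simp: orthonormal_carrier)
  also have "\<dots> = (\<Sum>i<s. if i = j then m i else 0)"
    using D(1) assms(2) by (intro sum.cong refl) (auto simp: orthonormal_def)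
  finally show ?thesis using assms(2) by simp
qed

lemma diag_form_sort:
  assumes q: "orthonormal s s q"
    and \<Phi>: "\<And>z. z \<in> carrier_vec s \<Longrightarrow> \<Phi> z = (\<Sum>j<s. e j * (cmod (z \<bullet>c q j))\<^sup>2)"
  obtains \<pi> where "\<pi> permutes {..<s}"
    "\<And>j. j < s \<Longrightarrow> decreasing (map e [0..<s]) ! j = e (\<pi> j)"
    "diag_form s \<Phi> (\<lambda>j. decreasing (map e [0..<s]) ! j) (\<lambda>j. q (\<pi> j))"
proof -
  obtain \<pi> where \<pi>: "\<pi> permutes {..<s}" "\<And>j. j < s \<Longrightarrow> decreasing (map e [0..<s]) ! j = map e [0..<s] ! \<pi> j"
    using decreasing_permutes[of "map e [0..<s]"] by auto
  have lt: "\<pi> j < s" if "j < s" for j using permutes_in_image[OF \<pi>(1), of j] that by auto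
  have e: "decreasing (map e [0..<s]) ! j = e (\<pi> j)" if "j < s" for j
    using \<pi>(2)[OF that] lt[OF that] by simp
  have "inj \<pi>" using \<pi>(1) by (rule permutes_inj)
  hence "orthonormal s s (\<lambda>j. q (\<pi> j))"
    using q lt by (auto simp: orthonormal_def inj_eq)
  moreover have "\<Phi> z = (\<Sum>j<s. decreasing (map e [0..<s]) ! j * (cmod (z \<bullet>c q (\<pi> j)))\<^sup>2)"
    if "z \<in> carrier_vec s" for z
    unfolding \<Phi>[OF that] by (subst sum.permute[OF \<pi>(1)]) (simp add: e)
  ultimately have "diag_form s \<Phi> (\<lambda>j. decreasing (map e [0..<s]) ! j) (\<lambda>j. q (\<pi> j))"
    unfolding diag_form_def using decreasing_antimono[of _ _ "map e [0..<s]"] by auto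
  with \<pi>(1) e show ?thesis using that by blast
qed

lemma diag_form_uminus:
  assumes "diag_form s \<Phi> m q"
  shows "diag_form s (\<lambda>z. - \<Phi> z) (\<lambda>j. - m (s - 1 - j)) (\<lambda>j. q (s - 1 - j))"
proof -
  note D = diag_formD[OF assms]
  have "orthonormal s s (\<lambda>j. q (s - 1 - j))" using D(1) by (auto simp: orthonormal_def)
  moreover have "- \<Phi> z = (\<Sum>j<s. - m (s - 1 - j) * (cmod (z \<bullet>c q (s - 1 - j)))\<^sup>2)"
    if "z \<in> carrier_vec s" for z
    unfolding D(3)[OF that] sum_negf[symmetric]
    by (subst sum.nat_diff_reindex[symmetric]) simp
  ultimately show ?thesis unfolding diag_form_def using D(2) by auto
qed

text \<open>The one min-max argument of the development. On the span of \<open>q 0, \<dots>, q j\<close> the form \<open>\<Phi>\<close> is at least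
  \<open>m j\<close> times the squared norm, on the span of \<open>r j, \<dots>, r (t - 1)\<close> the form \<open>\<Psi>\<close> is at most \<open>n j\<close>
  times it, and by counting dimensions some nonzero vector of the first span is mapped into the second one.
  Interlacing, monotonicity and uniqueness of eigenvalues follow by comparing \<open>\<Phi> z\<close> with
  \<open>\<Psi> (L z)\<close> at this single vector.\<close>

lemma diag_form_compare:
  fixes L :: "complex mat"
  assumes \<Phi>: "diag_form s \<Phi> m q" and \<Psi>: "diag_form t \<Psi> n r"
    and L: "L \<in> carrier_mat t s" and j: "j < s" "j < t"
  obtains z where "z \<in> carrier_vec s" "0 < norm_sq z" "m j * norm_sq z \<le> \<Phi> z"
    "\<Psi> (L *\<^sub>v z) \<le> n j * norm_sq (L *\<^sub>v z)"
proof -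
  note P = diag_formD[OF \<Phi>] and R = diag_formD[OF \<Psi>]
  \<comment> \<open>\<open>L z\<close> must be orthogonal to \<open>r i\<close> for \<open>i < j\<close> and \<open>z\<close> to \<open>q i\<close> for \<open>i > j\<close>: \<open>s - 1\<close> conditions on \<open>z\<close>,
    listed as one family \<open>w\<close>.\<close>
  define w where "w i = (if i < j then mat_adjoint L *\<^sub>v r i else q (Suc i))" for i
  have w: "w i \<in> carrier_vec s" if "i < s - 1" for i
    using that j mult_mat_vec_carrier[OF mat_adjoint_carrier[OF L] orthonormal_carrier[OF R(1), of i]]
      orthonormal_carrier[OF P(1), of "Suc i"]
    by (auto simp: w_def)
  obtain z where z: "z \<in> carrier_vec s" "z \<noteq> 0\<^sub>v s" and zw: "\<And>i. i < s - 1 \<Longrightarrow> z \<bullet>c w i = 0"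
    using exists_orthogonal[of "s - 1" s w] w j by auto
  have Lz: "L *\<^sub>v z \<in> carrier_vec t" using L z by simp
  have zq: "z \<bullet>c q i = 0" if "j < i" "i < s" for i
    using zw[of "i - 1"] that by (cases i) (auto simp: w_def)
  have zr: "(L *\<^sub>v z) \<bullet>c r i = 0" if "i < j" for i
    using zw[of i] that j cscalar_adjoint[OF L z(1) orthonormal_carrier[OF R(1), of i]]
    by (auto simp: w_def)
  have "m j * norm_sq z = (\<Sum>i<s. m j * (cmod (z \<bullet>c q i))\<^sup>2)"
    by (simp add: norm_sq_coords[OF P(1) z(1)] sum_distrib_left)
  also have "\<dots> \<le> (\<Sum>i<s. m i * (cmod (z \<bullet>c q i))\<^sup>2)"
  proof (rule sum_mono)
    fix i assume "i \<in> {..<s}"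
    thus "m j * (cmod (z \<bullet>c q i))\<^sup>2 \<le> m i * (cmod (z \<bullet>c q i))\<^sup>2"
      using zq[of i] P(2)[of i j] j by (cases "j < i") (auto intro!: mult_right_mono)
  qed
  finally have 1: "m j * norm_sq z \<le> \<Phi> z" using P(3)[OF z(1)] by simp
  have "(\<Sum>i<t. n i * (cmod ((L *\<^sub>v z) \<bullet>c r i))\<^sup>2) \<le> (\<Sum>i<t. n j * (cmod ((L *\<^sub>v z) \<bullet>c r i))\<^sup>2)"
  proof (rule sum_mono)
    fix i assume "i \<in> {..<t}"
    thus "n i * (cmod ((L *\<^sub>v z) \<bullet>c r i))\<^sup>2 \<le> n j * (cmod ((L *\<^sub>v z) \<bullet>c r i))\<^sup>2"
      using zr[of i] R(2)[of j i] j by (cases "i < j") (auto intro!: mult_right_mono)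
  qed
  hence 2: "\<Psi> (L *\<^sub>v z) \<le> n j * norm_sq (L *\<^sub>v z)"
    by (simp add: norm_sq_coords[OF R(1) Lz] sum_distrib_left R(3)[OF Lz])
  show ?thesis using that z(1) norm_sq_pos[OF z] 1 2 by blast
qed

lemma diag_form_le:
  assumes "diag_form s \<Phi> m q" "diag_form s \<Psi> n r" "\<And>z. z \<in> carrier_vec s \<Longrightarrow> \<Phi> z \<le> \<Psi> z" "j < s"
  shows "m j \<le> n j"
proof -
  obtain z where z: "z \<in> carrier_vec s" "0 < norm_sq z" "m j * norm_sq z \<le> \<Phi> z"
    "\<Psi> (1\<^sub>m s *\<^sub>v z) \<le> n j * norm_sq (1\<^sub>m s *\<^sub>v z)"
    using diag_form_compare[OF assms(1,2) one_carrier_mat assms(4,4)] by blast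
  have "m j * norm_sq z \<le> n j * norm_sq z" using z(1,3,4) assms(3)[OF z(1)] by auto
  thus ?thesis using z(2) by simp
qed

lemma diag_form_unique:
  assumes "diag_form s \<Phi> m q" "diag_form s \<Psi> n r" "\<And>z. z \<in> carrier_vec s \<Longrightarrow> \<Phi> z = \<Psi> z" "j < s"
  shows "m j = n j"
  using diag_form_le[OF assms(1,2) _ assms(4)] diag_form_le[OF assms(2,1) _ assms(4)] assms(3)
  by (simp add: order.antisym)

section \<open>Spectral theorem for Hermitian matrices\<close>

lemma exists_eigenvector:
  fixes M :: "complex mat"
  assumes M: "M \<in> carrier_mat s s" and s: "0 < s"
  obtains u e where "u \<in> carrier_vec s" "u \<noteq> 0\<^sub>v s" "M *\<^sub>v u = e \<cdot>\<^sub>v u"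
proof -
  have "degree (char_poly M) = s" using degree_monic_char_poly[OF M] by simp
  hence "\<not> constant (poly (char_poly M))" using s by (simp add: constant_degree)
  then obtain e where "poly (char_poly M) e = 0"
    using fundamental_theorem_of_algebra by blast
  hence "eigenvalue M e" using eigenvalue_root_char_poly[OF M] by simp
  thus ?thesis using that M unfolding eigenvalue_def eigenvector_def by auto
qed

text \<open>An orthonormal family of \<open>k < s\<close> eigenvectors spans an invariant subspace, whose orthogonal complement
  is invariant because \<open>M\<close> is Hermitian. The compression of \<open>M\<close> to that complement has an eigenvector,
  and it is an eigenvector of \<open>M\<close> itself.\<close>

lemma hermitian_eigenfamily:
  fixes M :: "complex mat"
  assumes M: "M \<in> carrier_mat s s" and herm: "mat_adjoint M = M"
  shows "\<exists>q e. orthonormal s s q \<and> (\<forall>j<s. M *\<^sub>v q j = complex_of_real (e j) \<cdot>\<^sub>v q j)"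
proof -
  have sym: "(M *\<^sub>v v) \<bullet>c w = v \<bullet>c (M *\<^sub>v w)" if "v \<in> carrier_vec s" "w \<in> carrier_vec s" for v w
    using cscalar_adjoint[OF M that] by (simp add: herm)
  have "\<exists>q e. orthonormal s k q \<and> (\<forall>j<k. M *\<^sub>v q j = complex_of_real (e j) \<cdot>\<^sub>v q j)" if "k \<le> s" for k
    using that
  proof (induction k)
    case 0
    show ?case by (auto simp: orthonormal_def)
  next
    case (Suc k)
    then obtain q e where q: "orthonormal s k q" and e: "\<And>j. j < k \<Longrightarrow> M *\<^sub>v q j = complex_of_real (e j) \<cdot>\<^sub>v q j"
      by auto
    obtain r where r: "orthonormal s s r" and rq: "\<And>j. j < k \<Longrightarrow> r j = q j"
      using orthonormal_completion[OF q] Suc.prems by auto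
    define N where "N = family_mat s (s - k) (\<lambda>a. r (k + a))"
    have N: "N \<in> carrier_mat s (s - k)" "mat_adjoint N \<in> carrier_mat (s - k) s"
      by (auto simp: N_def)
    have rc: "r j \<in> carrier_vec s" if "j < s" for j using r that by (rule orthonormal_carrier)
    have Ni: "(mat_adjoint N *\<^sub>v w) $ a = w \<bullet>c r (k + a)" if "w \<in> carrier_vec s" "a < s - k" for w a
      unfolding N_def using that rc by (intro adjoint_family_mat_index) auto
    have H: "mat_adjoint N * M * N \<in> carrier_mat (s - k) (s - k)" using N M by auto
    obtain u c where u: "u \<in> carrier_vec (s - k)" "u \<noteq> 0\<^sub>v (s - k)"
      and Hu: "mat_adjoint N * M * N *\<^sub>v u = c \<cdot>\<^sub>v u"
      using exists_eigenvector[OF H] Suc.prems by auto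
    have Hu': "mat_adjoint N *\<^sub>v (M *\<^sub>v (N *\<^sub>v u)) = c \<cdot>\<^sub>v u"
      unfolding Hu[symmetric] using N M u
      by (simp add: assoc_mult_mat_vec[of "mat_adjoint N * M" "s - k" s N "s - k" u]
          assoc_mult_mat_vec[of "mat_adjoint N" "s - k" s M s "N *\<^sub>v u"] del: assoc_mult_mat)
    define v where "v = N *\<^sub>v u"
    have v: "v \<in> carrier_vec s" using N u by (simp add: v_def)
    have "orthonormal s (s - k) (\<lambda>a. r (k + a))" using r by (auto simp: orthonormal_def)
    from orthonormal_gram[OF this] have "mat_adjoint N * N = 1\<^sub>m (s - k)" by (simp add: N_def)
    hence Nv: "mat_adjoint N *\<^sub>v v = u"
      unfolding v_def using N u by (simp add: assoc_mult_mat_vec[symmetric])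
    have v0: "v \<noteq> 0\<^sub>v s"
    proof
      assume "v = 0\<^sub>v s"
      hence "u = mat_adjoint N *\<^sub>v 0\<^sub>v s" using Nv by metis
      also have "\<dots> = 0\<^sub>v (s - k)" using N by (intro eq_vecI) auto
      finally show False using u by simp
    qed
    have vr: "v \<bullet>c r j = 0" if "j < k" for j
    proof -
      have "mat_adjoint N *\<^sub>v r j = 0\<^sub>v (s - k)"
      proof (rule eq_vecI)
        fix a assume "a < dim_vec (0\<^sub>v (s - k))"
        hence a: "a < s - k" by simp
        show "(mat_adjoint N *\<^sub>v r j) $ a = 0\<^sub>v (s - k) $ a"
          using r a that Suc.prems rc[of j]
          by (subst Ni) (auto simp: orthonormal_def)
      qed (use N in auto)
      thus ?thesis unfolding v_def using that Suc.prems u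
        by (subst cscalar_adjoint[OF N(1) u(1) rc]) auto
    qed
    have Mv: "M *\<^sub>v v = c \<cdot>\<^sub>v v"
    proof (rule orthonormal_basis_eqI[OF r])
      fix j assume j: "j < s"
      show "(M *\<^sub>v v) \<bullet>c r j = (c \<cdot>\<^sub>v v) \<bullet>c r j"
      proof (cases "j < k")
        case True
        have "(M *\<^sub>v v) \<bullet>c r j = v \<bullet>c (complex_of_real (e j) \<cdot>\<^sub>v r j)"
          using True e[of j] rq[of j] j rc[OF j] v by (simp add: sym)
        also have "\<dots> = of_real (e j) * (v \<bullet>c r j)"
          using rc[OF j] v by (auto simp: scalar_prod_def sum_distrib_left intro!: sum.cong)
        also have "\<dots> = (c \<cdot>\<^sub>v v) \<bullet>c r j" using vr[OF True] v rc[OF j] by simp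
        finally show ?thesis .
      next
        case False
        then obtain a where a: "j = k + a" "a < s - k"
          using j by (metis add_diff_inverse_nat add_less_cancel_left diff_less_mono not_less less_diff_conv2 add.commute)
        have "(M *\<^sub>v v) \<bullet>c r j = (c \<cdot>\<^sub>v u) $ a"
          using Ni[of "M *\<^sub>v v" a] Hu' M v a by (simp add: v_def)
        moreover have "v \<bullet>c r j = u $ a" using Ni[of v a] Nv v a by simp
        ultimately show ?thesis using a u v rc[OF j] by simp
      qed
    qed (use M v in auto)
    have vpos: "norm_sq v > 0" using v v0 by (rule norm_sq_pos)
    have "c * of_real (norm_sq v) = (M *\<^sub>v v) \<bullet>c v"
      using v by (simp add: Mv cscalar_self)
    also have "\<dots> = v \<bullet>c (M *\<^sub>v v)" using sym[OF v v] .
    also have "\<dots> = cnj ((M *\<^sub>v v) \<bullet>c v)" using cscalar_commute[of "M *\<^sub>v v" s v] M v by simp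
    also have "\<dots> = cnj c * of_real (norm_sq v)" using v by (simp add: Mv cscalar_self)
    finally have "c = cnj c" using vpos by simp
    hence c: "c = of_real (Re c)" by (simp add: complex_eq_iff)
    define v' where "v' = complex_of_real (1 / sqrt (norm_sq v)) \<cdot>\<^sub>v v"
    have "orthonormal s (Suc k) (q(k := v'))" unfolding v'_def
      by (rule orthonormal_extend[OF q v v0]) (use vr rq in auto)
    moreover have "M *\<^sub>v v' = of_real (Re c) \<cdot>\<^sub>v v'"
    proof -
      have "M *\<^sub>v v' = complex_of_real (1 / sqrt (norm_sq v)) \<cdot>\<^sub>v (M *\<^sub>v v)"
        unfolding v'_def using M v by (intro mult_mat_vec) auto
      thus ?thesis using c by (simp add: Mv v'_def smult_smult_assoc mult.commute)
    qed
    ultimately have "orthonormal s (Suc k) (q(k := v')) \<and>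
        (\<forall>j<Suc k. M *\<^sub>v (q(k := v')) j = complex_of_real ((e(k := Re c)) j) \<cdot>\<^sub>v (q(k := v')) j)"
      using e by (auto simp: less_Suc_eq simp del: fun_upd_apply simp: fun_upd_def[of e] fun_upd_same fun_upd_other)
    thus ?case by blast
  qed
  thus ?thesis by blast
qed

lemma eigenfamily_form:
  fixes M :: "complex mat"
  assumes M: "M \<in> carrier_mat s s" and q: "orthonormal s s q"
    and e: "\<And>j. j < s \<Longrightarrow> M *\<^sub>v q j = complex_of_real (e j) \<cdot>\<^sub>v q j"
    and herm: "mat_adjoint M = M" and z: "z \<in> carrier_vec s"
  shows "Re ((M *\<^sub>v z) \<bullet>c z) = (\<Sum>j<s. e j * (cmod (z \<bullet>c q j))\<^sup>2)"
proof -
  have "(M *\<^sub>v z) \<bullet>c q j = of_real (e j) * (z \<bullet>c q j)" if j: "j < s" for j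
  proof -
    have qj: "q j \<in> carrier_vec s" using q j by (rule orthonormal_carrier)
    have "(M *\<^sub>v z) \<bullet>c q j = z \<bullet>c (complex_of_real (e j) \<cdot>\<^sub>v q j)"
      using cscalar_adjoint[OF M z qj] by (simp add: herm e[OF j])
    thus ?thesis using qj z
      by (auto simp: scalar_prod_def sum_distrib_left intro!: sum.cong)
  qed
  hence "(M *\<^sub>v z) \<bullet>c z = (\<Sum>j<s. of_real (e j * (cmod (z \<bullet>c q j))\<^sup>2))"
    using parseval[OF q, of "M *\<^sub>v z" z] M z
    by (simp add: complex_norm_square mult.assoc del: of_real_power)
  thus ?thesis by simp
qed

text \<open>Connects eigenvectors with the definition through the characteristic polynomial: in the basis \<open>q\<close> the matrix
  is diagonal.\<close>

lemma hermitian_eigenvalues_eigenfamily: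
  fixes M :: "complex mat"
  assumes M: "M \<in> carrier_mat s s" and q: "orthonormal s s q"
    and e: "\<And>j. j < s \<Longrightarrow> M *\<^sub>v q j = complex_of_real (e j) \<cdot>\<^sub>v q j"
  shows "hermitian_eigenvalues M = decreasing (map e [0..<s])"
proof -
  define U where "U = family_mat s s q"
  define D where "D = mat s s (\<lambda>(i, j). if i = j then complex_of_real (e j) else 0)"
  have U: "U \<in> carrier_mat s s" "mat_adjoint U \<in> carrier_mat s s" and D: "D \<in> carrier_mat s s"
    by (auto simp: U_def D_def)
  have UU: "mat_adjoint U * U = 1\<^sub>m s" unfolding U_def by (rule orthonormal_gram[OF q])
  have UU': "U * mat_adjoint U = 1\<^sub>m s" by (rule mat_mult_left_right_inverse[OF U(2,1) UU])
  have "M * U = U * D"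
  proof (rule mat_col_eqI)
    fix j assume "j < dim_col (U * D)"
    hence j: "j < s" by (simp add: D_def)
    have "col D j = of_real (e j) \<cdot>\<^sub>v unit_vec s j" using j by (auto simp: D_def)
    moreover have "U *\<^sub>v unit_vec s j = q j"
      using j orthonormal_carrier[OF q j] by (auto simp: U_def family_mat_def intro!: eq_vecI)
    ultimately have "col (U * D) j = of_real (e j) \<cdot>\<^sub>v q j"
      using mult_mat_vec[OF U(1), of "unit_vec s j"] by (simp only: col_mult2[OF U(1) D j] unit_vec_carrier)
    moreover have "col (M * U) j = of_real (e j) \<cdot>\<^sub>v q j"
      using M U j e[OF j] by (simp add: col_mult2[of _ s s _ s] U_def col_family_mat orthonormal_carrier[OF q])
    ultimately show "col (M * U) j = col (U * D) j" by simp
  qed (use M U D in auto)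
  hence "M * U * mat_adjoint U = U * D * mat_adjoint U" by simp
  hence "M = U * D * mat_adjoint U" using M U UU' by (simp add: assoc_mult_mat[of _ s s _ s _ s])
  hence "similar_mat M D"
    by (intro similar_matI[of _ _ U "mat_adjoint U" s]) (use M U D UU UU' in auto)
  hence "char_poly M = char_poly D" by (rule char_poly_similar)
  also have "\<dots> = (\<Prod>a\<leftarrow>diag_mat D. [:- a, 1:])"
    by (rule char_poly_upper_triangular[OF D]) (auto simp: upper_triangular_def D_def)
  also have "diag_mat D = map (\<lambda>j. complex_of_real (e j)) [0..<s]"
    by (auto simp: diag_mat_def D_def)
  finally have cp: "char_poly M = (\<Prod>a\<leftarrow>map (\<lambda>j. complex_of_real (e j)) [0..<s]. [:- a, 1:])" .
  have pr: "proots (\<Prod>a\<leftarrow>as. [:- a, 1:]) = mset as" for as :: "complex list"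
  proof (induction as)
    case (Cons a as)
    have "(\<Prod>a\<leftarrow>as. [:- a, 1:]) \<noteq> 0" by (auto simp: prod_list_zero_iff)
    thus ?case using Cons by (simp add: proots_mult del: mult_pCons_left)
  qed simp
  have "image_mset Re (proots (char_poly M)) = mset (map e [0..<s])"
    unfolding cp pr by (simp add: image_mset.compositionality o_def)
  thus ?thesis by (simp only: hermitian_eigenvalues_def decreasing_def sorted_list_of_multiset_mset)
qed

lemma hermitian_spectral:
  fixes M :: "complex mat"
  assumes M: "M \<in> carrier_mat s s" and herm: "mat_adjoint M = M"
  obtains q where "length (hermitian_eigenvalues M) = s"
    "diag_form s (\<lambda>z. Re ((M *\<^sub>v z) \<bullet>c z)) (\<lambda>j. hermitian_eigenvalues M ! j) q"
    "\<And>j. j < s \<Longrightarrow> M *\<^sub>v q j = complex_of_real (hermitian_eigenvalues M ! j) \<cdot>\<^sub>v q j"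
proof -
  obtain q e where q: "orthonormal s s q"
    and e: "\<And>j. j < s \<Longrightarrow> M *\<^sub>v q j = complex_of_real (e j) \<cdot>\<^sub>v q j"
    using hermitian_eigenfamily[OF M herm] by auto
  have h: "hermitian_eigenvalues M = decreasing (map e [0..<s])"
    by (rule hermitian_eigenvalues_eigenfamily[OF M q e])
  obtain \<pi> where \<pi>: "\<pi> permutes {..<s}" "\<And>j. j < s \<Longrightarrow> decreasing (map e [0..<s]) ! j = e (\<pi> j)"
    "diag_form s (\<lambda>z. Re ((M *\<^sub>v z) \<bullet>c z)) (\<lambda>j. decreasing (map e [0..<s]) ! j) (\<lambda>j. q (\<pi> j))"
    using diag_form_sort[OF q eigenfamily_form[OF M q e herm]] by blast
  have "\<pi> j < s" if "j < s" for j using permutes_in_image[OF \<pi>(1), of j] that by auto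
  with \<pi> e that[of "\<lambda>j. q (\<pi> j)"] show ?thesis by (simp add: h)
qed

section \<open>Trace inequalities\<close>

text \<open>Summation by parts: a decreasing nonnegative weight is a nonnegative combination of the indicators of
  initial segments.\<close>

lemma abel_sum_le:
  fixes w a b :: "nat \<Rightarrow> real"
  assumes w: "\<And>i j. i \<le> j \<Longrightarrow> j < k \<Longrightarrow> w j \<le> w i" "\<And>j. j < k \<Longrightarrow> 0 \<le> w j"
    and ab: "\<And>m. m \<le> k \<Longrightarrow> (\<Sum>j<m. a j) \<le> (\<Sum>j<m. b j)"
  shows "(\<Sum>j<k. w j * a j) \<le> (\<Sum>j<k. w j * b j)"
proof -
  have step: "w m * (\<Sum>j<Suc m. b j - a j) \<le> (\<Sum>j<Suc m. w j * (b j - a j))" if "m < k" for m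
    using that
  proof (induction m)
    case (Suc m)
    have "w (Suc m) * (\<Sum>j<Suc m. b j - a j) \<le> w m * (\<Sum>j<Suc m. b j - a j)"
      using w(1)[of m "Suc m"] Suc.prems ab[of "Suc m"]
      by (intro mult_right_mono) (auto simp: sum_subtractf)
    thus ?case using Suc by (simp add: distrib_left)
  qed simp
  have "0 \<le> (\<Sum>j<k. w j * (b j - a j))"
  proof (cases k)
    case (Suc m)
    have "0 \<le> w m * (\<Sum>j<Suc m. b j - a j)"
      using w(2)[of m] ab[of "Suc m"] Suc by (intro mult_nonneg_nonneg) (auto simp: sum_subtractf)
    thus ?thesis using step[of m] Suc by auto
  qed simp
  thus ?thesis by (simp add: right_diff_distrib sum_subtractf)
qed

text \<open>Weights in \<open>[0, 1]\<close> of total mass \<open>k\<close> do best when they sit on the \<open>k\<close> largest values. After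
  subtracting the \<open>k\<close>-th value this can be read off term by term.\<close>

lemma sum_weighted_le:
  fixes m t :: "nat \<Rightarrow> real"
  assumes m: "\<And>i j. i \<le> j \<Longrightarrow> j < s \<Longrightarrow> m j \<le> m i"
    and t: "\<And>j. j < s \<Longrightarrow> 0 \<le> t j" "\<And>j. j < s \<Longrightarrow> t j \<le> 1" "(\<Sum>j<s. t j) = real k" and "k \<le> s"
  shows "(\<Sum>j<s. m j * t j) \<le> (\<Sum>j<k. m j)"
proof (cases k)
  case 0
  hence "\<forall>j<s. t j = 0" using t sum_nonneg_eq_0_iff[of "{..<s}" t] by auto
  thus ?thesis using 0 by simp
next
  case (Suc k')
  define c where "c = m k'"
  have "(\<Sum>j<s. (m j - c) * t j) \<le> (\<Sum>j<s. if j < k then m j - c else 0)"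
  proof (rule sum_mono)
    fix j assume j: "j \<in> {..<s}"
    show "(m j - c) * t j \<le> (if j < k then m j - c else 0)"
    proof (cases "j < k")
      case True
      hence "0 \<le> m j - c" using m[of j k'] Suc \<open>k \<le> s\<close> by (simp add: c_def)
      thus ?thesis using True t(2)[of j] j mult_left_le by fastforce
    next
      case False
      hence "m j - c \<le> 0" using m[of k' j] Suc j by (simp add: c_def)
      thus ?thesis using False t(1)[of j] j by (simp add: mult_nonpos_nonneg)
    qed
  qed
  also have "\<dots> = (\<Sum>j\<in>{..<s} \<inter> {j. j < k}. m j - c)" by (simp add: sum.If_cases)
  also have "{..<s} \<inter> {j. j < k} = {..<k}" using \<open>k \<le> s\<close> by auto
  finally show ?thesis
    using t(3) by (simp add: left_diff_distrib sum_subtractf sum_distrib_left[symmetric])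
qed

text \<open>Ky Fan's principle. The squared coordinates of \<open>u 0, \<dots>, u (k - 1)\<close> along \<open>q j\<close>, summed over the
  \<open>k\<close> vectors, are weights as in \<open>sum_weighted_le\<close>.\<close>

lemma ky_fan:
  assumes \<Phi>: "diag_form s \<Phi> m q" and u: "orthonormal s s u" and k: "k \<le> s"
  shows "(\<Sum>c<k. \<Phi> (u c)) \<le> (\<Sum>j<k. m j)"
proof -
  note D = diag_formD[OF \<Phi>]
  have uc: "u c \<in> carrier_vec s" if "c < s" for c using u that by (rule orthonormal_carrier)
  have qc: "q c \<in> carrier_vec s" if "c < s" for c using D(1) that by (rule orthonormal_carrier)
  define t where "t j = (\<Sum>c<k. (cmod (u c \<bullet>c q j))\<^sup>2)" for j
  have "t j \<le> 1" if j: "j < s" for j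
  proof -
    have "t j \<le> (\<Sum>c<s. (cmod (u c \<bullet>c q j))\<^sup>2)"
      unfolding t_def using k by (intro sum_mono2) auto
    also have "\<dots> = (\<Sum>c<s. (cmod (q j \<bullet>c u c))\<^sup>2)"
      by (intro sum.cong refl) (metis cscalar_commute[OF uc qc[OF j]] complex_mod_cnj lessThan_iff)
    also have "\<dots> = norm_sq (q j)" by (rule norm_sq_coords[OF u qc[OF j], symmetric])
    finally show ?thesis using orthonormal_norm_sq[OF D(1) j] by simp
  qed
  moreover have "(\<Sum>j<s. t j) = real k"
  proof -
    have "(\<Sum>j<s. t j) = (\<Sum>c<k. \<Sum>j<s. (cmod (u c \<bullet>c q j))\<^sup>2)"
      unfolding t_def by (rule sum.swap)
    also have "\<dots> = (\<Sum>c<k. norm_sq (u c))"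
      using k uc by (intro sum.cong refl) (simp add: norm_sq_coords[OF D(1)])
    also have "\<dots> = (\<Sum>c<k. 1)" using k orthonormal_norm_sq[OF u] by (intro sum.cong) auto
    finally show ?thesis by simp
  qed
  moreover have "0 \<le> t j" for j unfolding t_def by (simp add: sum_nonneg)
  ultimately have "(\<Sum>j<s. m j * t j) \<le> (\<Sum>j<k. m j)"
    using D(2) k by (intro sum_weighted_le) auto
  moreover have "(\<Sum>c<k. \<Phi> (u c)) = (\<Sum>c<k. \<Sum>j<s. m j * (cmod (u c \<bullet>c q j))\<^sup>2)"
    using k uc by (intro sum.cong refl) (simp add: D(3))
  moreover have "\<dots> = (\<Sum>j<s. m j * t j)"
    unfolding t_def sum_distrib_left by (rule sum.swap)
  ultimately show ?thesis by simp
qed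

lemma gram_spectral:
  fixes T :: "complex mat"
  assumes T: "T \<in> carrier_mat r s"
  obtains q where "length (hermitian_eigenvalues (mat_adjoint T * T)) = s"
    "diag_form s (\<lambda>z. norm_sq (T *\<^sub>v z)) (\<lambda>j. hermitian_eigenvalues (mat_adjoint T * T) ! j) q"
    "\<And>j. j < s \<Longrightarrow> mat_adjoint T *\<^sub>v (T *\<^sub>v q j) =
       complex_of_real (hermitian_eigenvalues (mat_adjoint T * T) ! j) \<cdot>\<^sub>v q j"
proof -
  have TT: "mat_adjoint T * T \<in> carrier_mat s s" and TH: "mat_adjoint T \<in> carrier_mat s r" using T by auto
  have "mat_adjoint (mat_adjoint T * T) = mat_adjoint T * T"
    using T by (subst mat_adjoint_mult) (auto simp: mat_adjoint_adjoint)
  from hermitian_spectral[OF TT this]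
  obtain q where q: "length (hermitian_eigenvalues (mat_adjoint T * T)) = s"
    "diag_form s (\<lambda>z. Re ((mat_adjoint T * T *\<^sub>v z) \<bullet>c z)) (\<lambda>j. hermitian_eigenvalues (mat_adjoint T * T) ! j) q"
    "\<And>j. j < s \<Longrightarrow> mat_adjoint T * T *\<^sub>v q j = complex_of_real (hermitian_eigenvalues (mat_adjoint T * T) ! j) \<cdot>\<^sub>v q j"
    by blast
  have a: "mat_adjoint T * T *\<^sub>v z = mat_adjoint T *\<^sub>v (T *\<^sub>v z)" if "z \<in> carrier_vec s" for z
    using assoc_mult_mat_vec[OF TH T that] .
  have "Re ((mat_adjoint T * T *\<^sub>v z) \<bullet>c z) = norm_sq (T *\<^sub>v z)" if z: "z \<in> carrier_vec s" for z
    using cscalar_adjoint[OF TH, of "T *\<^sub>v z" z] T z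
    by (simp add: a mat_adjoint_adjoint cscalar_self)
  hence "diag_form s (\<lambda>z. norm_sq (T *\<^sub>v z)) (\<lambda>j. hermitian_eigenvalues (mat_adjoint T * T) ! j) q"
    using q(2) by (simp add: diag_form_def)
  moreover have "mat_adjoint T *\<^sub>v (T *\<^sub>v q j) =
       complex_of_real (hermitian_eigenvalues (mat_adjoint T * T) ! j) \<cdot>\<^sub>v q j" if "j < s" for j
    using q(3)[OF that] a[of "q j"] orthonormal_carrier[OF diag_formD(1)[OF q(2)] that] by simp
  ultimately show ?thesis using that q(1) by blast
qed

lemma cauchy_schwarz_vec:
  assumes "v \<in> carrier_vec s" "w \<in> carrier_vec s"
  shows "(cmod (v \<bullet>c w))\<^sup>2 \<le> norm_sq v * norm_sq w"
proof -
  define a W where "a = v \<bullet>c w" and "W = norm_sq w"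
  have "(complex_of_real W \<cdot>\<^sub>v v) \<bullet>c (- a \<cdot>\<^sub>v w) = of_real W * (cnj (- a) * (v \<bullet>c w))"
    using assms by (simp add: scalar_prod_def sum_distrib_left mult_ac)
  also have "\<dots> = of_real (- (W * (cmod a)\<^sup>2))"
    by (simp add: a_def[symmetric] mult.commute[of "cnj a"] complex_norm_square[symmetric])
  finally have "Re ((complex_of_real W \<cdot>\<^sub>v v) \<bullet>c (- a \<cdot>\<^sub>v w)) = - (W * (cmod a)\<^sup>2)"
    by (simp only: Re_complex_of_real)
  hence "norm_sq (complex_of_real W \<cdot>\<^sub>v v + - a \<cdot>\<^sub>v w) = W * (W * norm_sq v - (cmod a)\<^sup>2)"
    using assms by (subst norm_sq_add[of _ s])
      (simp_all add: norm_sq_smult W_def[symmetric] power2_eq_square algebra_simps)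
  hence "0 \<le> W * (W * norm_sq v - (cmod a)\<^sup>2)" by (metis norm_sq_nonneg)
  hence "(cmod a)\<^sup>2 \<le> norm_sq v * W" if "0 < W"
    using that by (simp add: zero_le_mult_iff mult.commute)
  moreover have "a = 0" if "W = 0"
    using that assms by (simp add: a_def W_def norm_sq_eq_0_iff)
  ultimately show ?thesis using norm_sq_nonneg[of w] unfolding a_def W_def by (cases "norm_sq w = 0") auto
qed

text \<open>The matrices \<open>S S\<^sup>H\<close> and \<open>S\<^sup>H S\<close> have the same nonzero eigenvalues, here in the form of an inequality
  for eigenvalues of equal index. The vector \<open>w\<close> provided by \<open>diag_form_compare\<close> for \<open>L = S\<^sup>H\<close> satisfies
  \<open>|S\<^sup>H w|\<^sup>4 \<le> |S S\<^sup>H w|\<^sup>2 |w|\<^sup>2\<close> by the Cauchy-Schwarz inequality.\<close>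

lemma gram_adjoint_le:
  fixes S :: "complex mat"
  assumes S: "S \<in> carrier_mat r s"
    and b: "diag_form s (\<lambda>z. norm_sq (S *\<^sub>v z)) b v"
    and b': "diag_form r (\<lambda>w. norm_sq (mat_adjoint S *\<^sub>v w)) b' v'"
    and j: "j < s" "j < r"
  shows "b' j \<le> b j"
proof -
  have SH: "mat_adjoint S \<in> carrier_mat s r" using S by auto
  obtain w where w: "w \<in> carrier_vec r" "0 < norm_sq w" "b' j * norm_sq w \<le> norm_sq (mat_adjoint S *\<^sub>v w)"
    "norm_sq (S *\<^sub>v (mat_adjoint S *\<^sub>v w)) \<le> b j * norm_sq (mat_adjoint S *\<^sub>v w)"
    using diag_form_compare[OF b' b SH j(2,1)] by blast
  define u where "u = mat_adjoint S *\<^sub>v w"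
  have u: "u \<in> carrier_vec s" using SH w by (simp add: u_def)
  have bj: "0 \<le> b j" using diag_form_basis[OF b j(1)] norm_sq_nonneg by metis
  have "(S *\<^sub>v u) \<bullet>c w = of_real (norm_sq u)"
    using cscalar_adjoint[OF S u w(1)] by (simp add: u_def[symmetric] cscalar_self)
  hence "(norm_sq u)\<^sup>2 \<le> norm_sq (S *\<^sub>v u) * norm_sq w"
    using cauchy_schwarz_vec[of "S *\<^sub>v u" r w] S u w(1) by simp
  also have "\<dots> \<le> b j * norm_sq u * norm_sq w"
    using w by (intro mult_right_mono) (auto simp: u_def)
  finally have "norm_sq u * norm_sq u \<le> norm_sq u * (b j * norm_sq w)" by (simp add: power2_eq_square mult_ac)
  hence "norm_sq u \<le> b j * norm_sq w"
    using bj w(2) by (cases "norm_sq u = 0") (auto simp: less_le)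
  hence "b' j * norm_sq w \<le> b j * norm_sq w" using w(3) by (simp add: u_def)
  thus ?thesis using w(2) by simp
qed

text \<open>The additive form of Horn's inequality for the singular values of a product: the \<open>k\<close> largest
  eigenvalues of \<open>S\<^sup>H \<Delta> S\<close> sum up to at most \<open>\<Sum> d\<^sub>j b\<^sub>j\<close>, where \<open>d\<close> and \<open>b\<close> belong to \<open>\<Delta>\<close> and
  \<open>S\<^sup>H S\<close>. With \<open>u\<close> the leading eigenvectors of \<open>S\<^sup>H \<Delta> S\<close>, its eigenvalue sum is
  \<open>\<Sum> d\<^sub>a \<rho>\<^sub>a\<close> for \<open>\<rho>\<^sub>a = \<Sum>\<^sub>c |\<langle>S u\<^sub>c, q\<^sub>a\<rangle>|\<^sup>2\<close>. By \<open>abel_sum_le\<close> it is enough to bound the sums of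
  \<open>\<rho>\<close> over initial segments, and each of them is bounded by Ky Fan's principle: for at most \<open>k\<close>
  terms applied to \<open>S S\<^sup>H\<close> and the \<open>q\<^sub>a\<close>, for more terms applied to \<open>S\<^sup>H S\<close> and the \<open>u\<^sub>c\<close>.\<close>

lemma ky_fan_product:
  fixes S :: "complex mat"
  assumes S: "S \<in> carrier_mat r s"
    and D: "diag_form r \<Delta> d q" and d: "\<And>j. j < r \<Longrightarrow> 0 \<le> d j"
    and e: "diag_form s (\<lambda>z. \<Delta> (S *\<^sub>v z)) e u"
    and b: "diag_form s (\<lambda>z. norm_sq (S *\<^sub>v z)) b v"
    and k: "k \<le> s" "k \<le> r"
  shows "(\<Sum>j<k. e j) \<le> (\<Sum>j<k. d j * b j)"
proof -
  note Dq = diag_formD[OF D] and Eu = diag_formD[OF e]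
  have SH: "mat_adjoint S \<in> carrier_mat s r" using S by auto
  obtain b' v' where b': "diag_form r (\<lambda>w. norm_sq (mat_adjoint S *\<^sub>v w)) b' v'"
    using gram_spectral[OF SH] by blast
  have uc: "u c \<in> carrier_vec s" "S *\<^sub>v u c \<in> carrier_vec r" if "c < s" for c
    using orthonormal_carrier[OF Eu(1) that] S by auto
  have qc: "q a \<in> carrier_vec r" "mat_adjoint S *\<^sub>v q a \<in> carrier_vec s" if "a < r" for a
    using orthonormal_carrier[OF Dq(1) that] SH by auto
  define \<rho> where "\<rho> a = (\<Sum>c<k. (cmod ((S *\<^sub>v u c) \<bullet>c q a))\<^sup>2)" for a
  define \<beta> where "\<beta> a = (if a < k then b a else 0)" for a
  have \<beta>: "(\<Sum>a<m. \<beta> a) = (\<Sum>a<min m k. b a)" for m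
  proof -
    have "(\<Sum>a<m. \<beta> a) = (\<Sum>a\<in>{..<m} \<inter> {a. a < k}. b a)" by (simp add: \<beta>_def sum.If_cases)
    also have "{..<m} \<inter> {a. a < k} = {..<min m k}" by auto
    finally show ?thesis .
  qed
  have "(\<Sum>a<m. \<rho> a) \<le> (\<Sum>a<m. \<beta> a)" if m: "m \<le> r" for m
  proof (cases "m \<le> k")
    case True
    have "\<rho> a \<le> norm_sq (mat_adjoint S *\<^sub>v q a)" if a: "a < r" for a
    proof -
      have "\<rho> a \<le> (\<Sum>c<s. (cmod ((S *\<^sub>v u c) \<bullet>c q a))\<^sup>2)"
        unfolding \<rho>_def using k by (intro sum_mono2) auto
      also have "\<dots> = (\<Sum>c<s. (cmod ((mat_adjoint S *\<^sub>v q a) \<bullet>c u c))\<^sup>2)"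
      proof (intro sum.cong refl)
        fix c assume "c \<in> {..<s}"
        hence c: "c < s" by simp
        have "(S *\<^sub>v u c) \<bullet>c q a = cnj ((mat_adjoint S *\<^sub>v q a) \<bullet>c u c)"
          by (simp only: cscalar_adjoint[OF S uc(1)[OF c] qc(1)[OF a]]
              cscalar_commute[OF qc(2)[OF a] uc(1)[OF c]])
        thus "(cmod ((S *\<^sub>v u c) \<bullet>c q a))\<^sup>2 = (cmod ((mat_adjoint S *\<^sub>v q a) \<bullet>c u c))\<^sup>2"
          by (simp only: complex_mod_cnj)
      qed
      also have "\<dots> = norm_sq (mat_adjoint S *\<^sub>v q a)"
        by (rule norm_sq_coords[OF Eu(1) qc(2)[OF a], symmetric])
      finally show ?thesis .
    qed
    hence "(\<Sum>a<m. \<rho> a) \<le> (\<Sum>a<m. norm_sq (mat_adjoint S *\<^sub>v q a))"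
      using m by (intro sum_mono) auto
    also have "\<dots> \<le> (\<Sum>a<m. b' a)" by (rule ky_fan[OF b' Dq(1) m])
    also have "\<dots> \<le> (\<Sum>a<m. b a)"
      using gram_adjoint_le[OF S b b'] m True k by (intro sum_mono) auto
    finally show ?thesis using True by (simp add: \<beta> min_absorb1)
  next
    case False
    have "(\<Sum>a<m. \<rho> a) \<le> (\<Sum>a<r. \<rho> a)"
      using m by (intro sum_mono2) (auto simp: \<rho>_def intro!: sum_nonneg)
    also have "\<dots> = (\<Sum>c<k. \<Sum>a<r. (cmod ((S *\<^sub>v u c) \<bullet>c q a))\<^sup>2)"
      unfolding \<rho>_def by (rule sum.swap)
    also have "\<dots> = (\<Sum>c<k. norm_sq (S *\<^sub>v u c))"
      using k uc by (intro sum.cong refl) (simp add: norm_sq_coords[OF Dq(1)])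
    also have "\<dots> \<le> (\<Sum>c<k. b c)" by (rule ky_fan[OF b Eu(1) k(1)])
    finally show ?thesis using False by (simp add: \<beta> min_absorb2)
  qed
  hence "(\<Sum>a<r. d a * \<rho> a) \<le> (\<Sum>a<r. d a * \<beta> a)"
    using Dq(2) d by (intro abel_sum_le) auto
  also have "\<dots> = (\<Sum>a<r. if a < k then d a * b a else 0)"
    by (intro sum.cong) (auto simp: \<beta>_def)
  also have "\<dots> = (\<Sum>a\<in>{..<r} \<inter> {a. a < k}. d a * b a)" by (simp add: sum.If_cases)
  also have "{..<r} \<inter> {a. a < k} = {..<k}" using k by auto
  finally have "(\<Sum>a<r. d a * \<rho> a) \<le> (\<Sum>a<k. d a * b a)" .
  moreover have "(\<Sum>j<k. e j) = (\<Sum>c<k. \<Delta> (S *\<^sub>v u c))"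
    using k diag_form_basis[OF e] by (intro sum.cong) auto
  moreover have "\<dots> = (\<Sum>c<k. \<Sum>a<r. d a * (cmod ((S *\<^sub>v u c) \<bullet>c q a))\<^sup>2)"
    using k uc by (intro sum.cong refl) (simp add: Dq(3))
  moreover have "\<dots> = (\<Sum>a<r. d a * \<rho> a)"
    unfolding \<rho>_def sum_distrib_left by (rule sum.swap)
  ultimately show ?thesis by simp
qed

section \<open>Ratios of eigenvalues under a change of inner product\<close>

lemma conjugate_unit_vec [simp]: "conjugate (unit_vec s j) = (unit_vec s j :: complex vec)"
  by (intro eq_vecI) (auto simp: unit_vec_def)

lemma orthonormal_unit_vecs: "orthonormal s s (unit_vec s)"
  by (auto simp: orthonormal_def)

lemma cscalar_unit_vec: "z \<in> carrier_vec s \<Longrightarrow> j < s \<Longrightarrow> z \<bullet>c unit_vec s j = (z :: complex vec) $ j"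
  by simp

text \<open>If \<open>L\<close> were an isometry, \<open>ge\<close> would give \<open>d\<^sub>j \<le> h\<^sub>j\<close>; the lemma measures the loss when the inner
  product is changed to \<open>G = L\<^sup>H L\<close>. This is an additive variant of the argument of Li and Mathias
  for Lidskii's multiplicative inequality. Let \<open>k = |J|\<close> and \<open>c = g\<^sub>k\<close> (in the numbering from \<open>1\<close>), raise the
  eigenvalues of \<open>G\<close> below \<open>c\<close> to \<open>c\<close>, and call the result \<open>G'\<close>. Let \<open>\<nu>\<close> be the increasing sequence of
  eigenvalues of \<open>K = D\<^sup>-\<^sup>1\<^sup>/\<^sup>2 G' D\<^sup>-\<^sup>1\<^sup>/\<^sup>2\<close> with \<open>D = diag d\<close>. Then \<open>d\<^sub>j / h\<^sub>j \<le> d\<^sub>j \<nu>\<^sub>j\<close> by the min-max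
  argument, \<open>c \<le> d\<^sub>j \<nu>\<^sub>j\<close> because \<open>G' \<ge> c\<close>, and \<open>\<Sum> d\<^sub>j \<nu>\<^sub>j \<le> tr (D K) = tr G'\<close> by Ky Fan's principle and
  summation by parts. Leaving out the indices outside \<open>J\<close> lowers the sum by at least \<open>c\<close> each, and
  \<open>tr G' - (s - k) c\<close> is the sum of the \<open>k\<close> largest eigenvalues of \<open>G\<close>.\<close>

lemma sum_ratio_le_top_eigenvalues:
  fixes L :: "complex mat" and d :: "nat \<Rightarrow> real"
  assumes L: "L \<in> carrier_mat t s" and st: "s \<le> t"
    and G: "diag_form s (\<lambda>u. norm_sq (L *\<^sub>v u)) g q"
    and P: "diag_form t \<Psi> h r"
    and d: "\<And>i j. i \<le> j \<Longrightarrow> j < s \<Longrightarrow> d j \<le> d i" "\<And>j. j < s \<Longrightarrow> 0 < d j"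
    and ge: "\<And>u. u \<in> carrier_vec s \<Longrightarrow> (\<Sum>j<s. d j * (cmod (u $ j))\<^sup>2) \<le> \<Psi> (L *\<^sub>v u)"
    and J: "J \<subseteq> {..<s}" "J \<noteq> {}"
  shows "(\<forall>j<s. 0 < h j) \<and> (\<Sum>j\<in>J. d j / h j) \<le> (\<Sum>l<card J. g l)"
proof -
  note Gq = diag_formD[OF G]
  have fJ: "finite J" using J(1) by (rule finite_subset) simp
  define k where "k = card J"
  have k: "0 < k" "k \<le> s"
    using J fJ card_mono[OF _ J(1)] by (auto simp: k_def card_gt_0_iff)
  \<comment> \<open>The \<open>k\<close>-th largest eigenvalue, as indices start at \<open>0\<close>.\<close>
  define c where "c = g (k - 1)"
  define g' where "g' l = max (g l) c" for l
  have g0: "0 \<le> g l" if "l < s" for l using diag_form_basis[OF G that] norm_sq_nonneg by metis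
  have c0: "0 \<le> c" using g0 k by (simp add: c_def)
  define \<Gamma> where "\<Gamma> u = (\<Sum>l<s. g' l * (cmod (u \<bullet>c q l))\<^sup>2)" for u
  have \<Gamma>ge: "norm_sq (L *\<^sub>v u) \<le> \<Gamma> u" "c * norm_sq u \<le> \<Gamma> u" if u: "u \<in> carrier_vec s" for u
    unfolding Gq(3)[OF u] norm_sq_coords[OF Gq(1) u] \<Gamma>_def sum_distrib_left
    by (auto simp: g'_def intro!: sum_mono mult_right_mono)
  \<comment> \<open>\<open>E = D\<^sup>-\<^sup>1\<^sup>/\<^sup>2\<close>, and \<open>R\<^sup>H R = G'\<close>, so that \<open>K\<close> is a Gram form.\<close>
  define E where "E = mat s s (\<lambda>(a, b). if a = b then complex_of_real (1 / sqrt (d a)) else 0)"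
  have E: "E \<in> carrier_mat s s" by (simp add: E_def)
  have Ez: "(E *\<^sub>v z) $ a = z $ a / of_real (sqrt (d a))" if "z \<in> carrier_vec s" "a < s" for z a
    using that by (simp add: E_def scalar_prod_def if_distrib[of "\<lambda>x. x * _"] cong: if_cong)
  have Ezc: "E *\<^sub>v z \<in> carrier_vec s" if "z \<in> carrier_vec s" for z using E that by simp
  have dE: "d a * (cmod ((E *\<^sub>v z) $ a))\<^sup>2 = (cmod (z $ a))\<^sup>2" if "z \<in> carrier_vec s" "a < s" for z a
    using d(2)[OF that(2)] by (simp add: Ez[OF that] norm_divide power_divide)
  define R where "R = mat s s (\<lambda>(l, a). complex_of_real (sqrt (g' l)) * cnj (q l $ a))"
  have R: "R \<in> carrier_mat s s" by (simp add: R_def)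
  have nR: "norm_sq (R *\<^sub>v u) = \<Gamma> u" if u: "u \<in> carrier_vec s" for u
  proof -
    have "(R *\<^sub>v u) $ l = complex_of_real (sqrt (g' l)) * (u \<bullet>c q l)" if "l < s" for l
      using that u orthonormal_carrier[OF Gq(1) that]
      by (simp add: R_def scalar_prod_def sum_distrib_left mult_ac)
    moreover have "0 \<le> g' l" for l using c0 by (simp add: g'_def)
    ultimately show ?thesis
      using R by (simp add: norm_sq_def \<Gamma>_def norm_mult power_mult_distrib)
  qed
  define K where "K z = norm_sq (R * E *\<^sub>v z)" for z
  have K: "K z = \<Gamma> (E *\<^sub>v z)" if "z \<in> carrier_vec s" for z
    unfolding K_def using assoc_mult_mat_vec[OF R E that] nR[OF Ezc[OF that]] by simp
  have "R * E \<in> carrier_mat s s" using R E by simp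
  then obtain \<kappa> w where "diag_form s K \<kappa> w"
    unfolding K_def[abs_def] using gram_spectral by blast
  from diag_form_uminus[OF this]
  obtain \<nu> w' where N: "diag_form s (\<lambda>z. - K z) (\<lambda>j. - \<nu> j) w'"
    by (metis (no_types))
  have h\<nu>: "0 < h j \<and> 1 \<le> h j * \<nu> j" if j: "j < s" for j
  proof -
    have LE: "L * E \<in> carrier_mat t s" using L E by auto
    obtain z where z: "z \<in> carrier_vec s" "0 < norm_sq z" "- \<nu> j * norm_sq z \<le> - K z"
      "\<Psi> (L * E *\<^sub>v z) \<le> h j * norm_sq (L * E *\<^sub>v z)"
      using diag_form_compare[OF N P LE] j st by (metis order.strict_trans2)
    define u where "u = E *\<^sub>v z"
    have u: "u \<in> carrier_vec s" using Ezc z by (simp add: u_def)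
    have LEz: "L * E *\<^sub>v z = L *\<^sub>v u" using assoc_mult_mat_vec[OF L E z(1)] by (simp add: u_def)
    have "norm_sq z = (\<Sum>a<s. d a * (cmod (u $ a))\<^sup>2)"
      using z(1) by (simp add: norm_sq_def u_def dE)
    hence 1: "norm_sq z \<le> h j * norm_sq (L *\<^sub>v u)" using ge[OF u] z(4) by (simp add: LEz)
    hence h: "0 < h j" using z(2) norm_sq_nonneg[of "L *\<^sub>v u"]
      by (smt (verit) mult_nonpos_nonneg)
    have "h j * norm_sq (L *\<^sub>v u) \<le> h j * K z"
      using h \<Gamma>ge(1)[OF u] by (simp add: K[OF z(1)] u_def)
    also have "\<dots> \<le> h j * (\<nu> j * norm_sq z)" using h z(3) by simp
    finally have "1 * norm_sq z \<le> (h j * \<nu> j) * norm_sq z" using 1 by simp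
    thus ?thesis using h z(2) by (simp only: mult_le_cancel_right_pos)
  qed
  have \<nu>d: "c \<le> d j * \<nu> j" if j: "j < s" for j
  proof -
    define \<Theta> where "\<Theta> z = (\<Sum>a<s. - (1 / d a) * (cmod (z \<bullet>c unit_vec s a))\<^sup>2)" for z
    have T: "diag_form s \<Theta> (\<lambda>a. - (1 / d a)) (unit_vec s)"
      unfolding diag_form_def \<Theta>_def using d orthonormal_unit_vecs
      by (auto intro!: divide_left_mono mult_pos_pos simp del: scalar_prod_right_unit)
    obtain z where z: "z \<in> carrier_vec s" "0 < norm_sq z" "- \<nu> j * norm_sq z \<le> - K z"
      "\<Theta> (1\<^sub>m s *\<^sub>v z) \<le> - (1 / d j) * norm_sq (1\<^sub>m s *\<^sub>v z)"
      using diag_form_compare[OF N T one_carrier_mat j j] by blast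
    have "norm_sq (E *\<^sub>v z) = - \<Theta> z"
      using z(1) E less_imp_le[OF d(2)]
      by (auto simp: norm_sq_def \<Theta>_def Ez norm_divide power_divide sum_negf[symmetric] simp del: index_mult_mat_vec intro!: sum.cong)
    moreover have "- \<Theta> z \<ge> 1 / d j * norm_sq z" using z(1,4) by simp
    ultimately have "c * (1 / d j * norm_sq z) \<le> c * norm_sq (E *\<^sub>v z)" using c0 by (intro mult_left_mono) auto
    also have "\<dots> \<le> K z" using \<Gamma>ge(2)[OF Ezc[OF z(1)]] by (simp add: K[OF z(1)])
    also have "\<dots> \<le> \<nu> j * norm_sq z" using z(3) by simp
    finally have "(c / d j) * norm_sq z \<le> \<nu> j * norm_sq z" by simp
    hence "c / d j \<le> \<nu> j" using z(2) by (simp only: mult_le_cancel_right_pos)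
    thus ?thesis using d(2)[OF j] by (simp add: field_simps)
  qed
  have tr: "(\<Sum>j<s. d j * \<nu> j) \<le> (\<Sum>l<s. g' l)"
  proof -
    have "(\<Sum>j<s. d j * - K (unit_vec s j)) \<le> (\<Sum>j<s. d j * - \<nu> j)"
      using d by (intro abel_sum_le ky_fan[OF N orthonormal_unit_vecs]) (auto intro: less_imp_le)
    hence "(\<Sum>j<s. d j * \<nu> j) \<le> (\<Sum>j<s. d j * K (unit_vec s j))" by (simp add: sum_negf)
    also have "\<dots> = (\<Sum>j<s. \<Sum>l<s. g' l * (cmod (q l $ j))\<^sup>2)"
    proof (intro sum.cong refl)
      fix j assume "j \<in> {..<s}"
      hence j: "j < s" by simp
      have "E *\<^sub>v unit_vec s j = complex_of_real (1 / sqrt (d j)) \<cdot>\<^sub>v unit_vec s j"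
        using j E by (intro eq_vecI) (auto simp: Ez unit_vec_def simp del: index_mult_mat_vec)
      hence "(cmod ((E *\<^sub>v unit_vec s j) \<bullet>c q l))\<^sup>2 = (cmod (q l $ j))\<^sup>2 / d j" if "l < s" for l
        using j d(2)[OF j] orthonormal_carrier[OF Gq(1) that]
        by (simp add: norm_mult norm_divide power_mult_distrib power_divide)
      thus "d j * K (unit_vec s j) = (\<Sum>l<s. g' l * (cmod (q l $ j))\<^sup>2)"
        using d(2)[OF j] by (simp add: K \<Gamma>_def sum_distrib_left)
    qed
    also have "\<dots> = (\<Sum>l<s. g' l * norm_sq (q l))"
      unfolding norm_sq_def sum_distrib_left
      by (subst sum.swap) (auto intro!: sum.cong simp: carrier_vecD[OF orthonormal_carrier[OF Gq(1)]])
    also have "\<dots> = (\<Sum>l<s. g' l)" using orthonormal_norm_sq[OF Gq(1)] by simp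
    finally show ?thesis .
  qed
  have "(\<Sum>j\<in>J. d j / h j) \<le> (\<Sum>j\<in>J. d j * \<nu> j)"
  proof (rule sum_mono)
    fix j assume "j \<in> J"
    hence j: "j < s" using J by auto
    have "d j * 1 \<le> d j * (h j * \<nu> j)" using h\<nu>[OF j] d(2)[OF j] by (intro mult_left_mono) auto
    thus "d j / h j \<le> d j * \<nu> j" using h\<nu>[OF j] by (simp add: pos_divide_le_eq mult_ac)
  qed
  also have "\<dots> = (\<Sum>j<s. d j * \<nu> j) - (\<Sum>j\<in>{..<s} - J. d j * \<nu> j)"
    using J(1) by (simp add: sum_diff)
  also have "\<dots> \<le> (\<Sum>l<s. g' l) - (\<Sum>j\<in>{..<s} - J. c)"
    using \<nu>d by (intro diff_mono tr sum_mono) auto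
  also have "(\<Sum>j\<in>{..<s} - J. c) = (\<Sum>l\<in>{k..<s}. c)"
    using J(1) fJ by (simp add: card_Diff_subset k_def)
  also have "(\<Sum>l<s. g' l) = (\<Sum>l<k. g' l) + (\<Sum>l\<in>{k..<s}. g' l)"
    using k(2) by (simp add: lessThan_atLeast0 sum.atLeastLessThan_concat)
  also have "(\<Sum>l\<in>{k..<s}. g' l) = (\<Sum>l\<in>{k..<s}. c)"
    using Gq(2)[of "k - 1"] by (intro sum.cong) (auto simp: g'_def c_def)
  also have "(\<Sum>l<k. g' l) = (\<Sum>l<k. g l)"
    using Gq(2)[of _ "k - 1"] k by (intro sum.cong) (auto simp: g'_def c_def)
  finally show ?thesis using h\<nu> by (simp add: k_def)
qed

section \<open>Orthonormal bases of subspaces\<close>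

lemma col_space_image:
  fixes T :: "complex mat"
  assumes "T \<in> carrier_mat n k"
  shows "vec_space.col_space n T = (\<lambda>z. T *\<^sub>v z) ` carrier_vec k"
proof -
  interpret vec_space "TYPE(complex)" n .
  show ?thesis using assms by (auto simp: col_space_eq[OF assms])
qed

lemma cspan_image:
  assumes "\<And>j. j < k \<Longrightarrow> v j \<in> carrier_vec n"
  shows "cspan n (v ` {..<k}) = (\<lambda>z. family_mat n k v *\<^sub>v z) ` carrier_vec k"
proof -
  interpret vec_space "TYPE(complex)" n .
  have "set (cols (family_mat n k v)) = v ` {..<k}"
    using assms by (auto simp: cols_def col_family_mat image_def)
  thus ?thesis
    using col_space_image[of "family_mat n k v" n k] by (simp add: col_space_def)
qed

lemma orthonormal_basis_matI:
  assumes "orthonormal n k w" "U = (\<lambda>z. family_mat n k w *\<^sub>v z) ` carrier_vec k"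
  shows "orthonormal_basis_mat n U (family_mat n k w)"
  using assms orthonormal_gram[OF assms(1)] col_space_image[of "family_mat n k w" n k]
  by (simp add: orthonormal_basis_mat_def)

lemma orthonormal_kernel:
  assumes "orthonormal n k q" "z \<in> carrier_vec k" "family_mat n k q *\<^sub>v z = 0\<^sub>v n"
  shows "z = 0\<^sub>v k"
proof -
  have c: "family_mat n k q \<in> carrier_mat n k" "mat_adjoint (family_mat n k q) \<in> carrier_mat k n" by auto
  have "z = mat_adjoint (family_mat n k q) *\<^sub>v (family_mat n k q *\<^sub>v z)"
    using assoc_mult_mat_vec[OF c(2,1) assms(2)] assms by (simp add: orthonormal_gram)
  also have "\<dots> = 0\<^sub>v k" using c by (intro eq_vecI) (auto simp: assms(3))
  finally show ?thesis .
qed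

lemma orthonormal_le:
  assumes q: "orthonormal n k q"
  shows "k \<le> n"
proof (rule ccontr)
  assume "\<not> k \<le> n"
  moreover have "col (mat_adjoint (family_mat n k q)) j \<in> carrier_vec k" for j
    by (metis col_dim mat_adjoint_dim(1) family_mat_carrier(3))
  ultimately obtain z where z: "z \<in> carrier_vec k" "z \<noteq> 0\<^sub>v k"
    and zw: "\<And>j. j < n \<Longrightarrow> z \<bullet>c col (mat_adjoint (family_mat n k q)) j = 0"
    using exists_orthogonal[of n k "col (mat_adjoint (family_mat n k q))"]
    by (metis (no_types, lifting) not_le)
  have "family_mat n k q *\<^sub>v z = 0\<^sub>v n"
  proof (rule eq_vecI)
    fix j assume "j < dim_vec (0\<^sub>v n)"
    hence "j < n" by simp
    thus "(family_mat n k q *\<^sub>v z) $ j = 0\<^sub>v n $ j"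
      using adjoint_mult_vec_index[of j "mat_adjoint (family_mat n k q)" z] zw z
      by (simp add: mat_adjoint_adjoint del: index_mult_mat_vec)
  qed simp
  with z orthonormal_kernel[OF q z(1)] show False by simp
qed

text \<open>A maximal orthonormal family inside the subspace spans it, since the residual of a projection could be
  added otherwise. Orthonormal vectors are linearly independent, so their number is the dimension.\<close>

lemma subspace_orthonormal_basis:
  assumes Y: "csubspace_of n Y" and dim: "csubspace_dim n Y = p"
  obtains W where "W \<in> carrier_mat n p" "orthonormal_basis_mat n Y W"
proof -
  interpret V: vec_space "TYPE(complex)" n .
  interpret S: submodule class_ring Y "cspace n" using Y by (simp add: subspace_def)
  define P where "P k \<longleftrightarrow> (\<exists>q. orthonormal n k q \<and> q ` {..<k} \<subseteq> Y)" for k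
  have "P 0" by (auto simp: P_def orthonormal_def)
  moreover have "k \<le> n" if "P k" for k using that orthonormal_le by (auto simp: P_def)
  ultimately obtain k where k: "P k" and max: "\<And>k'. P k' \<Longrightarrow> k' \<le> k"
    by (metis GreatestI_nat Greatest_le_nat)
  then obtain q where q: "orthonormal n k q" "q ` {..<k} \<subseteq> Y" by (auto simp: P_def)
  have qc: "q j \<in> carrier_vec n" if "j < k" for j using q(1) that by (rule orthonormal_carrier)
  define Q where "Q = family_mat n k q"
  have Q: "Q \<in> carrier_mat n k" "mat_adjoint Q \<in> carrier_mat k n" by (auto simp: Q_def)
  have QQ: "mat_adjoint Q * Q = 1\<^sub>m k" unfolding Q_def by (rule orthonormal_gram[OF q(1)])
  have span: "cspan n (q ` {..<k}) = (\<lambda>z. Q *\<^sub>v z) ` carrier_vec k"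
    unfolding Q_def by (rule cspan_image[OF qc])
  have sub: "cspan n (q ` {..<k}) \<subseteq> Y"
    by (rule V.span_is_subset[OF q(2)]) (use Y in \<open>simp add: subspace_def\<close>)
  have "Y \<subseteq> cspan n (q ` {..<k})"
  proof
    fix v assume v: "v \<in> Y"
    have vc: "v \<in> carrier_vec n" using S.subset v by auto
    define u where "u = Q *\<^sub>v (mat_adjoint Q *\<^sub>v v)"
    have u: "u \<in> cspan n (q ` {..<k})" unfolding span u_def using Q vc by auto
    have uc: "u \<in> carrier_vec n" using Q vc by (simp add: u_def)
    define z where "z = v + - 1 \<cdot>\<^sub>v u"
    have "- 1 \<cdot>\<^sub>v u \<in> Y" using S.smult_closed[of "-1" u] u sub by auto
    hence zY: "z \<in> Y" using S.m_closed[OF v] by (simp add: z_def)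
    have z: "z \<in> carrier_vec n" using vc uc by (simp add: z_def)
    have "mat_adjoint Q *\<^sub>v u = mat_adjoint Q *\<^sub>v v"
      unfolding u_def using assoc_mult_mat_vec[OF Q(2,1), of "mat_adjoint Q *\<^sub>v v"] Q vc by (simp add: QQ)
    hence zq: "z \<bullet>c q j = 0" if "j < k" for j
      using adjoint_family_mat_index[of j k q n v] adjoint_family_mat_index[of j k q n u] that vc uc qc[OF that]
      by (simp add: z_def Q_def add_scalar_prod_distrib[of _ n] del: index_mult_mat_vec)
    have "z = 0\<^sub>v n"
    proof (rule ccontr)
      assume z0: "z \<noteq> 0\<^sub>v n"
      define w where "w = complex_of_real (1 / sqrt (norm_sq z)) \<cdot>\<^sub>v z"
      have "w \<in> Y" unfolding w_def using S.smult_closed[OF _ zY] by simp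
      hence "(q(k := w)) ` {..<Suc k} \<subseteq> Y" using q(2) by (auto simp: less_Suc_eq)
      with orthonormal_extend[OF q(1) z z0 zq] have "P (Suc k)" unfolding P_def w_def by blast
      with max[of "Suc k"] show False by simp
    qed
    hence "v = u" using vc uc unfolding z_def
      by (intro eq_vecI) (auto dest!: arg_cong[of _ _ "\<lambda>w. w $ _"] simp: vec_eq_iff)
    thus "v \<in> cspan n (q ` {..<k})" using u by simp
  qed
  with sub have YS: "Y = cspan n (q ` {..<k})" by auto
  have inj: "inj_on q {..<k}"
    using q(1) by (auto simp: inj_on_def orthonormal_def) (metis zero_neq_one)
  have cols: "cols Q = map q [0..<k]" by (auto simp: Q_def cols_def col_family_mat qc)
  have li: "\<not> V.lin_dep (q ` {..<k})"
  proof
    assume "V.lin_dep (q ` {..<k})"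
    moreover have "set (cols Q) = q ` {..<k}" "distinct (cols Q)"
      using inj by (auto simp: cols distinct_map atLeast0LessThan)
    ultimately obtain z where "z \<in> carrier_vec k" "z \<noteq> 0\<^sub>v k" "Q *\<^sub>v z = 0\<^sub>v n"
      using V.lin_depE[OF Q(1)] by metis
    thus False using orthonormal_kernel[OF q(1)] by (simp add: Q_def)
  qed
  interpret VY: vectorspace class_ring "(cspace n)\<lparr>carrier := Y\<rparr>"
    by (rule V.subspace_is_vs[OF Y])
  have sm: "submodule class_ring Y (cspace n)" using Y by (simp add: subspace_def)
  have "VY.basis (q ` {..<k})"
    unfolding VY.basis_def
    using V.span_li_not_depend[OF q(2) sm] li YS q(2) by auto
  hence "VY.dim = card (q ` {..<k})" by (intro VY.dim_basis) auto
  hence "k = p" using dim inj by (simp add: card_image)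
  moreover have "orthonormal_basis_mat n Y Q"
    unfolding Q_def by (rule orthonormal_basis_matI[OF q(1)]) (simp add: YS span Q_def)
  ultimately show ?thesis using that Q by blast
qed

text \<open>Orthogonal eigenvectors \<open>q j\<close> of \<open>T\<^sup>H T\<close> have orthogonal images of squared norm \<open>g j\<close>; dividing by
  \<open>sqrt (g j)\<close> therefore gives explicit orthonormal bases for the graphs considered below.\<close>

lemma orthonormal_basis_of_range:
  fixes T :: "complex mat"
  assumes T: "T \<in> carrier_mat n k" and q: "orthonormal k k q"
    and TT: "\<And>j. j < k \<Longrightarrow> mat_adjoint T *\<^sub>v (T *\<^sub>v q j) = complex_of_real (g j) \<cdot>\<^sub>v q j"
    and g: "\<And>j. j < k \<Longrightarrow> 0 < g j"
  shows "orthonormal_basis_mat n ((\<lambda>z. T *\<^sub>v z) ` carrier_vec k)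
    (family_mat n k (\<lambda>j. complex_of_real (1 / sqrt (g j)) \<cdot>\<^sub>v (T *\<^sub>v q j)))"
proof -
  define w where "w j = complex_of_real (1 / sqrt (g j)) \<cdot>\<^sub>v (T *\<^sub>v q j)" for j
  have qc: "q j \<in> carrier_vec k" if "j < k" for j using q that by (rule orthonormal_carrier)
  have wc: "w j \<in> carrier_vec n" if "j < k" for j using T qc[OF that] by (simp add: w_def)
  have Tw: "(T *\<^sub>v z) \<bullet>c w j = of_real (sqrt (g j)) * (z \<bullet>c q j)" if "j < k" "z \<in> carrier_vec k" for z j
  proof -
    have "(T *\<^sub>v z) \<bullet>c w j = of_real (1 / sqrt (g j)) * ((T *\<^sub>v z) \<bullet>c (T *\<^sub>v q j))"
      using T that qc by (simp add: w_def cscalar_smult_right[of _ n])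
    also have "(T *\<^sub>v z) \<bullet>c (T *\<^sub>v q j) = z \<bullet>c (of_real (g j) \<cdot>\<^sub>v q j)"
      using cscalar_adjoint[OF T that(2), of "T *\<^sub>v q j"] T TT[OF that(1)] qc[OF that(1)] by simp
    also have "\<dots> = of_real (g j) * (z \<bullet>c q j)"
      using that qc by (simp add: cscalar_smult_right[of _ k])
    also have "complex_of_real (1 / sqrt (g j)) * (of_real (g j) * (z \<bullet>c q j))
        = of_real (1 / sqrt (g j) * g j) * (z \<bullet>c q j)" by simp
    also have "1 / sqrt (g j) * g j = sqrt (g j)"
      using g[OF that(1)] by (simp add: real_div_sqrt)
    finally show ?thesis .
  qed
  have ww: "w i \<bullet>c w j = (if i = j then 1 else 0)" if ij: "i < k" "j < k" for i j
  proof -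
    have "w i \<bullet>c w j = of_real (1 / sqrt (g i)) * ((T *\<^sub>v q i) \<bullet>c w j)"
      using T ij wc[OF ij(2)] qc[OF ij(1)] by (simp add: w_def)
    also have "\<dots> = of_real (1 / sqrt (g i)) * (of_real (sqrt (g j)) * (q i \<bullet>c q j))"
      by (simp only: Tw[OF ij(2) qc[OF ij(1)]])
    finally show ?thesis using q ij g[OF ij(1)] by (auto simp: orthonormal_def)
  qed
  have on: "orthonormal n k w" using ww wc by (simp add: orthonormal_def)
  define R where "R = family_mat k k (\<lambda>j. complex_of_real (1 / sqrt (g j)) \<cdot>\<^sub>v q j)"
  have R: "R \<in> carrier_mat k k" by (simp add: R_def)
  have wTR: "family_mat n k w = T * R"
  proof (rule mat_col_eqI)
    fix j assume "j < dim_col (T * R)"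
    hence j: "j < k" by (simp add: R_def)
    have "col (T * R) j = T *\<^sub>v (complex_of_real (1 / sqrt (g j)) \<cdot>\<^sub>v q j)"
      using T R j qc[OF j] by (simp add: col_mult2[of _ n k _ k] R_def col_family_mat)
    also have "\<dots> = w j" unfolding w_def using T qc[OF j] by (rule mult_mat_vec)
    finally show "col (family_mat n k w) j = col (T * R) j" using j wc[OF j] by (simp add: col_family_mat)
  qed (use T in \<open>auto simp: R_def\<close>)
  have wz: "family_mat n k w *\<^sub>v z = T *\<^sub>v (R *\<^sub>v z)" if "z \<in> carrier_vec k" for z
    using that T R by (simp add: wTR assoc_mult_mat_vec[of _ n k])
  have surj: "\<exists>c\<in>carrier_vec k. z = R *\<^sub>v c" if z: "z \<in> carrier_vec k" for z
  proof -
    define c where "c = vec k (\<lambda>j. of_real (sqrt (g j)) * (z \<bullet>c q j))"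
    have c: "c \<in> carrier_vec k" by (simp add: c_def)
    have "z = R *\<^sub>v c"
    proof (rule orthonormal_basis_eqI[OF q z])
      fix j assume j: "j < k"
      have "mat_adjoint R *\<^sub>v q j = complex_of_real (1 / sqrt (g j)) \<cdot>\<^sub>v unit_vec k j"
      proof (rule eq_vecI)
        fix a assume "a < dim_vec (complex_of_real (1 / sqrt (g j)) \<cdot>\<^sub>v unit_vec k j)"
        hence a: "a < k" by simp
        have "(mat_adjoint R *\<^sub>v q j) $ a = q j \<bullet>c (complex_of_real (1 / sqrt (g a)) \<cdot>\<^sub>v q a)"
          unfolding R_def using a j qc by (intro adjoint_family_mat_index) auto
        also have "\<dots> = complex_of_real (1 / sqrt (g a)) * (q j \<bullet>c q a)"
          using qc[OF a] qc[OF j] by (simp add: cscalar_smult_right[of _ k])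
        also have "q j \<bullet>c q a = (if j = a then 1 else 0)"
          using q a j by (simp add: orthonormal_def)
        finally show "(mat_adjoint R *\<^sub>v q j) $ a
            = (complex_of_real (1 / sqrt (g j)) \<cdot>\<^sub>v unit_vec k j) $ a"
          using a j by (auto simp: unit_vec_def)
      qed (simp add: R_def)
      hence "(R *\<^sub>v c) \<bullet>c q j = c \<bullet>c (complex_of_real (1 / sqrt (g j)) \<cdot>\<^sub>v unit_vec k j)"
        using cscalar_adjoint[OF R c qc[OF j]] by simp
      also have "\<dots> = complex_of_real (1 / sqrt (g j)) * (c \<bullet>c unit_vec k j)"
        using c by (simp add: cscalar_smult_right[of _ k])
      also have "c \<bullet>c unit_vec k j = of_real (sqrt (g j)) * (z \<bullet>c q j)"
        using c j by (simp add: cscalar_unit_vec c_def)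
      finally show "z \<bullet>c q j = (R *\<^sub>v c) \<bullet>c q j" using g[OF j] by simp
    qed (use R c in auto)
    with c show ?thesis by blast
  qed
  have "(\<lambda>z. T *\<^sub>v z) ` carrier_vec k = (\<lambda>z. family_mat n k w *\<^sub>v z) ` carrier_vec k"
  proof (intro equalityI subsetI)
    fix y assume "y \<in> (\<lambda>z. T *\<^sub>v z) ` carrier_vec k"
    then obtain z where z: "z \<in> carrier_vec k" "y = T *\<^sub>v z" by blast
    from surj[OF z(1)] obtain c where "c \<in> carrier_vec k" "z = R *\<^sub>v c" by blast
    with z(2) wz show "y \<in> (\<lambda>z. family_mat n k w *\<^sub>v z) ` carrier_vec k" by (metis imageI)
  next
    fix y assume "y \<in> (\<lambda>z. family_mat n k w *\<^sub>v z) ` carrier_vec k"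
    then obtain c where "c \<in> carrier_vec k" "y = family_mat n k w *\<^sub>v c" by blast
    thus "y \<in> (\<lambda>z. T *\<^sub>v z) ` carrier_vec k"
      using wz mult_mat_vec_carrier[OF R] by (metis imageI)
  qed
  thus ?thesis using orthonormal_basis_matI[OF on] by (simp add: w_def[abs_def])
qed

section \<open>Graphs over the leading eigenvectors\<close>

abbreviation gram_eigs :: "complex mat \<Rightarrow> real list" where
  "gram_eigs M \<equiv> hermitian_eigenvalues (mat_adjoint M * M)"

text \<open>For an orthonormal basis \<open>v\<close> the \<open>t j\<close> are the columns of a graph:
  \<open>t j = v j + \<Sum>\<^sub>a M\<^sub>a\<^sub>j v (p + a)\<close> with \<open>M\<close> the matrix
  \<open>tail_mat n p v k t\<close>, so that their span is the graph of \<open>M\<close> over the span of \<open>v 0, \<dots>, v (k - 1)\<close>.\<close>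

definition graph_family :: "nat \<Rightarrow> nat \<Rightarrow> (nat \<Rightarrow> complex vec) \<Rightarrow> nat \<Rightarrow> (nat \<Rightarrow> complex vec) \<Rightarrow> bool" where
  "graph_family n p v k t \<longleftrightarrow> (\<forall>j<k. t j \<in> carrier_vec n \<and> (\<forall>a<p. t j \<bullet>c v a = (if a = j then 1 else 0)))"

definition tail_mat :: "nat \<Rightarrow> nat \<Rightarrow> (nat \<Rightarrow> complex vec) \<Rightarrow> nat \<Rightarrow> (nat \<Rightarrow> complex vec) \<Rightarrow> complex mat" where
  "tail_mat n p v k t = mat (n - p) k (\<lambda>(a, j). t j \<bullet>c v (p + a))"

lemma tail_mat_carrier [simp]: "tail_mat n p v k t \<in> carrier_mat (n - p) k"
  "dim_row (tail_mat n p v k t) = n - p" "dim_col (tail_mat n p v k t) = k"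
  by (simp_all add: tail_mat_def)

lemma graph_family_mono: "graph_family n p v k t \<Longrightarrow> i \<le> k \<Longrightarrow> graph_family n p v i t"
  by (auto simp: graph_family_def)

lemma family_mat_mult_cscalar:
  assumes t: "\<And>j. j < k \<Longrightarrow> t j \<in> carrier_vec n" and w: "w \<in> carrier_vec n" and u: "u \<in> carrier_vec k"
  shows "(family_mat n k t *\<^sub>v u) \<bullet>c w = (\<Sum>j<k. u $ j * (t j \<bullet>c w))"
proof -
  have "(family_mat n k t *\<^sub>v u) \<bullet>c w = (\<Sum>i<n. \<Sum>j<k. u $ j * (t j $ i * cnj (w $ i)))"
    using w u by (simp add: scalar_prod_def lessThan_atLeast0 sum_distrib_left sum_distrib_right family_mat_def mult_ac)
  also have "\<dots> = (\<Sum>j<k. \<Sum>i<n. u $ j * (t j $ i * cnj (w $ i)))" by (rule sum.swap)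
  also have "\<dots> = (\<Sum>j<k. u $ j * (t j \<bullet>c w))"
    using w by (simp add: scalar_prod_def lessThan_atLeast0 sum_distrib_left)
  finally show ?thesis .
qed

lemma graph_coords:
  assumes v: "orthonormal n n v" and t: "graph_family n p v k t" and le: "k \<le> p" and a: "a < n"
    and u: "u \<in> carrier_vec k"
  shows "(family_mat n k t *\<^sub>v u) \<bullet>c v a =
    (if a < k then u $ a else if a < p then 0 else (tail_mat n p v k t *\<^sub>v u) $ (a - p))"
proof -
  have "(family_mat n k t *\<^sub>v u) \<bullet>c v a = (\<Sum>j<k. u $ j * (t j \<bullet>c v a))"
    using t orthonormal_carrier[OF v a] u by (intro family_mat_mult_cscalar) (auto simp: graph_family_def)
  also have "\<dots> = (if a < k then u $ a else if a < p then 0 else (tail_mat n p v k t *\<^sub>v u) $ (a - p))"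
  proof (cases "a < p")
    case True
    hence "(\<Sum>j<k. u $ j * (t j \<bullet>c v a)) = (\<Sum>j<k. if j = a then u $ j else 0)"
      using t by (intro sum.cong refl) (auto simp: graph_family_def)
    thus ?thesis using True by simp
  next
    case False
    thus ?thesis using u a le
      by (auto simp: tail_mat_def scalar_prod_def lessThan_atLeast0 mult.commute intro!: sum.cong)
  qed
  finally show ?thesis .
qed

lemma graph_form:
  fixes \<mu> :: "nat \<Rightarrow> real"
  assumes v: "orthonormal n n v" and t: "graph_family n p v k t" and le: "k \<le> p" "p \<le> n"
    and u: "u \<in> carrier_vec k"
  shows "(\<Sum>a<n. \<mu> a * (cmod ((family_mat n k t *\<^sub>v u) \<bullet>c v a))\<^sup>2) =
    (\<Sum>a<k. \<mu> a * (cmod (u $ a))\<^sup>2) + (\<Sum>a<n - p. \<mu> (p + a) * (cmod ((tail_mat n p v k t *\<^sub>v u) $ a))\<^sup>2)"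
    (is "(\<Sum>a<n. ?F a) = _")
proof -
  have "(\<Sum>a<n. ?F a) = (\<Sum>a<k. ?F a) + (\<Sum>a\<in>{k..<p}. ?F a) + (\<Sum>a\<in>{p..<n}. ?F a)"
    using le by (simp add: lessThan_atLeast0 sum.atLeastLessThan_concat)
  also have "(\<Sum>a<k. ?F a) = (\<Sum>a<k. \<mu> a * (cmod (u $ a))\<^sup>2)"
    using graph_coords[OF v t le(1) _ u] le by (intro sum.cong) auto
  also have "(\<Sum>a\<in>{k..<p}. ?F a) = 0"
    using graph_coords[OF v t le(1) _ u] le by (intro sum.neutral) auto
  also have "(\<Sum>a\<in>{p..<n}. ?F a) = (\<Sum>a<n - p. ?F (p + a))"
    using sum.shift_bounds_nat_ivl[of ?F 0 p "n - p"] le by (simp add: lessThan_atLeast0 add.commute)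
  also have "\<dots> = (\<Sum>a<n - p. \<mu> (p + a) * (cmod ((tail_mat n p v k t *\<^sub>v u) $ a))\<^sup>2)"
    using graph_coords[OF v t le(1) _ u] le by (intro sum.cong refl) (auto simp del: index_mult_mat_vec)
  finally show ?thesis by simp
qed

lemma graph_norm_sq:
  assumes "orthonormal n n v" "graph_family n p v k t" "k \<le> p" "p \<le> n" "u \<in> carrier_vec k"
  shows "norm_sq (family_mat n k t *\<^sub>v u) = norm_sq u + norm_sq (tail_mat n p v k t *\<^sub>v u)"
proof -
  have "family_mat n k t *\<^sub>v u \<in> carrier_vec n"
    by (rule mult_mat_vec_carrier[OF family_mat_carrier(1) assms(5)])
  from norm_sq_coords[OF assms(1) this] graph_form[OF assms, of "\<lambda>_. 1"]
  have "norm_sq (family_mat n k t *\<^sub>v u) =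
      (\<Sum>a<k. (cmod (u $ a))\<^sup>2) + (\<Sum>a<n - p. (cmod ((tail_mat n p v k t *\<^sub>v u) $ a))\<^sup>2)"
    by (simp del: index_mult_mat_vec)
  thus ?thesis using assms(5)
    by (simp add: norm_sq_def[of u] norm_sq_def[of "tail_mat n p v k t *\<^sub>v u"] del: index_mult_mat_vec)
qed

text \<open>The columns of the graph satisfy \<open>T\<^sup>H T = 1 + M\<^sup>H M\<close>.\<close>

lemma graph_spectral:
  assumes v: "orthonormal n n v" and t: "graph_family n p v k t" and le: "k \<le> p" "p \<le> n"
  obtains q where "orthonormal k k q"
    "diag_form k (\<lambda>u. norm_sq (family_mat n k t *\<^sub>v u)) (\<lambda>j. 1 + gram_eigs (tail_mat n p v k t) ! j) q"
    "\<And>j. j < k \<Longrightarrow> mat_adjoint (family_mat n k t) *\<^sub>v (family_mat n k t *\<^sub>v q j) =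
      complex_of_real (1 + gram_eigs (tail_mat n p v k t) ! j) \<cdot>\<^sub>v q j"
    "\<And>j. j < k \<Longrightarrow> 0 \<le> gram_eigs (tail_mat n p v k t) ! j"
    "length (gram_eigs (tail_mat n p v k t)) = k"
    "\<And>i j. i \<le> j \<Longrightarrow> j < k \<Longrightarrow> gram_eigs (tail_mat n p v k t) ! j \<le> gram_eigs (tail_mat n p v k t) ! i"
proof -
  define T M where "T = family_mat n k t" and "M = tail_mat n p v k t"
  have T: "T \<in> carrier_mat n k" and M: "M \<in> carrier_mat (n - p) k" by (auto simp: T_def M_def)
  obtain q where q: "diag_form k (\<lambda>z. norm_sq (T *\<^sub>v z)) (\<lambda>j. gram_eigs T ! j) q"
    "\<And>j. j < k \<Longrightarrow> mat_adjoint T *\<^sub>v (T *\<^sub>v q j) = complex_of_real (gram_eigs T ! j) \<cdot>\<^sub>v q j"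
    using gram_spectral[OF T] by blast
  obtain r where r: "length (gram_eigs M) = k" "diag_form k (\<lambda>z. norm_sq (M *\<^sub>v z)) (\<lambda>j. gram_eigs M ! j) r"
    using gram_spectral[OF M] by blast
  note R = diag_formD[OF r(2)] and Q = diag_formD[OF q(1)]
  have "diag_form k (\<lambda>z. norm_sq (T *\<^sub>v z)) (\<lambda>j. 1 + gram_eigs M ! j) r"
    unfolding diag_form_def using R
    by (auto simp: T_def M_def graph_norm_sq[OF v t le] norm_sq_coords[OF R(1)] distrib_right sum.distrib)
  hence eq: "gram_eigs T ! j = 1 + gram_eigs M ! j" if "j < k" for j
    using diag_form_unique[OF q(1) _ refl that] by blast
  have "diag_form k (\<lambda>z. norm_sq (T *\<^sub>v z)) (\<lambda>j. 1 + gram_eigs M ! j) q"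
    using Q eq unfolding diag_form_def by (auto intro!: sum.cong)
  moreover have "0 \<le> gram_eigs M ! j" if "j < k" for j
    using diag_form_basis[OF r(2) that] norm_sq_nonneg by metis
  ultimately show ?thesis
    using that[of q] Q(1) q(2) eq r(1) R(2) by (simp add: T_def M_def)
qed

text \<open>For the orthonormal basis \<open>z j = (1 + b j)\<^sup>-\<^sup>1\<^sup>/\<^sup>2 T q\<^sub>j\<close> of the graph, \<open>Z\<^sup>H V u\<close> has the components
  \<open>(1 + b j)\<^sup>-\<^sup>1\<^sup>/\<^sup>2 \<langle>u, q\<^sub>j\<rangle>\<close>. Hence the squared cosines are \<open>1 / (1 + b j)\<close> and the squared tangents are
  the eigenvalues \<open>b j\<close> of \<open>M\<^sup>H M\<close>.\<close>

lemma graph_angles: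
  assumes v: "orthonormal n n v" and t: "graph_family n p v k t" and le: "k \<le> p" "p \<le> n"
  shows "principal_angles n ((\<lambda>z. family_mat n k v *\<^sub>v z) ` carrier_vec k) ((\<lambda>z. family_mat n k t *\<^sub>v z) ` carrier_vec k)
    = map (\<lambda>j. arccos (sqrt (1 / (1 + gram_eigs (tail_mat n p v k t) ! j)))) [0..<k]"
proof -
  define b where "b j = gram_eigs (tail_mat n p v k t) ! j" for j
  define T where "T = family_mat n k t"
  obtain q where q: "orthonormal k k q"
    "\<And>j. j < k \<Longrightarrow> mat_adjoint T *\<^sub>v (T *\<^sub>v q j) = complex_of_real (1 + b j) \<cdot>\<^sub>v q j"
    and b0: "\<And>j. j < k \<Longrightarrow> 0 \<le> b j" and bm: "\<And>i j. i \<le> j \<Longrightarrow> j < k \<Longrightarrow> b j \<le> b i"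
    using graph_spectral[OF v t le] unfolding b_def T_def by metis
  have T: "T \<in> carrier_mat n k" by (simp add: T_def)
  have qc: "q j \<in> carrier_vec k" if "j < k" for j using q(1) that by (rule orthonormal_carrier)
  define z where "z j = complex_of_real (1 / sqrt (1 + b j)) \<cdot>\<^sub>v (T *\<^sub>v q j)" for j
  define W Z where "W = family_mat n k v" and "Z = family_mat n k z"
  have W: "W \<in> carrier_mat n k" and Z: "Z \<in> carrier_mat n k" "mat_adjoint Z \<in> carrier_mat k n"
    by (auto simp: W_def Z_def)
  have zc: "z j \<in> carrier_vec n" if "j < k" for j using T qc[OF that] by (simp add: z_def)
  have pos: "0 < 1 + b j" if "j < k" for j using b0[OF that] by simp
  have OZ: "orthonormal_basis_mat n ((\<lambda>z. T *\<^sub>v z) ` carrier_vec k) Z"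
    unfolding Z_def z_def[abs_def] by (rule orthonormal_basis_of_range[OF T q(1,2) pos])
  have vk: "orthonormal n k v" using v le by (auto simp: orthonormal_def)
  have OW: "orthonormal_basis_mat n ((\<lambda>z. W *\<^sub>v z) ` carrier_vec k) W"
    unfolding W_def by (rule orthonormal_basis_matI[OF vk refl])
  define N where "N = mat_adjoint Z * W"
  have N: "N \<in> carrier_mat k k" using Z W by (simp add: N_def)
  have WT: "mat_adjoint W *\<^sub>v (T *\<^sub>v u) = u" if u: "u \<in> carrier_vec k" for u
  proof (rule eq_vecI)
    fix a assume "a < dim_vec u"
    hence a: "a < k" using u by simp
    have "(mat_adjoint W *\<^sub>v (T *\<^sub>v u)) $ a = (T *\<^sub>v u) \<bullet>c v a"
      unfolding W_def using a T u orthonormal_carrier[OF vk a] by (intro adjoint_family_mat_index) auto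
    thus "(mat_adjoint W *\<^sub>v (T *\<^sub>v u)) $ a = u $ a"
      using graph_coords[OF v t le(1) _ u, of a] a le by (simp add: T_def del: index_mult_mat_vec)
  qed (use u W in auto)
  have Nz: "norm_sq (N *\<^sub>v u) = (\<Sum>j<k. 1 / (1 + b j) * (cmod (u \<bullet>c q j))\<^sup>2)" if u: "u \<in> carrier_vec k" for u
  proof -
    have "(N *\<^sub>v u) $ j = of_real (1 / sqrt (1 + b j)) * (u \<bullet>c q j)" if j: "j < k" for j
    proof -
      have "N *\<^sub>v u = mat_adjoint Z *\<^sub>v (W *\<^sub>v u)"
        unfolding N_def by (rule assoc_mult_mat_vec[OF Z(2) W u])
      hence "(N *\<^sub>v u) $ j = (W *\<^sub>v u) \<bullet>c z j"
        using adjoint_family_mat_index[of j k z n "W *\<^sub>v u"] j zc[OF j] W u by (simp add: Z_def del: index_mult_mat_vec)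
      also have "\<dots> = of_real (1 / sqrt (1 + b j)) * ((W *\<^sub>v u) \<bullet>c (T *\<^sub>v q j))"
        using W T u qc[OF j] by (simp add: z_def cscalar_smult_right[of _ n])
      also have "(W *\<^sub>v u) \<bullet>c (T *\<^sub>v q j) = u \<bullet>c q j"
        using cscalar_adjoint[OF W u, of "T *\<^sub>v q j"] T qc[OF j] WT[OF qc[OF j]] by simp
      finally show ?thesis .
    qed
    thus ?thesis using N b0
      by (auto simp: norm_sq_def norm_mult norm_divide power_mult_distrib power_divide abs_of_nonneg simp del: index_mult_mat_vec intro!: sum.cong)
  qed
  \<comment> \<open>Small \<open>b j\<close> belong to large cosines, so the order has to be reversed; negating twice does this.\<close>
  have "diag_form k (\<lambda>u. - norm_sq (N *\<^sub>v u)) (\<lambda>j. - (1 / (1 + b j))) q"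
    unfolding diag_form_def using q(1) Nz bm b0
    by (auto simp: sum_negf intro!: divide_left_mono mult_pos_pos add_pos_nonneg)
  from diag_form_uminus[OF this]
  have D: "diag_form k (\<lambda>u. norm_sq (N *\<^sub>v u)) (\<lambda>j. 1 / (1 + b (k - 1 - j))) (\<lambda>j. q (k - 1 - j))" by simp
  obtain r where r: "length (gram_eigs N) = k" "diag_form k (\<lambda>u. norm_sq (N *\<^sub>v u)) (\<lambda>j. gram_eigs N ! j) r"
    using gram_spectral[OF N] by blast
  define F where "F j = arccos (sqrt (1 / (1 + b j)))" for j
  have "gram_eigs N ! j = 1 / (1 + b (k - 1 - j))" if "j < k" for j
    by (rule diag_form_unique[OF r(2) D refl that])
  hence sv: "map arccos (singular_values N) = rev (map F [0..<k])"
    using r(1) by (intro nth_equalityI) (auto simp: singular_values_def F_def rev_nth)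
  have "F j \<le> F i" if "i \<le> j" "j < k" for i j
    unfolding F_def
  proof (rule arccos_le_arccos)
    have "0 \<le> 1 / (1 + b i)" using b0[of i] that by simp
    thus "- 1 \<le> sqrt (1 / (1 + b i))" by (meson order_trans real_sqrt_ge_zero neg_le_0_iff_le zero_le_one)
    show "sqrt (1 / (1 + b i)) \<le> sqrt (1 / (1 + b j))"
      using b0[of j] b0[of i] bm[OF that] that by (auto intro!: divide_left_mono mult_pos_pos add_pos_nonneg)
    show "sqrt (1 / (1 + b j)) \<le> 1" using b0[of j] that by (simp add: field_simps)
  qed
  hence "decreasing (rev (map F [0..<k])) = map F [0..<k]"
    by (intro decreasing_eqI) auto
  thus ?thesis
    using principal_angles_eq[OF OW OZ] sv unfolding N_def F_def b_def W_def T_def by simp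
qed

lemma tan_arccos_sqrt:
  assumes "0 \<le> b"
  shows "(tan (arccos (sqrt (1 / (1 + b)))))\<^sup>2 = b"
proof -
  define y where "y = sqrt (1 / (1 + b))"
  have y: "0 < y" "y \<le> 1" "y\<^sup>2 = 1 / (1 + b)" using assms by (auto simp: y_def field_simps)
  have "y\<^sup>2 \<le> 1" using y by (intro power_le_one) auto
  hence "(tan (arccos y))\<^sup>2 = (1 - y\<^sup>2) / y\<^sup>2"
    using y(1,2) by (simp add: tan_def sin_arccos cos_arccos power_divide abs_square_le_1)
  also have "\<dots> = b" using assms by (simp add: y(3) field_simps)
  finally show ?thesis by (simp add: y_def)
qed

text \<open>Interlacing: the smaller matrix consists of the first \<open>i\<close> columns of the larger one, so its quadratic
  form is the restriction of the larger form to a coordinate subspace.\<close>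

lemma gram_eigs_tail_mono:
  assumes ij: "j < i" "i \<le> k"
  shows "gram_eigs (tail_mat n p v i t) ! j \<le> gram_eigs (tail_mat n p v k t) ! j"
proof -
  \<comment> \<open>The inclusion of \<open>\<complex>\<^sup>i\<close> into \<open>\<complex>\<^sup>k\<close>.\<close>
  define L where "L = mat k i (\<lambda>(a, b). if a = b then 1 else 0 :: complex)"
  have L: "L \<in> carrier_mat k i" by (simp add: L_def)
  obtain q where q: "diag_form i (\<lambda>z. norm_sq (tail_mat n p v i t *\<^sub>v z)) (\<lambda>j. gram_eigs (tail_mat n p v i t) ! j) q"
    using gram_spectral[of "tail_mat n p v i t" "n - p" i] by auto
  obtain r where r: "diag_form k (\<lambda>z. norm_sq (tail_mat n p v k t *\<^sub>v z)) (\<lambda>j. gram_eigs (tail_mat n p v k t) ! j) r"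
    using gram_spectral[of "tail_mat n p v k t" "n - p" k] by auto
  obtain z where z: "z \<in> carrier_vec i" "0 < norm_sq z"
    "gram_eigs (tail_mat n p v i t) ! j * norm_sq z \<le> norm_sq (tail_mat n p v i t *\<^sub>v z)"
    "norm_sq (tail_mat n p v k t *\<^sub>v (L *\<^sub>v z)) \<le> gram_eigs (tail_mat n p v k t) ! j * norm_sq (L *\<^sub>v z)"
    using diag_form_compare[OF q r L] ij by (metis order.strict_trans2)
  have Lz: "(L *\<^sub>v z) $ a = (if a < i then z $ a else 0)" if "a < k" for a
    using that z(1) by (simp add: L_def scalar_prod_def if_distrib[of "\<lambda>x. x * _"] cong: if_cong)
  have split: "{..<k} = {..<i} \<union> {i..<k}" "{..<i} \<inter> {i..<k} = {}" using ij by auto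
  have "norm_sq (L *\<^sub>v z) = norm_sq z"
    using z(1) L ij unfolding norm_sq_def
    by (simp add: Lz split sum.union_disjoint del: index_mult_mat_vec)
  moreover have "tail_mat n p v k t *\<^sub>v (L *\<^sub>v z) = tail_mat n p v i t *\<^sub>v z"
  proof (rule eq_vecI)
    fix a assume "a < dim_vec (tail_mat n p v i t *\<^sub>v z)"
    hence a: "a < n - p" by simp
    have "(tail_mat n p v k t *\<^sub>v (L *\<^sub>v z)) $ a = (\<Sum>b<k. t b \<bullet>c v (p + a) * (L *\<^sub>v z) $ b)"
      using a L by (simp add: tail_mat_def scalar_prod_def lessThan_atLeast0)
    also have "\<dots> = (\<Sum>b<k. if b < i then t b \<bullet>c v (p + a) * z $ b else 0)"
      by (intro sum.cong refl) (simp add: Lz del: index_mult_mat_vec)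
    also have "\<dots> = (\<Sum>b\<in>{..<k} \<inter> {b. b < i}. t b \<bullet>c v (p + a) * z $ b)" by (simp add: sum.If_cases)
    also have "{..<k} \<inter> {b. b < i} = {..<i}" using ij by auto
    also have "(\<Sum>b<i. t b \<bullet>c v (p + a) * z $ b) = (tail_mat n p v i t *\<^sub>v z) $ a"
      using a z(1) by (simp add: tail_mat_def scalar_prod_def lessThan_atLeast0)
    finally show "(tail_mat n p v k t *\<^sub>v (L *\<^sub>v z)) $ a = (tail_mat n p v i t *\<^sub>v z) $ a" .
  qed simp
  ultimately have "gram_eigs (tail_mat n p v i t) ! j * norm_sq z \<le> gram_eigs (tail_mat n p v k t) ! j * norm_sq z"
    using z(3,4) by simp
  thus ?thesis using z(2) by simp
qed

lemma decreasing_square: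
  assumes "\<And>a. a \<in> set as \<Longrightarrow> 0 \<le> a"
  shows "decreasing (tuple_square as) = tuple_square (decreasing as)"
proof (rule decreasing_eqI)
  show "mset (tuple_square as) = mset (tuple_square (decreasing as))"
    by (simp add: decreasing_def)
  fix i j assume ij: "i \<le> j" "j < length (tuple_square (decreasing as))"
  hence "decreasing as ! j \<in> set (decreasing as)" by (intro nth_mem) simp
  hence "0 \<le> decreasing as ! j" using assms by (simp add: decreasing_def)
  thus "tuple_square (decreasing as) ! j \<le> tuple_square (decreasing as) ! i"
    using ij decreasing_antimono[of i j as] by (simp add: power_mono)
qed

lemma diagonal_form_sorted:
  obtains q where "diag_form s (\<lambda>z. \<Sum>j<s. (e j)\<^sup>2 * (cmod (z $ j))\<^sup>2)
    (\<lambda>j. decreasing (map (\<lambda>j. (e j)\<^sup>2) [0..<s]) ! j) q"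
  using diag_form_sort[OF orthonormal_unit_vecs, of s "\<lambda>z. \<Sum>j<s. (e j)\<^sup>2 * (cmod (z $ j))\<^sup>2" "\<lambda>j. (e j)\<^sup>2"]
  by (auto simp: cscalar_unit_vec)

text \<open>How diagonal scalings of rows and columns affect singular values. The inequality \<open>ky_fan_product\<close> is used
  twice, for the columns and for the rows; in between, the bound for the rows enters as a
  bound on all initial sums, which is what \<open>abel_sum_le\<close> needs.\<close>

lemma gram_eigs_scaled:
  fixes B :: "complex mat" and \<phi> \<psi> :: "nat \<Rightarrow> complex"
  assumes B: "B \<in> carrier_mat r s" and sr: "s \<le> r" and k: "k \<le> s"
  defines "C \<equiv> mat r s (\<lambda>(a, j). \<psi> a * B $$ (a, j) * \<phi> j)"
  shows "(\<Sum>l<k. gram_eigs C ! l) \<le> (\<Sum>l<k. (decreasing (map (\<lambda>j. cmod (\<phi> j)) [0..<s]) ! l)\<^sup>2 *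
    (decreasing (map (\<lambda>a. cmod (\<psi> a)) [0..<r]) ! l)\<^sup>2 * gram_eigs B ! l)"
proof -
  define P where "P = mat s s (\<lambda>(a, j). if a = j then \<phi> j else 0)"
  define E where "E = mat r s (\<lambda>(a, j). \<psi> a * B $$ (a, j))"
  have P: "P \<in> carrier_mat s s" and E: "E \<in> carrier_mat r s" and C: "C \<in> carrier_mat r s"
    by (auto simp: P_def E_def C_def)
  define \<Delta> where "\<Delta> w = (\<Sum>a<r. (cmod (\<psi> a))\<^sup>2 * (cmod (w $ a))\<^sup>2)" for w :: "complex vec"
  define f2 where "f2 l = decreasing (map (\<lambda>a. (cmod (\<psi> a))\<^sup>2) [0..<r]) ! l" for l
  define p2 where "p2 l = decreasing (map (\<lambda>j. (cmod (\<phi> j))\<^sup>2) [0..<s]) ! l" for l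
  have f2: "f2 l = (decreasing (map (\<lambda>a. cmod (\<psi> a)) [0..<r]) ! l)\<^sup>2" if "l < r" for l
  proof -
    have "decreasing (tuple_square (map (\<lambda>a. cmod (\<psi> a)) [0..<r]))
        = tuple_square (decreasing (map (\<lambda>a. cmod (\<psi> a)) [0..<r]))"
      by (rule decreasing_square) auto
    thus ?thesis using that by (simp add: f2_def o_def)
  qed
  have p2: "p2 l = (decreasing (map (\<lambda>j. cmod (\<phi> j)) [0..<s]) ! l)\<^sup>2" if "l < s" for l
  proof -
    have "decreasing (tuple_square (map (\<lambda>j. cmod (\<phi> j)) [0..<s]))
        = tuple_square (decreasing (map (\<lambda>j. cmod (\<phi> j)) [0..<s]))"
      by (rule decreasing_square) auto
    thus ?thesis using that by (simp add: p2_def o_def)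
  qed
  obtain qf where qf: "diag_form r \<Delta> f2 qf"
    using diagonal_form_sorted[of r "\<lambda>a. cmod (\<psi> a)"] unfolding \<Delta>_def f2_def by blast
  obtain qb where qb: "diag_form s (\<lambda>z. norm_sq (B *\<^sub>v z)) (\<lambda>l. gram_eigs B ! l) qb"
    using gram_spectral[OF B] by blast
  obtain qc where qc: "diag_form s (\<lambda>z. norm_sq (C *\<^sub>v z)) (\<lambda>l. gram_eigs C ! l) qc"
    using gram_spectral[OF C] by blast
  obtain m qe where qe: "diag_form s (\<lambda>z. norm_sq (E *\<^sub>v z)) m qe"
    using gram_spectral[OF E] by blast
  have Ez: "norm_sq (E *\<^sub>v z) = \<Delta> (B *\<^sub>v z)" if "z \<in> carrier_vec s" for z
  proof -
    have "(E *\<^sub>v z) $ a = \<psi> a * (B *\<^sub>v z) $ a" if "a < r" for a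
      using that \<open>z \<in> carrier_vec s\<close> B by (simp add: E_def scalar_prod_def sum_distrib_left mult_ac)
    thus ?thesis using E by (simp add: norm_sq_def \<Delta>_def norm_mult power_mult_distrib del: index_mult_mat_vec)
  qed
  have Pz: "(P *\<^sub>v z) $ j = \<phi> j * z $ j" if "z \<in> carrier_vec s" "j < s" for z j
    using that by (simp add: P_def scalar_prod_def if_distrib[of "\<lambda>x. x * _"] cong: if_cong)
  have CEP: "C *\<^sub>v z = E *\<^sub>v (P *\<^sub>v z)" if z: "z \<in> carrier_vec s" for z
  proof (rule eq_vecI)
    fix a assume "a < dim_vec (E *\<^sub>v (P *\<^sub>v z))"
    hence a: "a < r" using E by simp
    have "(E *\<^sub>v (P *\<^sub>v z)) $ a = (\<Sum>j<s. E $$ (a, j) * (P *\<^sub>v z) $ j)"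
      using a E P by (simp add: scalar_prod_def lessThan_atLeast0)
    also have "\<dots> = (\<Sum>j<s. C $$ (a, j) * z $ j)"
      using a z by (intro sum.cong refl) (simp add: Pz E_def C_def del: index_mult_mat_vec)
    also have "\<dots> = (C *\<^sub>v z) $ a" using a C z by (simp add: scalar_prod_def lessThan_atLeast0)
    finally show "(C *\<^sub>v z) $ a = (E *\<^sub>v (P *\<^sub>v z)) $ a" by simp
  qed (use C E in auto)
  obtain qp where qp0: "diag_form s (\<lambda>z. \<Sum>j<s. (cmod (\<phi> j))\<^sup>2 * (cmod (z $ j))\<^sup>2) p2 qp"
    using diagonal_form_sorted[of s "\<lambda>j. cmod (\<phi> j)"] unfolding p2_def by blast
  have "norm_sq (P *\<^sub>v z) = (\<Sum>j<s. (cmod (\<phi> j))\<^sup>2 * (cmod (z $ j))\<^sup>2)" if "z \<in> carrier_vec s" for z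
    using P that by (simp add: norm_sq_def Pz norm_mult power_mult_distrib del: index_mult_mat_vec)
  hence qp: "diag_form s (\<lambda>z. norm_sq (P *\<^sub>v z)) p2 qp" using qp0 by (simp add: diag_form_def)
  have qc': "diag_form s (\<lambda>z. norm_sq (E *\<^sub>v (P *\<^sub>v z))) (\<lambda>l. gram_eigs C ! l) qc"
    using qc CEP by (simp add: diag_form_def)
  have qe': "diag_form s (\<lambda>z. \<Delta> (B *\<^sub>v z)) m qe" using qe Ez by (simp add: diag_form_def)
  have m0: "0 \<le> m l" if "l < s" for l using diag_form_basis[OF qe that] norm_sq_nonneg by metis
  have "(\<Sum>l<k. gram_eigs C ! l) \<le> (\<Sum>l<k. m l * p2 l)"
    by (rule ky_fan_product[OF P qe m0 qc' qp k k])
  also have "\<dots> = (\<Sum>l<k. p2 l * m l)" by (simp add: mult.commute)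
  also have "\<dots> \<le> (\<Sum>l<k. p2 l * (f2 l * gram_eigs B ! l))"
  proof (rule abel_sum_le)
    show "p2 j \<le> p2 i" if "i \<le> j" "j < k" for i j using diag_formD(2)[OF qp] that k by auto
    show "0 \<le> p2 j" if "j < k" for j using p2[of j] that k by simp
    show "(\<Sum>j<l. m j) \<le> (\<Sum>j<l. f2 j * gram_eigs B ! j)" if "l \<le> k" for l
      by (rule ky_fan_product[OF B qf _ qe' qb]) (use f2 that k sr in auto)
  qed
  also have "\<dots> = (\<Sum>l<k. (decreasing (map (\<lambda>j. cmod (\<phi> j)) [0..<s]) ! l)\<^sup>2 *
    (decreasing (map (\<lambda>a. cmod (\<psi> a)) [0..<r]) ! l)\<^sup>2 * gram_eigs B ! l)"
    using k sr by (intro sum.cong) (auto simp: p2 f2 mult.assoc)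
  finally show ?thesis .
qed

text \<open>The Ritz values are compared on the part of the graph above the first \<open>i\<close> eigenvectors only. There
  \<open>S u = \<Sum>\<^sub>j\<^sub><\<^sub>i u\<^sub>j t\<^sub>j\<close> has squared norm \<open>u\<^sup>H (1 + M\<^sup>H M) u\<close>, and shifting \<open>A\<close> by \<open>\<mu> (n - 1)\<close>, its smallest
  eigenvalue, makes the contribution of the tail nonnegative, whence
  \<open>\<langle>(A - \<mu> (n - 1)) S u, S u\<rangle> \<ge> \<Sum>\<^sub>j (\<mu> j - \<mu> (n - 1)) |u\<^sub>j|\<^sup>2\<close>. So \<open>sum_ratio_le_top_eigenvalues\<close> applies, and the \<open>1\<close>
  in \<open>1 + M\<^sup>H M\<close> cancels against \<open>(\<mu> j - \<eta>\<^sub>j) / (\<eta>\<^sub>j - \<mu> (n - 1)) = (\<mu> j - \<mu> (n - 1)) / (\<eta>\<^sub>j - \<mu> (n - 1)) - 1\<close>.\<close>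

lemma graph_ritz:
  fixes A :: "complex mat" and \<mu> :: "nat \<Rightarrow> real"
  assumes A: "A \<in> carrier_mat n n" and herm: "mat_adjoint A = A"
    and v: "orthonormal n n v" and Av: "\<And>j. j < n \<Longrightarrow> A *\<^sub>v v j = complex_of_real (\<mu> j) \<cdot>\<^sub>v v j"
    and \<mu>: "\<And>i j. i \<le> j \<Longrightarrow> j < n \<Longrightarrow> \<mu> j \<le> \<mu> i"
    and t: "graph_family n p v p t" and le: "i \<le> p" "p \<le> n" and gap: "\<And>j. j < p \<Longrightarrow> \<mu> (n - 1) < \<mu> j"
    and J: "J \<subseteq> {..<i}" "J \<noteq> {}"
  defines "\<eta> \<equiv> ritz_values n A ((\<lambda>z. family_mat n p t *\<^sub>v z) ` carrier_vec p)"
  shows "(\<Sum>j\<in>J. (\<mu> j - \<eta> ! j) / (\<eta> ! j - \<mu> (n - 1))) \<le> (\<Sum>l<card J. gram_eigs (tail_mat n p v i t) ! l)"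
proof -
  define T where "T = family_mat n p t"
  have T: "T \<in> carrier_mat n p" by (simp add: T_def)
  obtain q where q: "orthonormal p p q"
    "\<And>j. j < p \<Longrightarrow> mat_adjoint T *\<^sub>v (T *\<^sub>v q j) = complex_of_real (1 + gram_eigs (tail_mat n p v p t) ! j) \<cdot>\<^sub>v q j"
    "\<And>j. j < p \<Longrightarrow> 0 \<le> gram_eigs (tail_mat n p v p t) ! j"
    using graph_spectral[OF v t order_refl le(2)] unfolding T_def by metis
  have pos: "0 < 1 + gram_eigs (tail_mat n p v p t) ! j" if "j < p" for j using q(3)[OF that] by simp
  obtain W where W: "W \<in> carrier_mat n p" and OW: "orthonormal_basis_mat n ((\<lambda>z. T *\<^sub>v z) ` carrier_vec p) W"
    using orthonormal_basis_of_range[OF T q(1,2) pos] family_mat_carrier(1) by blast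
  have WH: "mat_adjoint W \<in> carrier_mat p n" using W by auto
  have WW: "mat_adjoint W * W = 1\<^sub>m p" using OW W by (simp add: orthonormal_basis_mat_def)
  have range: "(\<lambda>z. W *\<^sub>v z) ` carrier_vec p = (\<lambda>z. T *\<^sub>v z) ` carrier_vec p"
    using OW col_space_image[OF W] by (simp add: orthonormal_basis_mat_def)
  define H where "H = mat_adjoint W * A * W"
  have WA: "mat_adjoint W * A \<in> carrier_mat p n" using WH A by simp
  have H: "H \<in> carrier_mat p p" using WA W by (simp add: H_def)
  have "mat_adjoint H = H"
  proof -
    have "mat_adjoint H = mat_adjoint W * mat_adjoint (mat_adjoint W * A)"
      unfolding H_def using W A by (intro mat_adjoint_mult) simp
    also have "mat_adjoint (mat_adjoint W * A) = A * W"
      using W A by (subst mat_adjoint_mult) (simp_all add: mat_adjoint_adjoint herm)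
    finally show ?thesis unfolding H_def using assoc_mult_mat[OF WH A W] by simp
  qed
  have \<eta>: "\<eta> = hermitian_eigenvalues H"
    unfolding \<eta>_def H_def using ritz_values_eq[OF A OW] by (simp add: T_def)
  obtain r where r: "diag_form p (\<lambda>z. Re ((H *\<^sub>v z) \<bullet>c z)) (\<lambda>j. \<eta> ! j) r"
    using hermitian_spectral[OF H \<open>mat_adjoint H = H\<close>] unfolding \<eta> by blast
  note R = diag_formD[OF r]
  define \<Psi> where "\<Psi> z = Re ((H *\<^sub>v z) \<bullet>c z) - \<mu> (n - 1) * norm_sq z" for z
  have \<Psi>: "diag_form p \<Psi> (\<lambda>j. \<eta> ! j - \<mu> (n - 1)) r"
    unfolding diag_form_def \<Psi>_def using R
    by (auto simp: norm_sq_coords[OF R(1)] left_diff_distrib sum_subtractf sum_distrib_left)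
  define S where "S = family_mat n i t"
  have S: "S \<in> carrier_mat n i" by (simp add: S_def)
  \<comment> \<open>\<open>L u\<close> are the coordinates of \<open>S u\<close> in the orthonormal basis \<open>W\<close> of the whole graph.\<close>
  define L where "L = mat_adjoint W * S"
  have L: "L \<in> carrier_mat p i" using WH S by (simp add: L_def)
  have WL: "W *\<^sub>v (L *\<^sub>v u) = S *\<^sub>v u" if u: "u \<in> carrier_vec i" for u
  proof -
    define u' where "u' = vec p (\<lambda>j. if j < i then u $ j else 0)"
    have "S *\<^sub>v u = T *\<^sub>v u'"
    proof (rule eq_vecI)
      fix a assume "a < dim_vec (T *\<^sub>v u')"
      hence a: "a < n" by (simp add: T_def)
      have "(T *\<^sub>v u') $ a = (\<Sum>j<p. t j $ a * u' $ j)"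
        using a by (simp add: T_def family_mat_def scalar_prod_def u'_def lessThan_atLeast0)
      also have "\<dots> = (\<Sum>j<p. if j < i then t j $ a * u $ j else 0)"
        by (intro sum.cong) (auto simp: u'_def)
      also have "\<dots> = (\<Sum>j\<in>{..<p} \<inter> {j. j < i}. t j $ a * u $ j)" by (simp add: sum.If_cases)
      also have "{..<p} \<inter> {j. j < i} = {..<i}" using le by auto
      also have "(\<Sum>j<i. t j $ a * u $ j) = (S *\<^sub>v u) $ a"
        using a u by (simp add: S_def family_mat_def scalar_prod_def lessThan_atLeast0)
      finally show "(S *\<^sub>v u) $ a = (T *\<^sub>v u') $ a" by simp
    qed (simp add: S_def T_def)
    hence "S *\<^sub>v u \<in> (\<lambda>z. T *\<^sub>v z) ` carrier_vec p" by (auto simp: u'_def)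
    then obtain c where c: "c \<in> carrier_vec p" "S *\<^sub>v u = W *\<^sub>v c" unfolding range[symmetric] by auto
    have "L *\<^sub>v u = mat_adjoint W *\<^sub>v (W *\<^sub>v c)"
      unfolding L_def using assoc_mult_mat_vec[OF WH S u] c(2) by simp
    also have "\<dots> = c" using assoc_mult_mat_vec[OF WH W c(1)] c(1) by (simp add: WW)
    finally show ?thesis using c(2) by simp
  qed
  have nW: "norm_sq (W *\<^sub>v c) = norm_sq c" if c: "c \<in> carrier_vec p" for c
  proof -
    have "(W *\<^sub>v c) \<bullet>c (W *\<^sub>v c) = c \<bullet>c (mat_adjoint W *\<^sub>v (W *\<^sub>v c))"
      using W c by (intro cscalar_adjoint) auto
    also have "mat_adjoint W *\<^sub>v (W *\<^sub>v c) = c"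
      using assoc_mult_mat_vec[OF WH W c] c by (simp add: WW)
    finally show ?thesis by (simp add: cscalar_self)
  qed
  have Lu: "L *\<^sub>v u \<in> carrier_vec p" if "u \<in> carrier_vec i" for u using L that by simp
  have nL: "norm_sq (L *\<^sub>v u) = norm_sq (S *\<^sub>v u)" if "u \<in> carrier_vec i" for u
    using nW[OF Lu[OF that]] WL[OF that] by simp
  have ti: "graph_family n p v i t" using graph_family_mono[OF t le(1)] .
  obtain g where g: "diag_form i (\<lambda>u. norm_sq (S *\<^sub>v u)) (\<lambda>j. 1 + gram_eigs (tail_mat n p v i t) ! j) g"
    using graph_spectral[OF v ti le] unfolding S_def by metis
  have G: "diag_form i (\<lambda>u. norm_sq (L *\<^sub>v u)) (\<lambda>j. 1 + gram_eigs (tail_mat n p v i t) ! j) g"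
    using g nL by (simp add: diag_form_def)
  have ge: "(\<Sum>j<i. (\<mu> j - \<mu> (n - 1)) * (cmod (u $ j))\<^sup>2) \<le> \<Psi> (L *\<^sub>v u)" if u: "u \<in> carrier_vec i" for u
  proof -
    have Sc: "S *\<^sub>v u \<in> carrier_vec n" using S u by simp
    have "(H *\<^sub>v (L *\<^sub>v u)) = mat_adjoint W *\<^sub>v (A *\<^sub>v (S *\<^sub>v u))"
      using assoc_mult_mat_vec[OF WA W Lu[OF u]] assoc_mult_mat_vec[OF WH A Sc] WL[OF u]
      by (simp add: H_def)
    hence "(H *\<^sub>v (L *\<^sub>v u)) \<bullet>c (L *\<^sub>v u) = (A *\<^sub>v (S *\<^sub>v u)) \<bullet>c (S *\<^sub>v u)"
      using cscalar_adjoint[OF WH _ Lu[OF u], of "A *\<^sub>v (S *\<^sub>v u)"] A Sc WL[OF u]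
      by (simp add: mat_adjoint_adjoint)
    hence "\<Psi> (L *\<^sub>v u) = (\<Sum>a<n. (\<mu> a - \<mu> (n - 1)) * (cmod ((S *\<^sub>v u) \<bullet>c v a))\<^sup>2)"
      using eigenfamily_form[OF A v Av herm Sc] nL[OF u] norm_sq_coords[OF v Sc]
      by (simp add: \<Psi>_def left_diff_distrib sum_subtractf sum_distrib_left)
    also have "\<dots> = (\<Sum>j<i. (\<mu> j - \<mu> (n - 1)) * (cmod (u $ j))\<^sup>2) +
        (\<Sum>a<n - p. (\<mu> (p + a) - \<mu> (n - 1)) * (cmod ((tail_mat n p v i t *\<^sub>v u) $ a))\<^sup>2)"
      unfolding S_def by (rule graph_form[OF v ti le u])
    finally have "\<Psi> (L *\<^sub>v u) = \<dots>" .
    moreover have "0 \<le> (\<Sum>a<n - p. (\<mu> (p + a) - \<mu> (n - 1)) * (cmod ((tail_mat n p v i t *\<^sub>v u) $ a))\<^sup>2)"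
      using \<mu> by (intro sum_nonneg mult_nonneg_nonneg) auto
    ultimately show ?thesis by simp
  qed
  have "(\<forall>j<i. 0 < \<eta> ! j - \<mu> (n - 1)) \<and>
      (\<Sum>j\<in>J. (\<mu> j - \<mu> (n - 1)) / (\<eta> ! j - \<mu> (n - 1))) \<le> (\<Sum>l<card J. 1 + gram_eigs (tail_mat n p v i t) ! l)"
  proof (rule sum_ratio_le_top_eigenvalues[OF L le(1) G \<Psi> _ _ ge J])
    show "\<mu> j - \<mu> (n - 1) \<le> \<mu> i' - \<mu> (n - 1)" if "i' \<le> j" "j < i" for i' j using \<mu>[of i' j] that le by simp
    show "0 < \<mu> j - \<mu> (n - 1)" if "j < i" for j using gap[of j] that le by simp
  qed
  hence h: "\<And>j. j < i \<Longrightarrow> 0 < \<eta> ! j - \<mu> (n - 1)"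
    and le': "(\<Sum>j\<in>J. (\<mu> j - \<mu> (n - 1)) / (\<eta> ! j - \<mu> (n - 1))) \<le> real (card J) + (\<Sum>l<card J. gram_eigs (tail_mat n p v i t) ! l)"
    by (auto simp: sum.distrib)
  have "(\<Sum>j\<in>J. (\<mu> j - \<eta> ! j) / (\<eta> ! j - \<mu> (n - 1))) = (\<Sum>j\<in>J. (\<mu> j - \<mu> (n - 1)) / (\<eta> ! j - \<mu> (n - 1)) - 1)"
  proof (intro sum.cong refl)
    fix j assume "j \<in> J"
    hence "0 < \<eta> ! j - \<mu> (n - 1)" using h J by auto
    thus "(\<mu> j - \<eta> ! j) / (\<eta> ! j - \<mu> (n - 1)) = (\<mu> j - \<mu> (n - 1)) / (\<eta> ! j - \<mu> (n - 1)) - 1"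
      by (simp add: field_simps)
  qed
  also have "\<dots> \<le> (\<Sum>l<card J. gram_eigs (tail_mat n p v i t) ! l)"
    using le' by (simp add: sum_subtractf)
  finally show ?thesis .
qed

section \<open>Biorthogonal basis and convergence estimate\<close>

text \<open>The \<open>k\<close> largest entries of \<open>a\<close> sit at some \<open>k\<close> positions, so bounds for all index sets avoid
  sorting \<open>a\<close>.\<close>

lemma weakly_majorizedI:
  assumes len: "length a = length b" and b: "\<And>i j. i \<le> j \<Longrightarrow> j < length b \<Longrightarrow> b ! j \<le> b ! i"
    and J: "\<And>J. J \<subseteq> {..<length b} \<Longrightarrow> J \<noteq> {} \<Longrightarrow> (\<Sum>j\<in>J. a ! j) \<le> (\<Sum>l<card J. b ! l)"
  shows "a \<prec>\<^sub>w b"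
proof -
  obtain \<pi> where \<pi>: "\<pi> permutes {..<length a}" "\<And>j. j < length a \<Longrightarrow> decreasing a ! j = a ! \<pi> j"
    using decreasing_permutes[of a] by auto
  have sum_take: "sum_list (take k l) = (\<Sum>j<k. l ! j)" if "k \<le> length l" for k and l :: "real list"
    using that by (simp add: sum_list_sum_nth atLeast0LessThan min_absorb1)
  have "sum_list (take k (decreasing a)) \<le> sum_list (take k (decreasing b))" if k: "k \<in> {1..length a}" for k
  proof -
    have inj: "inj_on \<pi> {..<k}" using permutes_inj[OF \<pi>(1)] by (rule inj_on_subset) simp
    have "sum_list (take k (decreasing a)) = (\<Sum>j<k. a ! \<pi> j)"
      using k by (simp add: sum_take \<pi>(2))
    also have "\<dots> = (\<Sum>j\<in>\<pi> ` {..<k}. a ! j)" by (simp add: sum.reindex[OF inj])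
    also have "\<dots> \<le> (\<Sum>l<card (\<pi> ` {..<k}). b ! l)"
    proof (rule J)
      show "\<pi> ` {..<k} \<subseteq> {..<length b}"
        using permutes_in_image[OF \<pi>(1)] k len by fastforce
      show "\<pi> ` {..<k} \<noteq> {}" using k by (auto simp: lessThan_empty_iff)
    qed
    also have "\<dots> = sum_list (take k (decreasing b))"
      using k len b decreasing_eqI[of b b] by (simp add: card_image[OF inj] sum_take)
    finally show ?thesis .
  qed
  thus ?thesis using len by (simp add: weakly_majorized_def)
qed

lemma image_atLeast1_atMost: "h ` {1..i} = (\<lambda>j. h (Suc j)) ` {..<i}"
  unfolding image_Suc_lessThan[symmetric] by (rule image_image)

lemma mat_of_cols_shift: "mat_of_cols n (map x [1..<Suc p]) = family_mat n p (\<lambda>j. x (Suc j))"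
  by (rule eq_matI) (auto simp: family_mat_def mat_of_cols_index nth_upt simp del: upt_Suc)

text \<open>The biorthogonality relations are exactly the normalisation required by \<open>graph_family\<close>. The angle
  condition makes all cosines nonzero, hence \<open>X\<^sup>H W\<close> is invertible and the biorthogonal basis exists.\<close>

lemma biorthogonal_basis_graph:
  assumes x: "orthonormal n n (\<lambda>j. x (Suc j))" and p: "1 \<le> p" "p \<le> n"
    and Y: "csubspace_of n Y" "csubspace_dim n Y = p"
    and angle: "largest_angle n (cspan n (x ` {1..p})) Y < pi / 2"
  defines "y \<equiv> (\<lambda>j. biorthogonal_basis n p x Y (Suc j))"
  shows "graph_family n p (\<lambda>j. x (Suc j)) p y" "Y = (\<lambda>z. family_mat n p y *\<^sub>v z) ` carrier_vec p"
proof -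
  define v where "v j = x (Suc j)" for j
  obtain W where W: "W \<in> carrier_mat n p" and OW: "orthonormal_basis_mat n Y W"
    using subspace_orthonormal_basis[OF Y] .
  define X where "X = family_mat n p v"
  have X: "X \<in> carrier_mat n p" "mat_adjoint X \<in> carrier_mat p n" by (auto simp: X_def)
  have WH: "mat_adjoint W \<in> carrier_mat p n" using W by auto
  have vp: "orthonormal n p v" using x p(2) by (auto simp: orthonormal_def v_def)
  have OX: "orthonormal_basis_mat n (cspan n (x ` {1..p})) X"
    unfolding X_def image_atLeast1_atMost v_def[symmetric]
    by (rule orthonormal_basis_matI[OF vp cspan_image]) (rule orthonormal_carrier[OF vp])
  define N where "N = mat_adjoint W * X"
  have N: "N \<in> carrier_mat p p" using WH X by (simp add: N_def)
  obtain r where r: "length (gram_eigs N) = p" "diag_form p (\<lambda>z. norm_sq (N *\<^sub>v z)) (\<lambda>j. gram_eigs N ! j) r"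
    using gram_spectral[OF N] by blast
  define as where "as = map arccos (singular_values N)"
  have len: "length as = p" using r(1) by (simp add: as_def singular_values_def)
  have "decreasing as ! 0 < pi / 2"
    using angle principal_angles_eq[OF OX OW] p(1) len
    by (simp add: largest_angle_def N_def as_def hd_conv_nth flip: length_greater_0_conv)
  moreover have "as ! j \<le> decreasing as ! 0" if "j < p" for j
  proof -
    have "as ! j \<in> set (decreasing as)" using that len by (simp add: decreasing_def)
    then obtain i where "i < p" "decreasing as ! i = as ! j" using len by (auto simp: in_set_conv_nth)
    thus ?thesis using decreasing_antimono[of 0 i as] len by simp
  qed
  \<comment> \<open>A vanishing singular value would contribute the angle \<open>arccos 0 = pi / 2\<close>.\<close>
  ultimately have small: "arccos (sqrt (gram_eigs N ! j)) < pi / 2" if "j < p" for j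
    using that r(1) by (force simp: as_def singular_values_def)
  have g0: "gram_eigs N ! j \<noteq> 0" if "j < p" for j using small[OF that] by auto
  have gpos: "0 < gram_eigs N ! j" if "j < p" for j
    using g0[OF that] diag_form_basis[OF r(2) that] norm_sq_nonneg by (metis less_le)
  have "det N \<noteq> 0"
  proof
    assume "det N = 0"
    then obtain z where z: "z \<in> carrier_vec p" "z \<noteq> 0\<^sub>v p" "N *\<^sub>v z = 0\<^sub>v p"
      using det_0_iff_vec_prod_zero_field[OF N] by auto
    have "0 = norm_sq (N *\<^sub>v z)" using z(3) by (simp add: norm_sq_def)
    also have "\<dots> = (\<Sum>j<p. gram_eigs N ! j * (cmod (z \<bullet>c r j))\<^sup>2)" by (rule diag_formD(3)[OF r(2) z(1)])
    finally have "\<forall>j\<in>{..<p}. gram_eigs N ! j * (cmod (z \<bullet>c r j))\<^sup>2 = 0"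
      using gpos by (subst (asm) eq_commute, subst (asm) sum_nonneg_eq_0_iff) (auto simp: less_imp_le)
    hence "norm_sq z = 0" using g0 by (simp add: norm_sq_coords[OF diag_formD(1)[OF r(2)] z(1)])
    with norm_sq_pos[OF z(1,2)] show False by simp
  qed
  then obtain D where D: "D \<in> carrier_mat p p" "D * N = 1\<^sub>m p"
    using det_non_zero_imp_unit[OF N, of "()"] by (auto simp: Units_def ring_mat_def)
  define C where "C = mat_adjoint D"
  have C: "C \<in> carrier_mat p p" using D by (auto simp: C_def)
  have DH: "mat_adjoint (D * N) = mat_adjoint N * C"
    unfolding C_def by (rule mat_adjoint_mult) (use D N in simp)
  have "mat_adjoint N = mat_adjoint X * W"
    unfolding N_def using W X by (subst mat_adjoint_mult) (simp_all add: mat_adjoint_adjoint)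
  moreover have "mat_adjoint (1\<^sub>m p :: complex mat) = 1\<^sub>m p"
    by (rule eq_matI) (auto simp: mat_adjoint_index)
  ultimately have XWC: "mat_adjoint X * W * C = 1\<^sub>m p" using DH D(2) by simp
  have XW: "mat_adjoint X * W \<in> carrier_mat p p" using X W by simp
  have CXW: "C * (mat_adjoint X * W) = 1\<^sub>m p"
    by (rule mat_mult_left_right_inverse[OF XW C XWC])
  have yj: "y j = W *\<^sub>v col C j" if "j < p" for j
    using biorthogonal_basis_eq[OF OW _ _ C, of "Suc j" x] W XWC that
    by (simp add: y_def mat_of_cols_shift[unfolded One_nat_def] X_def v_def[abs_def] del: upt_Suc)
  have yc: "y j \<in> carrier_vec n" if "j < p" for j using yj[OF that] W C
      mult_mat_vec_carrier[OF W, of "col C j"] by (simp add: carrier_vecI)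
  have Yb: "family_mat n p y = W * C"
  proof (rule mat_col_eqI)
    fix j assume "j < dim_col (W * C)"
    hence j: "j < p" using C by simp
    have "col (family_mat n p y) j = y j" using j yc[OF j] by (rule col_family_mat)
    thus "col (family_mat n p y) j = col (W * C) j"
      using col_mult2[OF W C j] yj[OF j] by simp
  qed (use W C in auto)
  show "graph_family n p (\<lambda>j. x (Suc j)) p y"
    unfolding graph_family_def v_def[symmetric]
  proof (intro allI impI conjI yc)
    fix j a assume j: "j < p" and a: "a < p"
    have "y j \<bullet>c v a = (mat_adjoint X *\<^sub>v y j) $ a"
      unfolding X_def using a orthonormal_carrier[OF vp a] yc[OF j] by (intro adjoint_family_mat_index[symmetric]) auto
    also have "mat_adjoint X *\<^sub>v y j = (mat_adjoint X * W) *\<^sub>v col C j"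
      using assoc_mult_mat_vec[OF X(2) W, of "col C j"] C j by (simp add: yj)
    also have "\<dots> = col (mat_adjoint X * W * C) j"
      by (rule col_mult2[OF XW C j, symmetric])
    also have "\<dots> $ a = (if a = j then 1 else 0)" using a j by (simp add: XWC)
    finally show "y j \<bullet>c v a = (if a = j then 1 else 0)" .
  qed
  have YW: "Y = (\<lambda>z. W *\<^sub>v z) ` carrier_vec p"
    using OW col_space_image[OF W] by (simp add: orthonormal_basis_mat_def)
  show "Y = (\<lambda>z. family_mat n p y *\<^sub>v z) ` carrier_vec p"
    unfolding YW Yb
  proof (intro equalityI subsetI)
    fix w assume "w \<in> (\<lambda>z. W *\<^sub>v z) ` carrier_vec p"
    then obtain z where z: "z \<in> carrier_vec p" "w = W *\<^sub>v z" by blast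
    define u where "u = mat_adjoint X * W *\<^sub>v z"
    have u: "u \<in> carrier_vec p" unfolding u_def using XW z(1) by (rule mult_mat_vec_carrier)
    have "C *\<^sub>v u = z" unfolding u_def using assoc_mult_mat_vec[OF C XW z(1)] z(1) by (simp add: CXW)
    hence "w = W * C *\<^sub>v u" using assoc_mult_mat_vec[OF W C u] z by simp
    thus "w \<in> (\<lambda>z. W * C *\<^sub>v z) ` carrier_vec p" using u by blast
  next
    fix w assume "w \<in> (\<lambda>z. W * C *\<^sub>v z) ` carrier_vec p"
    then obtain z where z: "z \<in> carrier_vec p" "w = W * C *\<^sub>v z" by blast
    thus "w \<in> (\<lambda>z. W *\<^sub>v z) ` carrier_vec p"
      using assoc_mult_mat_vec[OF W C z(1)] C by auto
  qed
qed

lemma matrix_function_cscalar: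
  assumes x: "orthonormal n n (\<lambda>j. x (Suc j))" and w: "w \<in> carrier_vec n" and k: "k < n"
  shows "(matrix_function n lam x f *\<^sub>v w) \<bullet>c x (Suc k) = f (lam (Suc k)) * (w \<bullet>c x (Suc k))"
proof -
  have xc: "x (Suc j) \<in> carrier_vec n" if "j < n" for j using orthonormal_carrier[OF x that] by simp
  have eq: "(matrix_function n lam x f *\<^sub>v w) $ r = (\<Sum>j<n. f (lam (Suc j)) * (w \<bullet>c x (Suc j)) * x (Suc j) $ r)"
    if r: "r < n" for r
  proof -
    have "(matrix_function n lam x f *\<^sub>v w) $ r
        = (\<Sum>c<n. \<Sum>j<n. f (lam (Suc j)) * (w $ c * cnj (x (Suc j) $ c)) * x (Suc j) $ r)"
      using r w by (simp add: matrix_function_def scalar_prod_def lessThan_atLeast0 sum_distrib_left sum_distrib_right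
          sum.atLeast1_atMost_eq[unfolded One_nat_def] mult_ac)
    also have "\<dots> = (\<Sum>j<n. \<Sum>c<n. f (lam (Suc j)) * (w $ c * cnj (x (Suc j) $ c)) * x (Suc j) $ r)"
      by (rule sum.swap)
    also have "\<dots> = (\<Sum>j<n. f (lam (Suc j)) * (w \<bullet>c x (Suc j)) * x (Suc j) $ r)"
      using xc by (intro sum.cong refl)
        (auto simp: scalar_prod_def lessThan_atLeast0 sum_distrib_left sum_distrib_right carrier_vecD[OF xc])
    finally show ?thesis .
  qed
  define g where "g j = f (lam (Suc j)) * (w \<bullet>c x (Suc j))" for j
  have "matrix_function n lam x f *\<^sub>v w = family_mat n n (\<lambda>j. x (Suc j)) *\<^sub>v vec n g"
  proof (rule eq_vecI)
    fix r assume "r < dim_vec (family_mat n n (\<lambda>j. x (Suc j)) *\<^sub>v vec n g)"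
    hence r: "r < n" by simp
    show "(matrix_function n lam x f *\<^sub>v w) $ r = (family_mat n n (\<lambda>j. x (Suc j)) *\<^sub>v vec n g) $ r"
      unfolding eq[OF r] g_def[symmetric] using r
      by (simp add: family_mat_def scalar_prod_def lessThan_atLeast0 mult.commute)
  qed (simp add: matrix_function_def)
  hence "(matrix_function n lam x f *\<^sub>v w) \<bullet>c x (Suc k)
      = (\<Sum>j<n. g j * (x (Suc j) \<bullet>c x (Suc k)))"
    using family_mat_mult_cscalar[of n "\<lambda>j. x (Suc j)" n "x (Suc k)"] xc k by simp
  also have "\<dots> = (\<Sum>j<n. if j = k then g j else 0)"
    using x k by (intro sum.cong refl) (auto simp: orthonormal_def)
  finally show ?thesis using k by (simp add: g_def)
qed

text \<open>Rescaling the columns is what turns the image of a graph under \<open>f(A)\<close> into a graph with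
  normalised columns again.\<close>

lemma family_mat_scaled_range:
  fixes F :: "complex mat"
  assumes F: "F \<in> carrier_mat n n" and y: "\<And>j. j < p \<Longrightarrow> y j \<in> carrier_vec n" and c: "\<And>j. j < p \<Longrightarrow> c j \<noteq> 0"
  shows "(\<lambda>w. F *\<^sub>v w) ` (\<lambda>z. family_mat n p y *\<^sub>v z) ` carrier_vec p =
    (\<lambda>z. family_mat n p (\<lambda>j. c j \<cdot>\<^sub>v (F *\<^sub>v y j)) *\<^sub>v z) ` carrier_vec p"
proof -
  define G where "G z = vec p (\<lambda>j. c j * z $ j)" for z
  have FY: "F * family_mat n p y = family_mat n p (\<lambda>j. F *\<^sub>v y j)"
  proof (rule mat_col_eqI)
    fix j assume "j < dim_col (family_mat n p (\<lambda>j. F *\<^sub>v y j))"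
    hence j: "j < p" by simp
    show "col (F * family_mat n p y) j = col (family_mat n p (\<lambda>j. F *\<^sub>v y j)) j"
      using j F y[OF j] by (simp add: col_mult2[of _ n n _ p] col_family_mat)
  qed (use F in auto)
  have *: "family_mat n p (\<lambda>j. c j \<cdot>\<^sub>v (F *\<^sub>v y j)) *\<^sub>v z = F *\<^sub>v (family_mat n p y *\<^sub>v G z)" if z: "z \<in> carrier_vec p" for z
  proof -
    have "F *\<^sub>v (family_mat n p y *\<^sub>v G z) = family_mat n p (\<lambda>j. F *\<^sub>v y j) *\<^sub>v G z"
      using assoc_mult_mat_vec[OF F family_mat_carrier(1), of "G z" p y] by (simp add: FY G_def)
    also have "\<dots> = family_mat n p (\<lambda>j. c j \<cdot>\<^sub>v (F *\<^sub>v y j)) *\<^sub>v z"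
      using z F by (intro eq_vecI) (auto simp: family_mat_def G_def scalar_prod_def mult_ac intro!: sum.cong)
    finally show ?thesis by simp
  qed
  have "G ` carrier_vec p = carrier_vec p"
  proof (intro equalityI subsetI)
    fix z :: "complex vec" assume z: "z \<in> carrier_vec p"
    have "z = G (vec p (\<lambda>j. z $ j / c j))" using z c by (intro eq_vecI) (auto simp: G_def)
    thus "z \<in> G ` carrier_vec p" by (metis imageI vec_carrier)
  qed (auto simp: G_def)
  hence "(\<lambda>w. F *\<^sub>v w) ` (\<lambda>z. family_mat n p y *\<^sub>v z) ` carrier_vec p
      = (\<lambda>w. F *\<^sub>v w) ` (\<lambda>z. family_mat n p y *\<^sub>v z) ` G ` carrier_vec p" by simp
  also have "\<dots> = (\<lambda>z. family_mat n p (\<lambda>j. c j \<cdot>\<^sub>v (F *\<^sub>v y j)) *\<^sub>v z) ` carrier_vec p"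
    unfolding image_image by (intro image_cong refl) (simp add: *)
  finally show ?thesis .
qed

theorem theorem3p8:
  fixes n p :: nat
    and A :: "complex mat"
    and lam :: "nat \<Rightarrow> real"
    and x y :: "nat \<Rightarrow> complex vec"
    and X Y Y' :: "complex vec set"
    and f :: "real \<Rightarrow> complex"
    and eta :: "real list"
  assumes A_dim: "A \<in> carrier_mat n n"
    and A_herm: "mat_adjoint A = A"
    and x_dim: "\<And>j. j \<in> {1..n} \<Longrightarrow> x j \<in> carrier_vec n"
    and x_eigen: "\<And>j. j \<in> {1..n} \<Longrightarrow> A *\<^sub>v x j = complex_of_real (lam j) \<cdot>\<^sub>v x j"
    and x_orthonormal:
      "\<And>j k. j \<in> {1..n} \<Longrightarrow> k \<in> {1..n} \<Longrightarrow> x j \<bullet>c x k = (if j = k then 1 else 0)"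
    and lam_decreasing: "\<And>j k. 1 \<le> j \<Longrightarrow> j \<le> k \<Longrightarrow> k \<le> n \<Longrightarrow> lam k \<le> lam j"
    and p_pos: "1 \<le> p" and p_le: "2 * p \<le> n"
    and gap: "lam p > lam (p + 1)"
    and X_def: "X = cspan n (x ` {1..p})"
    and Y_subspace: "csubspace_of n Y" and Y_dim: "csubspace_dim n Y = p"
    and angle: "largest_angle n X Y < pi / 2"
    and f_sep: "Max ((\<lambda>j. cmod (f (lam j))) ` {p+1..n}) < Min ((\<lambda>j. cmod (f (lam j))) ` {1..p})"
    and Y'_def: "Y' = (\<lambda>v. matrix_function n lam x f *\<^sub>v v) ` Y"
    and eta_def: "eta = ritz_values n A Y'"
    and y_def: "y = biorthogonal_basis n p x Y"
  shows "\<forall>i\<in>{1..p}.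
    let Xi = cspan n (x ` {1..i});
        Yi = cspan n (y ` {1..i});
        Phi_i = decreasing (map (\<lambda>j. inverse (cmod (f (lam j)))) [1..<i+1]);
        Phihat = decreasing (map (\<lambda>j. cmod (f (lam j))) [p+1..<n+1]);
        Phihat_i = take i Phihat;
        Theta_i = take i (principal_angles n X Y);
        bound = tuple_square Phi_i \<circledast> tuple_square Phihat_i
                  \<circledast> tuple_square (map tan (principal_angles n Xi Yi))
    in map (\<lambda>j. (lam j - eta ! (j - 1)) / (eta ! (j - 1) - lam n)) [1..<i+1] \<prec>\<^sub>w bound
       \<and> list_all2 (\<le>) bound
           (tuple_square Phi_i \<circledast> tuple_square Phihat_i \<circledast> tuple_square (map tan Theta_i))"
proof
  fix i assume i: "i \<in> {1..p}"
  define v \<mu> fv yv where "v j = x (Suc j)" and "\<mu> j = lam (Suc j)" and "fv j = f (lam (Suc j))"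
    and "yv j = y (Suc j)" for j
  have v: "orthonormal n n v"
    using x_dim x_orthonormal by (auto simp: orthonormal_def v_def)
  have pn: "p \<le> n" "1 \<le> n" and ir: "i \<le> n - p" "i \<le> p" using p_pos p_le i by auto
  have Av: "A *\<^sub>v v j = complex_of_real (\<mu> j) \<cdot>\<^sub>v v j" if "j < n" for j
    using x_eigen[of "Suc j"] that by (simp add: v_def \<mu>_def)
  have \<mu>: "\<mu> k \<le> \<mu> j" if "j \<le> k" "k < n" for j k
    using lam_decreasing[of "Suc j" "Suc k"] that by (simp add: \<mu>_def)
  have gap': "\<mu> (n - 1) < \<mu> j" if "j < p" for j
  proof -
    have "\<mu> (n - 1) \<le> \<mu> p" by (rule \<mu>) (use p_pos p_le in auto)
    moreover have "\<mu> (p - 1) \<le> \<mu> j" by (rule \<mu>) (use that pn p_pos in auto)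
    ultimately show ?thesis using gap p_pos by (simp add: \<mu>_def)
  qed
  have f0: "fv j \<noteq> 0" if "j < p" for j
  proof -
    have "0 \<le> Max ((\<lambda>j. cmod (f (lam j))) ` {p+1..n})"
      using p_pos p_le by (intro Max_ge_iff[THEN iffD2]) auto
    also note f_sep
    also have "Min ((\<lambda>j. cmod (f (lam j))) ` {1..p}) \<le> cmod (fv j)"
      unfolding fv_def using that by (intro Min_le) auto
    finally show ?thesis by auto
  qed
  have x': "orthonormal n n (\<lambda>j. x (Suc j))" using v by (simp add: v_def[abs_def])
  note bio = biorthogonal_basis_graph[OF x' p_pos pn(1) Y_subspace Y_dim angle[unfolded X_def]]
  have yg: "graph_family n p v p yv" and Yr: "Y = (\<lambda>z. family_mat n p yv *\<^sub>v z) ` carrier_vec p"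
    using bio by (simp_all add: v_def[abs_def] yv_def[abs_def] y_def)
  have yc: "yv j \<in> carrier_vec n" if "j < p" for j using yg that by (simp add: graph_family_def)
  define F where "F = matrix_function n lam x f"
  have F: "F \<in> carrier_mat n n" by (simp add: F_def matrix_function_def)
  have Fv: "(F *\<^sub>v w) \<bullet>c v k = fv k * (w \<bullet>c v k)" if "w \<in> carrier_vec n" "k < n" for w k
    using matrix_function_cscalar[OF x' that] by (simp add: F_def v_def fv_def)
  \<comment> \<open>\<open>f(A)\<close> multiplies the \<open>j\<close>-th eigencoordinate by \<open>fv j\<close>; dividing by it restores the leading \<open>1\<close>.\<close>
  define t where "t j = inverse (fv j) \<cdot>\<^sub>v (F *\<^sub>v yv j)" for j
  have tv: "t j \<bullet>c v k = fv k * (yv j \<bullet>c v k) * inverse (fv j)" if "j < p" "k < n" for j k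
    using F yc[OF that(1)] orthonormal_carrier[OF v that(2)] Fv[OF yc[OF that(1)] that(2)] by (simp add: t_def)
  have tg: "graph_family n p v p t"
    using yg F yc tv f0 pn by (auto simp: graph_family_def) (simp_all add: t_def)
  have Y'r: "Y' = (\<lambda>z. family_mat n p t *\<^sub>v z) ` carrier_vec p"
    unfolding Y'_def Yr F_def[symmetric] t_def[abs_def]
    by (rule family_mat_scaled_range[OF F yc]) (simp_all add: f0)
  define B where "B k = tail_mat n p v k yv" for k
  define b where "b k j = gram_eigs (B k) ! j" for k j
  have B: "B k \<in> carrier_mat (n - p) k" for k by (simp add: B_def)
  have tail: "tail_mat n p v i t = mat (n - p) i (\<lambda>(a, j). fv (p + a) * B i $$ (a, j) * inverse (fv j))"
    by (rule eq_matI) (use ir tv in \<open>auto simp: tail_mat_def B_def\<close>)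
  define Phi where "Phi = decreasing (map (\<lambda>j. cmod (inverse (fv j))) [0..<i])"
  define Phihat where "Phihat = decreasing (map (\<lambda>a. cmod (fv (p + a))) [0..<n - p])"
  have Phi: "decreasing (map (\<lambda>j. inverse (cmod (f (lam j)))) [1..<i+1]) = Phi"
    unfolding Phi_def by (rule arg_cong[of _ _ decreasing], rule nth_equalityI)
      (auto simp: fv_def norm_inverse simp del: upt_Suc)
  have Phihat: "decreasing (map (\<lambda>j. cmod (f (lam j))) [p+1..<n+1]) = Phihat"
    unfolding Phihat_def by (rule arg_cong[of _ _ decreasing], rule nth_equalityI)
      (auto simp: fv_def simp del: upt_Suc)
  have angles: "principal_angles n (cspan n (x ` {1..k})) (cspan n (y ` {1..k}))
      = map (\<lambda>j. arccos (sqrt (1 / (1 + b k j)))) [0..<k]" if "k \<le> p" for k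
  proof -
    have "cspan n (x ` {1..k}) = (\<lambda>z. family_mat n k v *\<^sub>v z) ` carrier_vec k"
      unfolding image_atLeast1_atMost v_def[symmetric]
      using that pn orthonormal_carrier[OF v] by (intro cspan_image) auto
    moreover have "cspan n (y ` {1..k}) = (\<lambda>z. family_mat n k yv *\<^sub>v z) ` carrier_vec k"
      unfolding image_atLeast1_atMost yv_def[symmetric]
      using that yc by (intro cspan_image) auto
    ultimately show ?thesis
      using graph_angles[OF v graph_family_mono[OF yg that] that pn(1)] by (simp add: b_def B_def)
  qed
  have "Y = cspan n (y ` {1..p})"
    unfolding image_atLeast1_atMost yv_def[symmetric] Yr using yc by (intro cspan_image[symmetric]) auto
  hence anglesXY: "principal_angles n X Y = map (\<lambda>j. arccos (sqrt (1 / (1 + b p j)))) [0..<p]"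
    using angles[of p] by (simp add: X_def)
  have b0: "0 \<le> b k j" and bm: "l \<le> j \<Longrightarrow> b k j \<le> b k l" if "k \<le> p" "j < k" for k j l
    using graph_spectral[OF v graph_family_mono[OF yg that(1)] that(1) pn(1)] that(2)
    unfolding b_def B_def by metis+
  have mono: "b i j \<le> b p j" if "j < i" for j
    unfolding b_def B_def by (rule gram_eigs_tail_mono[OF that ir(2)])
  \<comment> \<open>\<open>W i\<close> is the first bound and \<open>W p\<close> the second one.\<close>
  define W where "W k = tuple_square Phi \<circledast> tuple_square (take i Phihat) \<circledast>
      tuple_square (map tan (map (\<lambda>j. arccos (sqrt (1 / (1 + b k j)))) [0..<i]))" for k
  have lenW: "length (W k) = i" for k using ir by (simp add: W_def Phi_def Phihat_def)
  have Wj: "W k ! j = (Phi ! j)\<^sup>2 * (Phihat ! j)\<^sup>2 * b k j" if "j < i" "i \<le> k" "k \<le> p" for k j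
    using that ir b0[of k j] by (simp add: W_def Phi_def Phihat_def tan_arccos_sqrt)
  have Phi0: "0 \<le> Phi ! j" if "j < i" for j
  proof -
    have "Phi ! j \<in> set Phi" using that by (intro nth_mem) (simp add: Phi_def)
    thus ?thesis by (auto simp: Phi_def decreasing_def)
  qed
  have Phihat0: "0 \<le> Phihat ! j" if "j < i" for j
  proof -
    have "Phihat ! j \<in> set Phihat" using that ir by (intro nth_mem) (simp add: Phihat_def)
    thus ?thesis by (auto simp: Phihat_def decreasing_def)
  qed
  have "map (\<lambda>j. (lam j - eta ! (j - 1)) / (eta ! (j - 1) - lam n)) [1..<i+1] \<prec>\<^sub>w W i"
  proof (rule weakly_majorizedI)
    show "W i ! k \<le> W i ! j" if "j \<le> k" "k < length (W i)" for j k
    proof -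
      have k: "k < i" "j < i" using that lenW by auto
      have "(Phi ! k)\<^sup>2 \<le> (Phi ! j)\<^sup>2" "(Phihat ! k)\<^sup>2 \<le> (Phihat ! j)\<^sup>2" "b i k \<le> b i j"
        using k that(1) Phi0 Phihat0 bm[of i k j] ir decreasing_antimono[of j k]
        by (auto simp: Phi_def Phihat_def intro!: power_mono)
      thus ?thesis using k ir b0[of i k] by (simp add: Wj mult_mono)
    qed
    fix J assume "J \<subseteq> {..<length (W i)}" "J \<noteq> {}"
    hence J: "J \<subseteq> {..<i}" "J \<noteq> {}" by (simp_all add: lenW)
    have cJ: "card J \<le> i" using card_mono[OF _ J(1)] by simp
    have "(\<Sum>j\<in>J. map (\<lambda>j. (lam j - eta ! (j - 1)) / (eta ! (j - 1) - lam n)) [1..<i+1] ! j)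
        = (\<Sum>j\<in>J. (\<mu> j - eta ! j) / (eta ! j - \<mu> (n - 1)))"
      using J(1) pn by (intro sum.cong refl) (auto simp: \<mu>_def simp del: upt_Suc)
    also have "\<dots> \<le> (\<Sum>l<card J. gram_eigs (tail_mat n p v i t) ! l)"
      unfolding eta_def Y'r by (rule graph_ritz[OF A_dim A_herm v Av \<mu> tg ir(2) pn(1) gap' J])
    also have "\<dots> \<le> (\<Sum>l<card J. (Phi ! l)\<^sup>2 * (Phihat ! l)\<^sup>2 * gram_eigs (B i) ! l)"
      unfolding tail Phi_def Phihat_def by (rule gram_eigs_scaled[OF B ir(1) cJ])
    also have "\<dots> = (\<Sum>l<card J. W i ! l)"
      using cJ ir by (intro sum.cong refl) (simp add: Wj b_def)
    finally show "(\<Sum>j\<in>J. map (\<lambda>j. (lam j - eta ! (j - 1)) / (eta ! (j - 1) - lam n)) [1..<i+1] ! j)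
        \<le> (\<Sum>l<card J. W i ! l)" .
  qed (simp add: lenW)
  moreover have "list_all2 (\<le>) (W i) (W p)"
    unfolding list_all2_conv_all_nth using ir Phi0 Phihat0 mono
    by (auto simp: lenW Wj intro!: mult_left_mono)
  moreover have "W p = tuple_square Phi \<circledast> tuple_square (take i Phihat) \<circledast>
      tuple_square (map tan (take i (principal_angles n X Y)))"
    using ir by (simp add: W_def anglesXY take_map)
  moreover have "W i = tuple_square Phi \<circledast> tuple_square (take i Phihat) \<circledast>
      tuple_square (map tan (principal_angles n (cspan n (x ` {1..i})) (cspan n (y ` {1..i}))))"
    using angles[OF ir(2)] by (simp add: W_def)
  ultimately show "let Xi = cspan n (x ` {1..i});
        Yi = cspan n (y ` {1..i});
        Phi_i = decreasing (map (\<lambda>j. inverse (cmod (f (lam j)))) [1..<i+1]);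
        Phihat = decreasing (map (\<lambda>j. cmod (f (lam j))) [p+1..<n+1]);
        Phihat_i = take i Phihat;
        Theta_i = take i (principal_angles n X Y);
        bound = tuple_square Phi_i \<circledast> tuple_square Phihat_i
                  \<circledast> tuple_square (map tan (principal_angles n Xi Yi))
    in map (\<lambda>j. (lam j - eta ! (j - 1)) / (eta ! (j - 1) - lam n)) [1..<i+1] \<prec>\<^sub>w bound
       \<and> list_all2 (\<le>) bound
           (tuple_square Phi_i \<circledast> tuple_square Phihat_i \<circledast> tuple_square (map tan Theta_i))"
    unfolding Let_def Phi Phihat by simp
qed

end
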